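(* Let $n\ge1$ and $p\in(1,2]$. There exists a constant $C>0$, depending only on $n$ and $p$, such that the following holds. Let $\Omega\subset\mathbb{R}^{2n+1}$ be a bounded open set with smooth boundary containing the origin, let $\psi:\mathbb{H}^n\to\mathbb{R}$ have continuous horizontal derivatives up to second order, let $\Omega_\star\Supset\Omega$ be a smooth domain, let $u_\star\in W^{1,p}_{\mathbb{H}^n}(\Omega_\star)\cap L^\infty(\Omega_\star)$, let $R\in(0,1)$ with $\mathcal{B}_R\Subset\Omega$, and let $\varepsilon>0$. Let $\bar u_0$ be the minimizer of $\int_\Omega|\nabla_{\mathbb{H}^n}u|^p$ over $$\{u\in W^{1,p}_{\mathbb{H}^n}(\Omega):\ u\le\psi,\ u-u_\star\in W^{1,p}_{\mathbb{H}^n,0}(\Omega)\},$$ and let $\bar u_\varepsilon$ be the minimizer of $\int_{\mathcal{B}_R}(\varepsilon+|\nabla_{\mathbb{H}^n}u|^2)^{p/2}$ over $$\{u\in W^{1,p}_{\mathbb{H}^n}(\mathcal{B}_R):\ u\le\psi,\ u-\bar u_0\in W^{1,p}_{\mathbb{H}^n,0}(\mathcal{B}_R)\}.$$ Then $$\int_{\mathcal{B}_R}|\nabla_{\mathbb{H}^n}\bar u_0-\nabla_{\mathbb{H}^n}\bar u_\varepsilon|^p\le C\big(1+(|\nabla_{\mathbb{H}^n}\bar u_0|^p)_R\big)^{1-(p/2)}\,\varepsilon^{(p/2)^2}R^Q .$$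
   Context: $\mathbb{H}^n$ is $\mathbb{R}^{2n+1}$ with coordinates $(x,y,t)\in\mathbb{R}^n\times\mathbb{R}^n\times\mathbb{R}$ and group law $(x^{(1)},y^{(1)},t^{(1)})\circ(x^{(2)},y^{(2)},t^{(2)})=(x^{(1)}+x^{(2)},y^{(1)}+y^{(2)},t^{(1)}+t^{(2)}+2(x^{(2)}\cdot y^{(1)}-x^{(1)}\cdot y^{(2)}))$. For $j=1,\dots,n$, $X_j=\partial_{x_j}+2y_j\partial_t$, $Y_j=\partial_{y_j}-2x_j\partial_t$, and $\nabla_{\mathbb{H}^n}=(X_1,\dots,X_n,Y_1,\dots,Y_n)$. For an open set $U$, $W^{1,p}_{\mathbb{H}^n}(U)$ is the set of $u\in L^p(U)$ whose distributional derivatives $X_ju,Y_ju$ belong to $L^p(U)$ for all $j$, with norm $\|u\|_{L^p(U)}+\sum_j(\|X_ju\|_{L^p(U)}+\|Y_ju\|_{L^p(U)})$; $W^{1,p}_{\mathbb{H}^n,0}(U)$ is the closure of $C_0^\infty(U)$ in this norm. For $\xi=(z,t)\in\mathbb{R}^{2n}\times\mathbb{R}$, $\|\xi\|_{\mathbb{H}^n}=(|z|^4+t^2)^{1/4}$, and $\mathcal{B}_r=\{\xi\in\mathbb{R}^{2n+1}:\|\xi\|_{\mathbb{H}^n}<r\}$. $Q=2(n+1)$ is the homogeneous dimension. For $g\in L^1(\mathcal{B}_r)$, $(g)_r=\frac{1}{\mathcal{L}(\mathcal{B}_r)}\int_{\mathcal{B}_r}g$, where $\mathcal{L}$ is Lebesgue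 measure on $\mathbb{R}^{2n+1}$. Inequalities $u\le\psi$ are a.e. in the relevant domain. *)

theory Defs
  imports "HOL-Analysis.Analysis"
begin

section \<open>The Heisenberg group and its horizontal fields\<close>

text \<open>The underlying space is written as triples \<open>(x, y, t)\<close>. The product norm is the Euclidean one, and
  \<open>lebesgue\<close> on this type is Lebesgue measure in dimension \<open>2 * CARD('n) + 1\<close>.\<close>

type_synonym 'n heis = "(real ^ 'n) \<times> (real ^ 'n) \<times> real"

definition heis_X :: "'n::finite \<Rightarrow> 'n heis \<Rightarrow> 'n heis" where
  "heis_X j = (\<lambda>(x, y, t). (axis j 1, 0, 2 * y $ j))"

definition heis_Y :: "'n::finite \<Rightarrow> 'n heis \<Rightarrow> 'n heis" where
  "heis_Y j = (\<lambda>(x, y, t). (0, axis j 1, - 2 * x $ j))"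

definition heis_norm :: "'n::finite heis \<Rightarrow> real" where
  "heis_norm = (\<lambda>(x, y, t). root 4 (norm (x, y) ^ 4 + t ^ 2))"

definition heis_ball :: "real \<Rightarrow> 'n::finite heis set" where
  "heis_ball r = {z. heis_norm z < r}"

definition heis_avg :: "real \<Rightarrow> ('n::finite heis \<Rightarrow> real) \<Rightarrow> real" where
  "heis_avg r g = (LINT z|lebesgue_on (heis_ball r). g z) / measure lebesgue (heis_ball r :: 'n heis set)"


section \<open>Classical derivatives and smoothness\<close>

text \<open>The fields \<open>heis_X j\<close> and \<open>heis_Y j\<close> are constant along the line through \<open>z\<close> in their own
  direction, so this line is their integral curve (equivalently, \<open>z\<close> multiplied on the right by
  the corresponding one-parameter subgroup). Hence the derivative along the line is the
  Lie derivative, and it makes sense for functions that are only horizontally differentiable.\<close>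

definition lie_deriv :: "('a::real_normed_vector \<Rightarrow> 'a) \<Rightarrow> ('a \<Rightarrow> real) \<Rightarrow> 'a \<Rightarrow> real" where
  "lie_deriv V f z = deriv (\<lambda>s. f (z + s *\<^sub>R V z)) 0"

definition lie_differentiable :: "('a::real_normed_vector \<Rightarrow> 'a) \<Rightarrow> ('a \<Rightarrow> real) \<Rightarrow> bool" where
  "lie_differentiable V f \<longleftrightarrow> (\<forall>z. (\<lambda>s. f (z + s *\<^sub>R V z)) field_differentiable (at 0))"

primrec horizontal_Ck :: "nat \<Rightarrow> ('n::finite heis \<Rightarrow> real) \<Rightarrow> bool" where
  "horizontal_Ck 0 f \<longleftrightarrow> continuous_on UNIV f"
| "horizontal_Ck (Suc k) f \<longleftrightarrow> continuous_on UNIV f \<and>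
     (\<forall>V \<in> range heis_X \<union> range heis_Y. lie_differentiable V f \<and> horizontal_Ck k (lie_deriv V f))"

primrec Ck_on :: "nat \<Rightarrow> 'a::real_normed_vector set \<Rightarrow> ('a \<Rightarrow> real) \<Rightarrow> bool" where
  "Ck_on 0 U f \<longleftrightarrow> continuous_on U f"
| "Ck_on (Suc k) U f \<longleftrightarrow> (\<forall>z\<in>U. f differentiable (at z)) \<and>
     (\<forall>v. Ck_on k U (\<lambda>z. frechet_derivative f (at z) v))"

definition smooth_on :: "'a::real_normed_vector set \<Rightarrow> ('a \<Rightarrow> real) \<Rightarrow> bool" where
  "smooth_on U f \<longleftrightarrow> (\<forall>k. Ck_on k U f)"

definition test_functions :: "'a::real_normed_vector set \<Rightarrow> ('a \<Rightarrow> real) set" where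
  "test_functions U =
     {\<phi>. smooth_on UNIV \<phi> \<and> compact (closure {z. \<phi> z \<noteq> 0}) \<and> closure {z. \<phi> z \<noteq> 0} \<subseteq> U}"

text \<open>Near each boundary point, the set is the sublevel set of a smooth function without critical
  points; in particular it lies locally on one side of its boundary.\<close>

definition smooth_boundary :: "'a::real_normed_vector set \<Rightarrow> bool" where
  "smooth_boundary U \<longleftrightarrow> (\<forall>z0 \<in> frontier U. \<exists>N \<rho>. open N \<and> z0 \<in> N \<and> smooth_on N \<rho> \<and>
     (\<forall>z\<in>N. \<exists>v. frechet_derivative \<rho> (at z) v \<noteq> 0) \<and> U \<inter> N = {z\<in>N. \<rho> z < 0})"

definition compactly_contained :: "'a::topological_space set \<Rightarrow> 'a set \<Rightarrow> bool" where
  "compactly_contained A B \<longleftrightarrow> compact (closure A) \<and> closure A \<subseteq> B"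


section \<open>Lebesgue and horizontal Sobolev spaces\<close>

text \<open>Elements of the function spaces on \<open>U\<close> are total functions, of which only the values on \<open>U\<close>
  matter, up to null sets.\<close>

definition Lp_space :: "real \<Rightarrow> 'a::euclidean_space set \<Rightarrow> ('a \<Rightarrow> real) set" where
  "Lp_space p U = {u \<in> borel_measurable (lebesgue_on U).
     integrable (lebesgue_on U) (\<lambda>z. \<bar>u z\<bar> powr p)}"

definition Lp_norm :: "real \<Rightarrow> 'a::euclidean_space set \<Rightarrow> ('a \<Rightarrow> real) \<Rightarrow> real" where
  "Lp_norm p U u = (LINT z|lebesgue_on U. \<bar>u z\<bar> powr p) powr (1 / p)"

definition Linf_space :: "'a::euclidean_space set \<Rightarrow> ('a \<Rightarrow> real) set" where
  "Linf_space U = {u \<in> borel_measurable (lebesgue_on U). \<exists>M. AE z in lebesgue_on U. \<bar>u z\<bar> \<le> M}"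

definition locally_integrable :: "'a::euclidean_space set \<Rightarrow> ('a \<Rightarrow> real) \<Rightarrow> bool" where
  "locally_integrable U v \<longleftrightarrow> (\<forall>K. compact K \<and> K \<subseteq> U \<longrightarrow> integrable (lebesgue_on K) v)"

text \<open>Integration by parts in this form is correct for divergence-free fields \<open>V\<close> (formal adjoint
  \<open>-V\<close>), such as \<open>heis_X j\<close> and \<open>heis_Y j\<close>.\<close>

definition has_weak_deriv ::
    "'a::euclidean_space set \<Rightarrow> ('a \<Rightarrow> 'a) \<Rightarrow> ('a \<Rightarrow> real) \<Rightarrow> ('a \<Rightarrow> real) \<Rightarrow> bool" where
  "has_weak_deriv U V u v \<longleftrightarrow> locally_integrable U v \<and>
     (\<forall>\<phi> \<in> test_functions U.
        (LINT z|lebesgue_on U. u z * lie_deriv V \<phi> z) = - (LINT z|lebesgue_on U. v z * \<phi> z))"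

text \<open>Determined only up to null sets, and only meaningful if a weak derivative exists.\<close>

definition weak_deriv ::
    "'a::euclidean_space set \<Rightarrow> ('a \<Rightarrow> 'a) \<Rightarrow> ('a \<Rightarrow> real) \<Rightarrow> 'a \<Rightarrow> real" where
  "weak_deriv U V u = (SOME v. has_weak_deriv U V u v)"

definition hgrad :: "'n::finite heis set \<Rightarrow> ('n heis \<Rightarrow> real) \<Rightarrow> 'n heis \<Rightarrow> (real ^ 'n) \<times> (real ^ 'n)" where
  "hgrad U u z = (\<chi> j. weak_deriv U (heis_X j) u z, \<chi> j. weak_deriv U (heis_Y j) u z)"

definition HW :: "real \<Rightarrow> 'n::finite heis set \<Rightarrow> ('n heis \<Rightarrow> real) set" where
  "HW p U = {u \<in> Lp_space p U.
     \<forall>j. (\<exists>v \<in> Lp_space p U. has_weak_deriv U (heis_X j) u v) \<and>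
         (\<exists>v \<in> Lp_space p U. has_weak_deriv U (heis_Y j) u v)}"

definition HW_norm :: "real \<Rightarrow> 'n::finite heis set \<Rightarrow> ('n heis \<Rightarrow> real) \<Rightarrow> real" where
  "HW_norm p U u = Lp_norm p U u +
     (\<Sum>j\<in>UNIV. Lp_norm p U (weak_deriv U (heis_X j) u) + Lp_norm p U (weak_deriv U (heis_Y j) u))"

definition HW0 :: "real \<Rightarrow> 'n::finite heis set \<Rightarrow> ('n heis \<Rightarrow> real) set" where
  "HW0 p U = {u \<in> HW p U. \<forall>e>0. \<exists>\<phi> \<in> test_functions U. HW_norm p U (\<lambda>z. u z - \<phi> z) < e}"

definition obstacle_class ::
    "real \<Rightarrow> 'n::finite heis set \<Rightarrow> ('n heis \<Rightarrow> real) \<Rightarrow> ('n heis \<Rightarrow> real) \<Rightarrow> ('n heis \<Rightarrow> real) set" where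
  "obstacle_class p U \<psi> g = {u \<in> HW p U.
     (AE z in lebesgue_on U. u z \<le> \<psi> z) \<and> (\<lambda>z. u z - g z) \<in> HW0 p U}"

end

theory Submission
  imports Defs
begin

text \<open>Let \<open>a\<close> and \<open>b\<close> be the gradients of the two minimizers on \<open>B = heis_ball R\<close>. The function that
  equals the mean of the two minimizers on \<open>B\<close> and \<open>u0\<close> elsewhere competes in the obstacle problem on
  \<open>\<Omega>\<close>, so \<open>a\<close> has at most the energy of \<open>(a + b) / 2\<close> on \<open>B\<close>; conversely \<open>u0\<close> competes in the
  regularised problem on \<open>B\<close>. Testing with the mean rather than with a first variation means that
  only the midpoint form of uniform convexity of \<open>\<bar>\<cdot>\<bar> powr p\<close> is needed:
  with \<open>S = (\<bar>a\<bar>\<^sup>2 + \<bar>b\<bar>\<^sup>2) / 2\<close>, the integral of \<open>S powr (p / 2 - 1) * \<bar>a - b\<bar>\<^sup>2\<close> is bounded by the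
  energy gap, which is at most \<open>\<epsilon> powr (p / 2) * \<bar>B\<bar>\<close>. Hoelder's inequality then gives the estimate,
  except when \<open>\<epsilon>\<close> is large compared with the energy of \<open>u0\<close>. In that case the regularised energy of
  \<open>b\<close>, reduced by its minimal value \<open>\<epsilon> powr (p / 2) * \<bar>B\<bar>\<close>, is at most the energy of \<open>a\<close>, and this
  controls \<open>b\<close> directly.

  That gradients on \<open>\<Omega>\<close> and on \<open>B\<close> can be compared rests on the uniqueness of weak derivatives, which
  follows by approximating indicators of boxes with smooth functions.\<close>

section \<open>Uniform convexity of powers of the norm\<close>

text \<open>Write q = p / 2, mu for the measure of B, I for the energy of u0 on B and E = eps powr q
  * mu for the energy gap. For p < 2 the convexity of the p-th power degenerates where gradients are
  large, so only the square of the difference with the weight S powr (q - 1) is controlled. Hoelder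
  with weights q and 1 - q removes that weight. The gap then enters as E powr q = eps powr (q * q) *
  mu powr q, which is where the squared exponent comes from, and the integral of S powr q
  contributes (I + E) powr (1 - q). The claim has mu + I in place of I + E. Now I + E is at most 2 *
  (mu + I) unless eps > 1 and E > I; in that regime the second estimate, of order I powr q * (I + E)
  powr (1 - q), suffices because q is at least 1/2. Factoring mu out of mu powr q * (mu + I) powr (1
  - q) produces the average of the energy, and mu is of order R^Q. In the Sobolev part,
  \<open>weak_deriv\<close> is an arbitrary choice made separately for each domain, so gradients can
  be identified almost everywhere only.\<close>

lemma powr_le_tangent:
  fixes q x y :: real
  assumes "0 < q" "q \<le> 1" "0 < x" "0 \<le> y"
  shows "y powr q \<le> x powr q + q * x powr (q - 1) * (y - x)"
proof (cases "y = 0")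
  case True
  have "q * x powr (q - 1) * x = q * x powr q"
    using assms by (simp add: powr_diff)
  also have "\<dots> \<le> x powr q"
    using assms by (simp add: mult_left_le_one_le)
  finally show ?thesis using True by simp
next
  case False
  \<comment> \<open>Young's inequality for \<open>y / x\<close> and 1 is the tangent bound at 1;
    multiplying by \<open>x powr q\<close> moves it to \<open>x\<close>.\<close>
  have "(y / x) powr q \<le> q * (y / x) + (1 - q)"
    using Youngs_inequality_0[of q "1 - q" "y / x" 1] assms False by simp
  then have "x powr q * (y / x) powr q \<le> x powr q * (q * (y / x) + (1 - q))"
    by (simp add: mult_left_mono)
  moreover have "x powr q * (y / x) powr q = y powr q"
    using assms by (simp add: powr_divide)
  moreover have "x powr q * (q * (y / x) + (1 - q)) = x powr q + q * x powr (q - 1) * (y - x)"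
    using assms by (simp add: powr_diff field_simps)
  ultimately show ?thesis by simp
qed

text \<open>Concavity: \<open>S - k\<close> and \<open>S + k\<close> lie between
  \<open>S - K\<close> and \<open>S + K\<close> and have the same midpoint. In
  \<open>midpoint_powr\<close> this reduces arbitrary vectors to collinear ones.\<close>

lemma powr_symmetric_sum_antimono:
  fixes q S k K :: real
  assumes "0 < q" "q \<le> 1" "\<bar>k\<bar> \<le> K" "K \<le> S"
  shows "(S + K) powr q + (S - K) powr q \<le> (S + k) powr q + (S - k) powr q"
proof (cases "\<bar>k\<bar> = K")
  case True
  then show ?thesis by (cases "k \<ge> 0") auto
next
  case False
  then have k: "\<bar>k\<bar> < K" using assms by simp
  then have K: "K > 0" by linarith
  \<comment> \<open>\<open>l\<close> is the weight that makes \<open>S + k\<close> a convex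
    combination of \<open>S + K\<close> and \<open>S - K\<close>; for \<open>S - k\<close> the
    weight is \<open>1 - l\<close>.\<close>
  define l where "l = (1 + k / K) / 2"
  have l: "0 \<le> l" "l \<le> 1" "l * (2 * K) = K + k"
    using k K by (auto simp: l_def field_simps abs_less_iff)
  have *: "l * (S + K) powr q + (1 - l) * (S - K) powr q \<le> (S + k) powr q"
          "(1 - l) * (S + K) powr q + l * (S - K) powr q \<le> (S - k) powr q"
  proof -
    \<comment> \<open>Concavity at \<open>u\<close> is obtained by averaging the two tangent bounds
      at \<open>u\<close>, whose linear terms cancel.\<close>
    have gen: "t * (S + K) powr q + (1 - t) * (S - K) powr q \<le> u powr q"
      if t: "0 \<le> t" "t \<le> 1" and u: "u > 0" "u = S - K + t * (2 * K)" for t u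
    proof -
      define A where "A = q * u powr (q - 1)"
      have a: "(S + K) powr q \<le> u powr q + A * (S + K - u)"
              "(S - K) powr q \<le> u powr q + A * (S - K - u)"
        using powr_le_tangent[of q u] assms K u(1) by (auto simp: A_def)
      have "t * (S + K) powr q + (1 - t) * (S - K) powr q
          \<le> t * (u powr q + A * (S + K - u)) + (1 - t) * (u powr q + A * (S - K - u))"
        using a t by (intro add_mono mult_left_mono) auto
      also have "\<dots> = u powr q + A * (t * (2 * K) + S - K - u)"
        by (simp add: algebra_simps)
      finally show ?thesis using u by simp
    qed
    show "l * (S + K) powr q + (1 - l) * (S - K) powr q \<le> (S + k) powr q"
      using l k assms by (intro gen) auto
    have l': "(1 - l) * (2 * K) = K - k" using l by (simp add: algebra_simps)
    have "(1 - l) * (S + K) powr q + (1 - (1 - l)) * (S - K) powr q \<le> (S - k) powr q"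
    proof (rule gen)
      show "S - k = S - K + (1 - l) * (2 * K)" unfolding l' by simp
    qed (use l k assms in auto)
    then show "(1 - l) * (S + K) powr q + l * (S - K) powr q \<le> (S - k) powr q"
      by simp
  qed
  show ?thesis
    using add_mono[OF *] by (simp add: algebra_simps)
qed

text \<open>Twice the difference of the two sides is \<open>G y\<close>, where \<open>G\<close> and
  its derivative \<open>p * g\<close> vanish at 0. Since \<open>g\<close> has a nonnegative
  derivative, first \<open>g\<close> and then \<open>G\<close> is nonnegative. Staying below 1 keeps
  \<open>1 - t\<close> positive, as the derivatives require.\<close>

lemma two_point_powr_less_one:
  fixes p y :: real
  assumes p: "1 < p" "p \<le> 2" and y: "0 \<le> y" "y < 1"
  shows "1 + p * (p - 1) / 2 * y\<^sup>2 \<le> ((1 + y) powr p + (1 - y) powr p) / 2"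
proof -
  define g where "g = (\<lambda>t::real. (1 + t) powr (p - 1) - (1 - t) powr (p - 1) - 2 * (p - 1) * t)"
  define G where "G = (\<lambda>t::real. (1 + t) powr p + (1 - t) powr p - 2 - p * (p - 1) * t\<^sup>2)"
  have d: "((\<lambda>s. (1 + s) powr a) has_real_derivative a * (1 + t) powr (a - 1)) (at t)"
          "((\<lambda>s. (1 - s) powr a) has_real_derivative - (a * (1 - t) powr (a - 1))) (at t)"
    if "0 \<le> t" "t < 1" for t a :: real
    using that DERIV_fun_powr[of "\<lambda>s. 1 + s" 1 t a] DERIV_fun_powr[of "\<lambda>s. 1 - s" "-1" t a]
    by (auto intro!: derivative_eq_intros)
  have dg: "(g has_real_derivative
      (p - 1) * ((1 + t) powr (p - 2) + (1 - t) powr (p - 2) - 2)) (at t)"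
    if "0 \<le> t" "t < 1" for t
  proof -
    have "(g has_real_derivative (p - 1) * (1 + t) powr (p - 1 - 1)
        + (p - 1) * (1 - t) powr (p - 1 - 1) - 2 * (p - 1)) (at t)"
      using DERIV_diff[OF DERIV_diff[OF d(1)[OF that, of "p - 1"] d(2)[OF that, of "p - 1"]]
          DERIV_cmult_Id[of "2 * (p - 1)"]]
      unfolding g_def by (simp only: minus_diff_eq diff_minus_eq_add)
    then show ?thesis by (simp add: algebra_simps)
  qed
  have dG: "(G has_real_derivative p * g t) (at t)" if "0 \<le> t" "t < 1" for t
  proof -
    have sq: "((\<lambda>t. p * (p - 1) * t\<^sup>2) has_real_derivative p * (p - 1) * (2 * t)) (at t)"
      by (auto intro!: derivative_eq_intros)
    have "(G has_real_derivative p * (1 + t) powr (p - 1) + - (p * (1 - t) powr (p - 1)) - 0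
        - p * (p - 1) * (2 * t)) (at t)"
      unfolding G_def by (intro DERIV_diff DERIV_add d that sq DERIV_const)
    then show ?thesis by (simp add: g_def algebra_simps)
  qed
  have g': "(1 + t) powr (p - 2) + (1 - t) powr (p - 2) - 2 \<ge> 0" if t: "0 \<le> t" "t < 1" for t
  proof -
    \<comment> \<open>\<open>a\<close> and \<open>b\<close> are the square roots of the two powers
      in the claim. Their product is at least 1 because \<open>1 - t\<^sup>2\<close> is at most 1
      and the exponent is nonpositive, so the sum of squares is at least 2.\<close>
    define a where "a = (1 + t) powr ((p - 2) / 2)"
    define b where "b = (1 - t) powr ((p - 2) / 2)"
    have ab: "a * b = (1 - t\<^sup>2) powr ((p - 2) / 2)"
      using t by (simp add: a_def b_def power2_eq_square algebra_simps flip: powr_mult)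
    have t2: "0 < 1 - t\<^sup>2" "1 - t\<^sup>2 \<le> 1"
      using t by (auto simp: abs_square_less_1)
    have "1 powr ((p - 2) / 2) \<le> (1 - t\<^sup>2) powr ((p - 2) / 2)"
      using p t2 by (intro powr_mono2') auto
    then have "a * b \<ge> 1" using ab by simp
    moreover have "a\<^sup>2 = (1 + t) powr (p - 2)" "b\<^sup>2 = (1 - t) powr (p - 2)"
      using t by (simp_all add: a_def b_def power2_eq_square flip: powr_add)
    moreover have "a\<^sup>2 + b\<^sup>2 \<ge> 2 * (a * b)"
      using sum_squares_bound[of a b] by simp
    ultimately show ?thesis by simp
  qed
  have "g 0 \<le> g t" if t: "0 \<le> t" "t < 1" for t
  proof (rule DERIV_nonneg_imp_nondecreasing[OF t(1)])
    fix x assume "0 \<le> x" "x \<le> t"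
    then show "\<exists>y. (g has_real_derivative y) (at x) \<and> 0 \<le> y"
      using t p g'[of x] by (intro exI[of _ "(p - 1) * ((1 + x) powr (p - 2) + (1 - x) powr (p - 2) - 2)"]
        conjI dg mult_nonneg_nonneg) auto
  qed
  moreover have "g 0 = 0" by (simp add: g_def)
  ultimately have g0: "0 \<le> g t" if "0 \<le> t" "t < 1" for t using that by metis
  have "G 0 \<le> G y"
  proof (rule DERIV_nonneg_imp_nondecreasing[OF y(1)])
    fix x assume "0 \<le> x" "x \<le> y"
    then show "\<exists>t. (G has_real_derivative t) (at x) \<and> 0 \<le> t"
      using y p by (intro exI[of _ "p * g x"] conjI dG mult_nonneg_nonneg g0) auto
  qed
  moreover have "G 0 = 0" by (simp add: G_def)
  ultimately show ?thesis by (simp add: G_def)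
qed

text \<open>Both sides are homogeneous of degree \<open>p\<close>, so only the ratio
  \<open>y / x\<close> matters. The ratio 1 is reached by continuity from the left.\<close>

lemma two_point_powr:
  fixes p x y :: real
  assumes p: "1 < p" "p \<le> 2" and y: "0 \<le> y" "y \<le> x" "0 < x"
  shows "x powr p + p * (p - 1) / 2 * x powr (p - 2) * y\<^sup>2 \<le> ((x + y) powr p + (x - y) powr p) / 2"
proof -
  have one: "1 + p * (p - 1) / 2 * t\<^sup>2 \<le> ((1 + t) powr p + (1 - t) powr p) / 2"
    if t: "0 \<le> t" "t \<le> 1" for t :: real
  proof (cases "t < 1")
    case True
    then show ?thesis using two_point_powr_less_one[OF p] t by simp
  next
    case False
    then have [simp]: "t = 1" using t by simp
    have "((\<lambda>s::real. ((1 + s) powr p + (1 - s) powr p) / 2 - (1 + p * (p - 1) / 2 * s\<^sup>2)) \<longlongrightarrow>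
        ((1 + 1) powr p + (1 - 1) powr p) / 2 - (1 + p * (p - 1) / 2 * 1\<^sup>2)) (at_left 1)"
      using p by (intro tendsto_intros tendsto_powr') (auto simp: eventually_at_filter)
    moreover have "\<forall>\<^sub>F s in at_left 1.
        0 \<le> ((1 + s) powr p + (1 - s) powr p) / 2 - (1 + p * (p - 1) / 2 * s\<^sup>2)"
      using eventually_at_left_real[OF zero_less_one]
      by eventually_elim (use two_point_powr_less_one[OF p] in auto)
    ultimately have "0 \<le> ((1 + 1) powr p + (1 - 1) powr p) / 2 - (1 + p * (p - 1) / 2 * 1\<^sup>2)"
      by (rule tendsto_lowerbound) (rule trivial_limit_at_left_real)
    then show ?thesis by simp
  qed
  have "x powr p * (1 + p * (p - 1) / 2 * (y / x)\<^sup>2)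
      \<le> x powr p * (((1 + y / x) powr p + (1 - y / x) powr p) / 2)"
    using y by (intro mult_left_mono one) auto
  moreover have "x powr p * (1 + y / x) powr p = (x + y) powr p"
    "x powr p * (1 - y / x) powr p = (x - y) powr p"
    using y by (simp_all add: algebra_simps flip: powr_mult)
  moreover have "x powr p * (y / x)\<^sup>2 = x powr (p - 2) * y\<^sup>2"
    using y by (simp add: powr_diff power_divide)
  ultimately show ?thesis
    by (simp add: algebra_simps)
qed

text \<open>The exponent \<open>p / 2 - 1\<close> is nonpositive, so the weight is at most the
  larger of \<open>x\<close> and \<open>y\<close> raised to \<open>p - 2\<close>. If
  \<open>y\<close> is at most \<open>x\<close>, the two-point inequality applies directly; otherwise
  it is used with \<open>x\<close> and \<open>y\<close> exchanged, and the tangent bound for the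
  power \<open>p / 2\<close> converts the result back.\<close>

lemma midpoint_powr_scalar:
  fixes p x y :: real
  assumes p: "1 < p" "p \<le> 2" and x: "0 \<le> x" and y: "0 \<le> y"
  shows "x powr p + p * (p - 1) / 2 * ((x\<^sup>2 + y\<^sup>2) powr (p / 2 - 1) * y\<^sup>2)
    \<le> ((x + y) powr p + \<bar>x - y\<bar> powr p) / 2"
proof -
  define c where "c = p * (p - 1) / 2"
  have c: "0 \<le> c" "c \<le> p / 2" "c \<le> 1"
    using p mult_mono[of p 2 "p - 1" 1] by (auto simp: c_def)
  have S: "(x\<^sup>2 + y\<^sup>2) powr (p / 2 - 1) \<le> z powr (p - 2)" if "0 < z" "z\<^sup>2 \<le> x\<^sup>2 + y\<^sup>2" for z
  proof -
    have "(x\<^sup>2 + y\<^sup>2) powr (p / 2 - 1) \<le> (z\<^sup>2) powr (p / 2 - 1)"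
      using that p by (intro powr_mono2') auto
    also have "(z\<^sup>2) powr (p / 2 - 1) = (z powr 2) powr (p / 2 - 1)"
      using that by (simp add: powr_numeral)
    also have "\<dots> = z powr (p - 2)"
      using that unfolding powr_powr by (simp add: algebra_simps)
    finally show ?thesis .
  qed
  consider "y = 0" | "0 < y" "y \<le> x" | "x < y" using x y by linarith
  then show ?thesis
  proof cases
    case 1
    then show ?thesis using x by simp
  next
    case 2
    then have "c * ((x\<^sup>2 + y\<^sup>2) powr (p / 2 - 1) * y\<^sup>2) \<le> c * (x powr (p - 2) * y\<^sup>2)"
      using c by (intro mult_left_mono mult_right_mono S) auto
    then show ?thesis
      using two_point_powr[OF p, of y x] 2 by (simp add: c_def mult.assoc)
  next
    case 3
    have yp: "0 < y" using 3 x by simp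
    have A: "y powr p + c * y powr (p - 2) * x\<^sup>2 \<le> ((x + y) powr p + \<bar>x - y\<bar> powr p) / 2"
      using two_point_powr[OF p, of x y] 3 x by (simp add: c_def add.commute)
    have "c * ((x\<^sup>2 + y\<^sup>2) powr (p / 2 - 1) * y\<^sup>2) \<le> c * (y powr (p - 2) * y\<^sup>2)"
      using c yp by (intro mult_left_mono mult_right_mono S) auto
    also have "y powr (p - 2) * y\<^sup>2 = y powr p" using yp by (simp add: powr_diff)
    finally have B: "c * ((x\<^sup>2 + y\<^sup>2) powr (p / 2 - 1) * y\<^sup>2) \<le> c * y powr p" .
    have xe: "x powr p = (x\<^sup>2) powr (p / 2)" and ye: "y powr p = (y\<^sup>2) powr (p / 2)"
      and ye2: "y powr (p - 2) = (y\<^sup>2) powr (p / 2 - 1)"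
      using x y by (auto simp: powr_powr algebra_simps simp flip: powr_numeral)
    have "x powr p \<le> y powr p + p / 2 * y powr (p - 2) * (x\<^sup>2 - y\<^sup>2)"
      unfolding xe ye ye2 using yp p by (intro powr_le_tangent) auto
    \<comment> \<open>As \<open>x < y\<close>, lowering the slope factor \<open>p / 2\<close> of the
      tangent at \<open>y\<^sup>2\<close> to \<open>c\<close> keeps it an upper bound, and with
      \<open>c\<close> it matches the term in \<open>A\<close>.\<close>
    moreover have "(p / 2 - c) * y powr (p - 2) * (x\<^sup>2 - y\<^sup>2) \<le> 0"
      using c 3 x by (intro mult_nonneg_nonpos mult_nonneg_nonneg) (auto simp: power_mono)
    moreover have "y powr (p - 2) * y\<^sup>2 = y powr p" using yp by (simp add: powr_diff)
    ultimately have "x powr p + c * y powr p \<le> y powr p + c * y powr (p - 2) * x\<^sup>2"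
      by (simp add: algebra_simps)
    then show ?thesis using A B by (simp add: c_def)
  qed
qed

text \<open>The squared norms of \<open>m + h\<close> and \<open>m - h\<close> are \<open>S\<close>
  plus and minus twice the inner product. By Cauchy-Schwarz and
  \<open>powr_symmetric_sum_antimono\<close> the right-hand side is smallest when \<open>m\<close>
  and \<open>h\<close> are collinear, which is the scalar inequality.\<close>

lemma midpoint_powr:
  fixes m h :: "'a::real_inner"
  assumes p: "1 < p" "p \<le> 2"
  shows "norm m powr p + p * (p - 1) / 2 * (((norm m)\<^sup>2 + (norm h)\<^sup>2) powr (p / 2 - 1) * (norm h)\<^sup>2)
    \<le> (norm (m + h) powr p + norm (m - h) powr p) / 2"
proof -
  have pw: "z powr p = (z\<^sup>2) powr (p / 2)" if "z \<ge> 0" for z :: real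
    using that by (simp add: powr_powr flip: powr_numeral)
  define S where "S = (norm m)\<^sup>2 + (norm h)\<^sup>2"
  have n: "(norm (m + h))\<^sup>2 = S + 2 * (m \<bullet> h)" "(norm (m - h))\<^sup>2 = S - 2 * (m \<bullet> h)"
    "(norm m + norm h)\<^sup>2 = S + 2 * (norm m * norm h)" "\<bar>norm m - norm h\<bar>\<^sup>2 = S - 2 * (norm m * norm h)"
    by (simp_all add: S_def power2_norm_eq_inner inner_simps inner_commute power2_sum power2_diff)
  have "(S + 2 * (norm m * norm h)) powr (p / 2) + (S - 2 * (norm m * norm h)) powr (p / 2)
      \<le> (S + 2 * (m \<bullet> h)) powr (p / 2) + (S - 2 * (m \<bullet> h)) powr (p / 2)"
    using p Cauchy_Schwarz_ineq2[of m h] sum_squares_bound[of "norm m" "norm h"]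
    by (intro powr_symmetric_sum_antimono) (auto simp: S_def)
  then have "(norm m + norm h) powr p + \<bar>norm m - norm h\<bar> powr p
      \<le> norm (m + h) powr p + norm (m - h) powr p"
    by (simp add: pw n del: power2_abs)
  then show ?thesis
    using midpoint_powr_scalar[OF p, of "norm m" "norm h"] by simp
qed

section \<open>Comparison of energies\<close>

lemma powr_add_le_add_powr:
  fixes q x y :: real
  assumes "0 < q" "q \<le> 1" "0 \<le> x" "0 \<le> y"
  shows "(x + y) powr q \<le> x powr q + y powr q"
proof (cases "x + y = 0")
  case False
  then have s: "x + y > 0" using assms by linarith
  have "z / (x + y) \<le> (z / (x + y)) powr q" if "0 \<le> z" "z \<le> x + y" for z
    using powr_mono'[of q 1 "z / (x + y)"] assms that s by simp
  from add_mono[OF this[of x] this[of y]]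
  have "1 \<le> (x / (x + y)) powr q + (y / (x + y)) powr q"
    using assms s by (simp flip: add_divide_distrib)
  then have "(x + y) powr q * 1 \<le> (x + y) powr q * ((x / (x + y)) powr q + (y / (x + y)) powr q)"
    by (intro mult_left_mono) auto
  also have "\<dots> = x powr q + y powr q"
    using s by (simp add: distrib_left flip: powr_mult)
  finally show ?thesis by simp
qed auto

text \<open>Pointwise Young after normalising both integrals to 1. The endpoints of \<open>t\<close>
  are included because the weight \<open>p / 2\<close> equals 1 when \<open>p = 2\<close>.\<close>

lemma Holder_powr:
  fixes F G :: "'a \<Rightarrow> real"
  assumes F: "integrable M F" "\<And>x. 0 \<le> F x" and G: "integrable M G" "\<And>x. 0 \<le> G x"
    and t: "0 \<le> t" "t \<le> 1"
  shows "integrable M (\<lambda>x. F x powr t * G x powr (1 - t))"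
    and "(\<integral>x. F x powr t * G x powr (1 - t) \<partial>M) \<le> (\<integral>x. F x \<partial>M) powr t * (\<integral>x. G x \<partial>M) powr (1 - t)"
proof -
  have young: "u powr t * v powr (1 - t) \<le> t * u + (1 - t) * v" if "0 \<le> u" "0 \<le> v" for u v
  proof (cases "u = 0 \<or> v = 0")
    case True
    then show ?thesis using that t by auto
  next
    case False
    then show ?thesis using that t by (intro Youngs_inequality_0) auto
  qed
  note [measurable] = borel_measurable_integrable[OF F(1)] borel_measurable_integrable[OF G(1)]
  show int: "integrable M (\<lambda>x. F x powr t * G x powr (1 - t))"
  proof (rule Bochner_Integration.integrable_bound)
    show "integrable M (\<lambda>x. t * F x + (1 - t) * G x)" using F G by auto
    show "AE x in M. norm (F x powr t * G x powr (1 - t)) \<le> norm (t * F x + (1 - t) * G x)"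
      using young[OF F(2) G(2)] t F(2) G(2) by (auto simp: abs_of_nonneg)
  qed auto
  define A where "A = (\<integral>x. F x \<partial>M)"
  define B where "B = (\<integral>x. G x \<partial>M)"
  have nn: "A \<ge> 0" "B \<ge> 0" using F G by (auto simp: A_def B_def)
  show "(\<integral>x. F x powr t * G x powr (1 - t) \<partial>M) \<le> (\<integral>x. F x \<partial>M) powr t * (\<integral>x. G x \<partial>M) powr (1 - t)"
  proof (cases "A = 0 \<or> B = 0")
    \<comment> \<open>If one integral is 0, its integrand vanishes almost everywhere; since 0 to any
      power is 0 here, even to the power 0, both sides are 0.\<close>
    case True
    then have "(AE x in M. F x = 0) \<or> (AE x in M. G x = 0)"
      using integral_nonneg_eq_0_iff_AE[OF F(1)] integral_nonneg_eq_0_iff_AE[OF G(1)] F G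
      by (auto simp: A_def B_def)
    then have "AE x in M. F x powr t * G x powr (1 - t) = 0" by auto
    then have "(\<integral>x. F x powr t * G x powr (1 - t) \<partial>M) = 0"
      by (rule integral_eq_zero_AE)
    then show ?thesis by simp
  next
    case False
    then have AB: "A > 0" "B > 0" using nn by auto
    define k where "k = A powr t * B powr (1 - t)"
    have k: "F x powr t * G x powr (1 - t) = k * ((F x / A) powr t * (G x / B) powr (1 - t))" for x
      using AB by (simp add: k_def powr_divide)
    have "(\<integral>x. F x powr t * G x powr (1 - t) \<partial>M)
        \<le> (\<integral>x. k * (t * (F x / A) + (1 - t) * (G x / B)) \<partial>M)"
    proof (intro integral_mono int)
      show "integrable M (\<lambda>x. k * (t * (F x / A) + (1 - t) * (G x / B)))" using F G by auto
      show "F x powr t * G x powr (1 - t) \<le> k * (t * (F x / A) + (1 - t) * (G x / B))" for x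
        unfolding k using AB F(2)[of x] G(2)[of x]
        by (intro mult_left_mono young) (auto simp: k_def)
    qed
    also have "\<dots> = k * (t * (A / A) + (1 - t) * (B / B))"
      using F G by (simp add: A_def B_def)
    also have "\<dots> = k" using AB by simp
    finally show ?thesis by (simp add: k_def A_def B_def)
  qed
qed

lemma norm_diff_powr_le:
  fixes a b :: "'a::real_normed_vector"
  assumes "0 \<le> p"
  shows "norm (a - b) powr p \<le> 2 powr p * (norm a powr p + norm b powr p)"
proof -
  have "norm (a - b) powr p \<le> (2 * max (norm a) (norm b)) powr p"
    using assms norm_triangle_ineq4[of a b] by (intro powr_mono2) auto
  also have "\<dots> = 2 powr p * max (norm a) (norm b) powr p"
    by (simp add: powr_mult)
  also have "\<dots> \<le> 2 powr p * (norm a powr p + norm b powr p)"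
    by (intro mult_left_mono) (auto simp: max_def)
  finally show ?thesis .
qed

text \<open>The powers of \<open>S\<close> cancel. This is the factorisation to which Hoelder is
  applied, once with the convexity weight and once with the regularised density;
  \<open>r\<^sup>2 \<le> S\<close> guarantees \<open>S > 0\<close> unless
  \<open>r = 0\<close>.\<close>

lemma norm_powr_eq_split:
  fixes r S p :: real
  assumes "0 \<le> r" "r\<^sup>2 \<le> S"
  shows "r powr p = (S powr (p / 2 - 1) * r\<^sup>2) powr (p / 2) * (S powr (p / 2)) powr (1 - p / 2)"
proof (cases "r = 0")
  case False
  then have r: "r > 0" and S: "S > 0" using assms by (auto intro: less_le_trans[of 0 "r\<^sup>2"])
  have "(r\<^sup>2) powr (p / 2) = r powr p"
    using r by (simp add: powr_powr flip: powr_numeral)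
  then have "(S powr (p / 2 - 1) * r\<^sup>2) powr (p / 2) * (S powr (p / 2)) powr (1 - p / 2)
      = r powr p * S powr ((p / 2 - 1) * (p / 2) + p / 2 * (1 - p / 2))"
    by (simp add: powr_mult powr_powr powr_add)
  also have "(p / 2 - 1) * (p / 2) + p / 2 * (1 - p / 2) = 0" by (simp add: algebra_simps)
  finally show ?thesis using S by simp
qed auto

text \<open>Here \<open>e\<close> is the regularisation parameter, \<open>m\<close> the measure of
  the ball, \<open>I\<close> the energy of the unregularised minimizer and \<open>E\<close> the
  energy gap. \<open>L1\<close> suffices if \<open>e \<le> 1\<close> or \<open>E \<le> I\<close>,
  since then \<open>I + E\<close> is at most \<open>2 * (m + I)\<close>; otherwise
  \<open>I < E\<close> and \<open>L2\<close> takes over.\<close>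

lemma interpolate_energy_bounds:
  fixes q m I e L K1 K2 :: real
  defines "E \<equiv> e powr q * m"
  assumes q: "1 / 2 \<le> q" "q \<le> 1" and nn: "0 \<le> m" "0 \<le> I" "0 < e" "0 \<le> K1" "0 \<le> K2"
    and L1: "L \<le> K1 * (E powr q * (I + E) powr (1 - q))"
    and L2: "L \<le> K2 * (I powr q * (I + E) powr (1 - q))"
  shows "L \<le> 2 * (K1 + K2) * ((m + I) powr (1 - q) * m powr q * e powr (q\<^sup>2))"
proof -
  define T where "T = (m + I) powr (1 - q) * m powr q * e powr (q\<^sup>2)"
  have T0: "T \<ge> 0" by (simp add: T_def)
  have Eq: "E powr q = m powr q * e powr (q\<^sup>2)"
    by (simp add: E_def powr_mult powr_powr power2_eq_square)
  have E0: "E \<ge> 0" using nn by (simp add: E_def)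
  have two: "(2 * x) powr (1 - q) \<le> 2 * x powr (1 - q)" for x :: real
    using q powr_mono[of "1 - q" 1 "2::real"] by (simp add: powr_mult mult_right_mono)
  have bound: "E powr q * (I + E) powr (1 - q) \<le> 2 * T" if "I + E \<le> 2 * (m + I)"
  proof -
    have "(I + E) powr (1 - q) \<le> (2 * (m + I)) powr (1 - q)"
      using that q nn E0 by (intro powr_mono2) auto
    also have "\<dots> \<le> 2 * (m + I) powr (1 - q)" by (rule two)
    finally have "E powr q * (I + E) powr (1 - q) \<le> E powr q * (2 * (m + I) powr (1 - q))"
      by (intro mult_left_mono) auto
    then show ?thesis by (simp add: Eq T_def algebra_simps)
  qed
  have "E powr q * (I + E) powr (1 - q) \<le> 2 * T \<or> I powr q * (I + E) powr (1 - q) \<le> 2 * T"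
  proof (cases "e \<le> 1 \<or> E \<le> I")
    case True
    then have "I + E \<le> 2 * (m + I)"
    proof
      assume "e \<le> 1"
      then have "E \<le> m" using nn q powr_le1[of q e] by (simp add: E_def mult_left_le_one_le)
      then show "I + E \<le> 2 * (m + I)" using nn by simp
    next
      assume "E \<le> I"
      then show "I + E \<le> 2 * (m + I)" using nn by simp
    qed
    then show ?thesis using bound by blast
  next
    case False
    then have IE: "I \<le> E" by simp
    have "(I + E) powr (1 - q) \<le> (2 * E) powr (1 - q)"
      using IE q nn by (intro powr_mono2) auto
    also have "\<dots> \<le> 2 * E powr (1 - q)" by (rule two)
    finally have 1: "I powr q * (I + E) powr (1 - q) \<le> I powr q * (2 * E powr (1 - q))"
      by (intro mult_left_mono) auto
    \<comment> \<open>The exponent \<open>2 * q - 1\<close> is nonnegative because \<open>q\<close>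
      is at least 1/2, so this part of the power of \<open>I\<close> can be traded for the same
      power of the larger \<open>E\<close>.\<close>
    have "I powr q * E powr (1 - q) = I powr (1 - q) * (I powr (2 * q - 1) * E powr (1 - q))"
      by (simp flip: powr_add mult.assoc)
    also have "\<dots> \<le> I powr (1 - q) * (E powr (2 * q - 1) * E powr (1 - q))"
      using IE q nn by (intro mult_left_mono mult_right_mono powr_mono2) auto
    also have "\<dots> = I powr (1 - q) * E powr q"
      by (simp flip: powr_add)
    also have "\<dots> \<le> (m + I) powr (1 - q) * E powr q"
      using q nn by (intro mult_right_mono powr_mono2) auto
    also have "\<dots> = T" by (simp add: Eq T_def)
    finally show ?thesis using 1 by simp
  qed
  then have "L \<le> K1 * (2 * T) \<or> L \<le> K2 * (2 * T)"
    using L1 L2 nn by (meson mult_left_mono order_trans)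
  moreover have "K1 * (2 * T) \<le> 2 * (K1 + K2) * T" "K2 * (2 * T) \<le> 2 * (K1 + K2) * T"
    using nn T0 by (simp_all add: algebra_simps)
  ultimately show ?thesis unfolding T_def by linarith
qed

text \<open>This is \<open>2 * (K1 + K2)\<close> from \<open>interpolate_energy_bounds\<close>. In
  the first summand \<open>2 powr p\<close> comes from \<open>a - b\<close> being twice the half
  difference, the fraction from the modulus of convexity, and the 2 from doubling
  \<open>I + E\<close>. In the second, 3 = 1 + 2 collects the bounds for the energies of
  \<open>a\<close> and \<open>b\<close>.\<close>

definition comparison_const :: "real \<Rightarrow> real" where
  "comparison_const p = 2 * (2 powr p * (2 * (1 / (p * (p - 1))) powr (p / 2)) + 2 powr p * 3)"

lemma comparison_const_pos: "0 < comparison_const p"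
  unfolding comparison_const_def by (intro mult_pos_pos add_nonneg_pos) auto

text \<open>The first bound comes from uniform convexity of the unregularised energy and is effective
  unless \<open>\<epsilon>\<close> is large compared with the energy of \<open>a\<close>; the second one, which covers that case,
  comes from subtracting the constant \<open>\<epsilon> powr (p / 2)\<close> from the regularised energy density.\<close>

lemma (in finite_measure) minimizer_comparison:
  fixes a b :: "'a \<Rightarrow> 'b::{real_inner, second_countable_topology}" and \<epsilon> :: real
  assumes p: "1 < p" "p \<le> 2" and eps: "0 < \<epsilon>"
    and a[measurable]: "a \<in> borel_measurable M" and b[measurable]: "b \<in> borel_measurable M"
    and ia: "integrable M (\<lambda>x. norm (a x) powr p)" and ib: "integrable M (\<lambda>x. norm (b x) powr p)"
    and min1: "(\<integral>x. norm (a x) powr p \<partial>M) \<le> (\<integral>x. norm ((1 / 2) *\<^sub>R (a x + b x)) powr p \<partial>M)"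
    and min2: "(\<integral>x. (\<epsilon> + (norm (b x))\<^sup>2) powr (p / 2) \<partial>M) \<le> (\<integral>x. (\<epsilon> + (norm (a x))\<^sup>2) powr (p / 2) \<partial>M)"
  shows "(\<integral>x. norm (a x - b x) powr p \<partial>M) \<le> comparison_const p *
    ((measure M (space M) + (\<integral>x. norm (a x) powr p \<partial>M)) powr (1 - p / 2)
      * measure M (space M) powr (p / 2) * \<epsilon> powr ((p / 2)\<^sup>2))"
proof -
  define q where "q = p / 2"
  have q: "1 / 2 \<le> q" "q \<le> 1" "0 < q" using p by (auto simp: q_def)
  define mu where "mu = measure M (space M)"
  define I where "I = (\<integral>x. norm (a x) powr p \<partial>M)"
  define E where "E = \<epsilon> powr q * mu"
  have I0: "I \<ge> 0" and E0: "E \<ge> 0" by (auto simp: I_def E_def mu_def)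
  define m where "m = (\<lambda>x. (1 / 2) *\<^sub>R (a x + b x))"
  define h where "h = (\<lambda>x. (1 / 2) *\<^sub>R (a x - b x))"
  have [measurable]: "m \<in> borel_measurable M" "h \<in> borel_measurable M"
    unfolding m_def h_def by measurable
  have mh: "m x + h x = a x" "m x - h x = b x" "a x - b x = 2 *\<^sub>R h x" for x
    by (simp_all add: m_def h_def algebra_simps flip: scaleR_2)
  have sq: "(r\<^sup>2) powr q = r powr p" if "0 \<le> r" for r :: real
    using that by (simp add: q_def powr_powr flip: powr_numeral)

  have ihp: "integrable M (\<lambda>x. norm (h x) powr p)" and imp: "integrable M (\<lambda>x. norm (m x) powr p)"
  proof -
    have dom: "integrable M (\<lambda>x. 2 powr p * (norm (a x) powr p + norm (b x) powr p))"
      using ia ib by simp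
    have hle: "norm (h x) powr p \<le> 2 powr p * (norm (a x) powr p + norm (b x) powr p)" for x
    proof -
      have "norm (h x) powr p \<le> norm (a x - b x) powr p"
        using p by (intro powr_mono2) (auto simp: h_def)
      also have "\<dots> \<le> 2 powr p * (norm (a x) powr p + norm (b x) powr p)"
        using p by (intro norm_diff_powr_le) auto
      finally show ?thesis .
    qed
    have mle: "norm (m x) powr p \<le> 2 powr p * (norm (a x) powr p + norm (b x) powr p)" for x
    proof -
      have "norm (m x) powr p \<le> norm (a x - - b x) powr p"
        using p by (intro powr_mono2) (auto simp: m_def)
      also have "\<dots> \<le> 2 powr p * (norm (a x) powr p + norm (- b x) powr p)"
        using p by (intro norm_diff_powr_le) auto
      finally show ?thesis by simp
    qed
    show "integrable M (\<lambda>x. norm (h x) powr p)"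
      by (rule Bochner_Integration.integrable_bound[OF dom]) (use hle in \<open>auto simp: abs_of_nonneg\<close>)
    show "integrable M (\<lambda>x. norm (m x) powr p)"
      by (rule Bochner_Integration.integrable_bound[OF dom]) (use mle in \<open>auto simp: abs_of_nonneg\<close>)
  qed

  have reg_le: "(\<epsilon> + (norm v)\<^sup>2) powr q \<le> \<epsilon> powr q + norm v powr p" for v :: 'b
    using powr_add_le_add_powr[of q \<epsilon> "(norm v)\<^sup>2"] q eps sq[of "norm v"] by simp
  have reg_int: "integrable M (\<lambda>x. (\<epsilon> + (norm (f x))\<^sup>2) powr q)"
    if "f \<in> borel_measurable M" "integrable M (\<lambda>x. norm (f x) powr p)" for f :: "'a \<Rightarrow> 'b"
  proof (rule Bochner_Integration.integrable_bound)
    show "integrable M (\<lambda>x. \<epsilon> powr q + norm (f x) powr p)" using that by auto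
    show "AE x in M. norm ((\<epsilon> + (norm (f x))\<^sup>2) powr q) \<le> norm (\<epsilon> powr q + norm (f x) powr p)"
      using reg_le by (auto simp: abs_of_nonneg)
  qed (use that in measurable)
  define RB where "RB = (\<integral>x. (\<epsilon> + (norm (b x))\<^sup>2) powr q \<partial>M)"
  have RB: "RB \<le> E + I"
  proof -
    have "RB \<le> (\<integral>x. (\<epsilon> + (norm (a x))\<^sup>2) powr q \<partial>M)" using min2 by (simp add: RB_def q_def)
    also have "\<dots> \<le> (\<integral>x. \<epsilon> powr q + norm (a x) powr p \<partial>M)"
      using ia reg_le by (intro integral_mono reg_int) auto
    also have "\<dots> = E + I" using ia by (simp add: E_def I_def mu_def)
    finally show ?thesis .
  qed
  have bRB: "(\<integral>x. norm (b x) powr p \<partial>M) \<le> RB"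
    unfolding RB_def
  proof (intro integral_mono reg_int ib b)
    show "norm (b x) powr p \<le> (\<epsilon> + (norm (b x))\<^sup>2) powr q" for x
      using sq[of "norm (b x)"] powr_mono2[of q "(norm (b x))\<^sup>2" "\<epsilon> + (norm (b x))\<^sup>2"] q eps by simp
  qed

  define L where "L = (\<integral>x. norm (a x - b x) powr p \<partial>M)"
  have Lh: "L = 2 powr p * (\<integral>x. norm (h x) powr p \<partial>M)"
    by (simp add: L_def mh powr_mult)

  define c where "c = p * (p - 1) / 2"
  have c: "c > 0" using p by (simp add: c_def)
  define S where "S = (\<lambda>x. (norm (m x))\<^sup>2 + (norm (h x))\<^sup>2)"
  define D where "D = (\<lambda>x. S x powr (q - 1) * (norm (h x))\<^sup>2)"
  have [measurable]: "S \<in> borel_measurable M" "D \<in> borel_measurable M"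
    unfolding S_def D_def by measurable
  have D0: "D x \<ge> 0" for x by (simp add: D_def)
  have conv: "norm (m x) powr p + c * D x \<le> (norm (a x) powr p + norm (b x) powr p) / 2" for x
    using midpoint_powr[OF p, of "m x" "h x"] by (simp add: mh c_def D_def S_def q_def)
  have iD: "integrable M D"
  proof (rule Bochner_Integration.integrable_bound)
    show "integrable M (\<lambda>x. (norm (a x) powr p + norm (b x) powr p) / 2 / c)" using ia ib by simp
    have "D x \<le> (norm (a x) powr p + norm (b x) powr p) / 2 / c" for x
    proof -
      have "c * D x \<le> (norm (a x) powr p + norm (b x) powr p) / 2"
        using conv[of x] powr_ge_zero[of "norm (m x)" p] by linarith
      then show ?thesis using c by (simp add: field_simps)
    qed
    then show "AE x in M. norm (D x) \<le> norm ((norm (a x) powr p + norm (b x) powr p) / 2 / c)"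
      using D0 c by (auto simp: abs_of_nonneg)
  qed measurable
  \<comment> \<open>After integrating \<open>conv\<close>, the energy of the mean is at least
    \<open>I\<close> by \<open>min1\<close>, while that of \<open>b\<close> is at most
    \<open>I + E\<close>. The average of the two energies therefore exceeds \<open>I\<close> by at
    most \<open>E / 2\<close>.\<close>
  have intD: "(\<integral>x. D x \<partial>M) \<le> E / (2 * c)"
  proof -
    have "(\<integral>x. norm (m x) powr p + c * D x \<partial>M)
        \<le> (\<integral>x. (norm (a x) powr p + norm (b x) powr p) / 2 \<partial>M)"
      using imp iD ia ib conv by (intro integral_mono) auto
    then have "(\<integral>x. norm (m x) powr p \<partial>M) + c * (\<integral>x. D x \<partial>M) \<le> (I + (\<integral>x. norm (b x) powr p \<partial>M)) / 2"
      using imp iD ia ib by (simp add: I_def)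
    moreover have "I \<le> (\<integral>x. norm (m x) powr p \<partial>M)" using min1 by (simp add: I_def m_def)
    ultimately have "c * (\<integral>x. D x \<partial>M) \<le> E / 2" using RB bRB by (simp add: field_simps)
    then show ?thesis using c by (simp add: field_simps)
  qed
  have Sq: "S x powr q \<le> norm (a x) powr p + norm (b x) powr p" for x
  proof -
    \<comment> \<open>The parallelogram law turns \<open>S\<close>, defined through mean and half
      difference, into the average of the squared norms of \<open>a\<close> and
      \<open>b\<close>.\<close>
    have "(norm (m x + h x))\<^sup>2 + (norm (m x - h x))\<^sup>2 = 2 * S x"
      by (simp add: S_def power2_norm_eq_inner inner_simps inner_commute)
    then have "S x = ((norm (a x))\<^sup>2 + (norm (b x))\<^sup>2) / 2" by (simp add: mh)
    also have "\<dots> \<le> (norm (a x))\<^sup>2 + (norm (b x))\<^sup>2" by simp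
    finally have "S x powr q \<le> ((norm (a x))\<^sup>2 + (norm (b x))\<^sup>2) powr q"
      using q by (intro powr_mono2) (auto simp: S_def)
    also have "\<dots> \<le> norm (a x) powr p + norm (b x) powr p"
      using powr_add_le_add_powr[of q "(norm (a x))\<^sup>2" "(norm (b x))\<^sup>2"] q by (simp add: sq)
    finally show ?thesis .
  qed
  have iS: "integrable M (\<lambda>x. S x powr q)"
    by (rule Bochner_Integration.integrable_bound[OF Bochner_Integration.integrable_add[OF ia ib]])
       (use Sq in \<open>auto simp: abs_of_nonneg\<close>)
  have intS: "(\<integral>x. S x powr q \<partial>M) \<le> 2 * (I + E)"
  proof -
    have "(\<integral>x. S x powr q \<partial>M) \<le> (\<integral>x. norm (a x) powr p + norm (b x) powr p \<partial>M)"
      using iS ia ib Sq by (intro integral_mono) auto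
    also have "\<dots> \<le> I + (E + I)" using ia ib RB bRB by (simp add: I_def)
    finally show ?thesis using E0 by simp
  qed
  have two: "(2 * x) powr (1 - q) \<le> 2 * x powr (1 - q)" for x :: real
    using q powr_mono[of "1 - q" 1 "2::real"] by (simp add: powr_mult mult_right_mono)
  have "(\<integral>x. norm (h x) powr p \<partial>M) = (\<integral>x. D x powr q * (S x powr q) powr (1 - q) \<partial>M)"
    using norm_powr_eq_split[of "norm (h x)" "S x" p for x] by (simp add: D_def S_def q_def)
  also have "\<dots> \<le> (\<integral>x. D x \<partial>M) powr q * (\<integral>x. S x powr q \<partial>M) powr (1 - q)"
    using q D0 by (intro Holder_powr iD iS) auto
  also have "\<dots> \<le> (E / (2 * c)) powr q * (2 * (I + E)) powr (1 - q)"
    using intD intS D0 q by (intro mult_mono powr_mono2) auto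
  also have "\<dots> \<le> (E / (2 * c)) powr q * (2 * (I + E) powr (1 - q))"
    by (intro mult_left_mono two) auto
  also have "\<dots> = 2 * (1 / (p * (p - 1))) powr q * (E powr q * (I + E) powr (1 - q))"
    by (simp add: c_def powr_divide)
  finally have L1: "L \<le> 2 powr p * (2 * (1 / (p * (p - 1))) powr q) * (E powr q * (I + E) powr (1 - q))"
    unfolding Lh by (simp add: mult.assoc mult_left_mono)

  \<comment> \<open>\<open>W\<close> plays for \<open>b\<close> the role that \<open>D\<close> plays
    for \<open>h\<close>. The tangent at \<open>\<epsilon> + (norm (b x))\<^sup>2\<close>, evaluated
    at \<open>\<epsilon>\<close>, bounds \<open>q * W x\<close> by the regularised density minus its
    minimal value; that difference has integral \<open>RB - E\<close>, which is at most
    \<open>I\<close>.\<close>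
  define W where "W = (\<lambda>x. (\<epsilon> + (norm (b x))\<^sup>2) powr (q - 1) * (norm (b x))\<^sup>2)"
  have [measurable]: "W \<in> borel_measurable M" unfolding W_def by measurable
  have W0: "W x \<ge> 0" for x by (simp add: W_def)
  have Wle: "q * W x \<le> (\<epsilon> + (norm (b x))\<^sup>2) powr q - \<epsilon> powr q" for x
    using powr_le_tangent[of q "\<epsilon> + (norm (b x))\<^sup>2" \<epsilon>] q eps
    by (simp add: W_def add_pos_nonneg algebra_simps)
  have iRb: "integrable M (\<lambda>x. (\<epsilon> + (norm (b x))\<^sup>2) powr q)" by (rule reg_int[OF b ib])
  have iW: "integrable M W"
  proof (rule Bochner_Integration.integrable_bound)
    show "integrable M (\<lambda>x. (\<epsilon> + (norm (b x))\<^sup>2) powr q / q)" using iRb by simp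
    have "W x \<le> (\<epsilon> + (norm (b x))\<^sup>2) powr q / q" for x
    proof -
      have "q * W x \<le> (\<epsilon> + (norm (b x))\<^sup>2) powr q"
        using Wle[of x] powr_ge_zero[of \<epsilon> q] by linarith
      then show ?thesis using q by (simp add: field_simps)
    qed
    then show "AE x in M. norm (W x) \<le> norm ((\<epsilon> + (norm (b x))\<^sup>2) powr q / q)"
      using W0 q by (auto simp: abs_of_nonneg)
  qed measurable
  have intW: "(\<integral>x. W x \<partial>M) \<le> 2 * I"
  proof -
    have "(\<integral>x. q * W x \<partial>M) \<le> (\<integral>x. (\<epsilon> + (norm (b x))\<^sup>2) powr q - \<epsilon> powr q \<partial>M)"
      using iW iRb Wle by (intro integral_mono) auto
    then have "q * (\<integral>x. W x \<partial>M) \<le> RB - E"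
      using iW iRb by (simp add: RB_def E_def mu_def mult.commute)
    then have "q * (\<integral>x. W x \<partial>M) \<le> I" using RB by linarith
    moreover have "1 / 2 * (\<integral>x. W x \<partial>M) \<le> q * (\<integral>x. W x \<partial>M)"
      using q W0 by (intro mult_right_mono) auto
    ultimately show ?thesis by linarith
  qed
  have two': "(2 * x) powr q \<le> 2 * x powr q" for x :: real
    using q powr_mono[of q 1 "2::real"] by (simp add: powr_mult mult_right_mono)
  have "(\<integral>x. norm (b x) powr p \<partial>M)
      = (\<integral>x. W x powr q * ((\<epsilon> + (norm (b x))\<^sup>2) powr q) powr (1 - q) \<partial>M)"
    using norm_powr_eq_split[of "norm (b x)" "\<epsilon> + (norm (b x))\<^sup>2" p for x] eps
    by (simp add: W_def q_def)
  also have "\<dots> \<le> (\<integral>x. W x \<partial>M) powr q * RB powr (1 - q)"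
    unfolding RB_def using q W0 by (intro Holder_powr iW iRb) auto
  also have "\<dots> \<le> (2 * I) powr q * (I + E) powr (1 - q)"
    using intW RB W0 q by (intro mult_mono powr_mono2) (auto simp: RB_def)
  also have "\<dots> \<le> (2 * I powr q) * (I + E) powr (1 - q)"
    by (intro mult_right_mono two') auto
  finally have B: "(\<integral>x. norm (b x) powr p \<partial>M) \<le> 2 * (I powr q * (I + E) powr (1 - q))" by simp
  have A: "I \<le> I powr q * (I + E) powr (1 - q)"
  proof -
    have "I = I powr q * I powr (1 - q)" using I0 by (simp flip: powr_add)
    also have "\<dots> \<le> I powr q * (I + E) powr (1 - q)"
      using I0 E0 q by (intro mult_left_mono powr_mono2) auto
    finally show ?thesis .
  qed
  have "L \<le> (\<integral>x. 2 powr p * (norm (a x) powr p + norm (b x) powr p) \<partial>M)"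
    unfolding L_def
  proof (intro integral_mono norm_diff_powr_le)
    show "integrable M (\<lambda>x. norm (a x - b x) powr p)"
      using ihp by (simp add: mh powr_mult)
  qed (use ia ib p in auto)
  also have "\<dots> = 2 powr p * (I + (\<integral>x. norm (b x) powr p \<partial>M))"
    using ia ib by (simp add: I_def)
  also have "\<dots> \<le> 2 powr p * (3 * (I powr q * (I + E) powr (1 - q)))"
    using A B by (intro mult_left_mono) auto
  finally have L2: "L \<le> 2 powr p * 3 * (I powr q * (I + E) powr (1 - q))" by simp

  have "L \<le> 2 * (2 powr p * (2 * (1 / (p * (p - 1))) powr q) + 2 powr p * 3)
      * ((mu + I) powr (1 - q) * mu powr q * \<epsilon> powr (q\<^sup>2))"
    using q eps I0 L1 L2
    by (intro interpolate_energy_bounds) (auto simp: E_def mu_def)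
  then show ?thesis
    by (simp add: comparison_const_def L_def mu_def I_def q_def)
qed

section \<open>Smooth functions\<close>

lemma Ck_on_UNIV_SucI:
  assumes "\<And>z. (f has_derivative f' z) (at z)" "\<And>v. Ck_on k UNIV (\<lambda>z. f' z v)"
  shows "Ck_on (Suc k) UNIV f"
proof -
  have "frechet_derivative f (at z) = f' z" for z
    using frechet_derivative_at[OF assms(1)[of z]] by simp
  then show ?thesis using assms by (auto simp: differentiable_def)
qed

lemma Ck_on_UNIV_SucD:
  assumes "Ck_on (Suc k) UNIV f"
  shows "(f has_derivative frechet_derivative f (at z)) (at z)"
    and "Ck_on k UNIV (\<lambda>z. frechet_derivative f (at z) v)"
  using assms by (auto simp: frechet_derivative_works)

text \<open>\<open>Ck_on (Suc k)\<close> records differentiability and the regularity of the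
  derivatives, not that of the function itself. The product rule needs the latter, so it is
  recovered by induction from continuity of differentiable functions.\<close>

lemma Ck_on_UNIV_Suc_imp: "Ck_on (Suc k) UNIV f \<Longrightarrow> Ck_on k UNIV f"
proof (induction k arbitrary: f)
  case 0
  then show ?case
    by (auto intro!: differentiable_imp_continuous_on simp: differentiable_on_def)
next
  case (Suc k)
  note prems = Suc.prems
  show ?case
    by (rule Ck_on_UNIV_SucI[OF Ck_on_UNIV_SucD(1)[OF prems]])
       (rule Suc.IH[OF Ck_on_UNIV_SucD(2)[OF prems]])
qed

lemma Ck_on_const: "Ck_on k UNIV (\<lambda>z. c)"
proof (induction k arbitrary: c)
  case (Suc k)
  show ?case
    by (rule Ck_on_UNIV_SucI[where f' = "\<lambda>z v. 0"]) (auto intro: Suc.IH)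
qed auto

lemma Ck_on_add:
  assumes "Ck_on k UNIV f" "Ck_on k UNIV g"
  shows "Ck_on k UNIV (\<lambda>z. f z + g z)"
  using assms
proof (induction k arbitrary: f g)
  case (Suc k)
  note F = Ck_on_UNIV_SucD[OF Suc.prems(1)] and G = Ck_on_UNIV_SucD[OF Suc.prems(2)]
  show ?case
    by (rule Ck_on_UNIV_SucI[OF has_derivative_add[OF F(1) G(1)]]) (rule Suc.IH[OF F(2) G(2)])
qed (auto intro: continuous_on_add)

lemma Ck_on_mult:
  assumes "Ck_on k UNIV f" "Ck_on k UNIV g"
  shows "Ck_on k UNIV (\<lambda>z. f z * g z)"
  using assms
proof (induction k arbitrary: f g)
  case (Suc k)
  note F = Ck_on_UNIV_SucD[OF Suc.prems(1)] and G = Ck_on_UNIV_SucD[OF Suc.prems(2)]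
  note f = Ck_on_UNIV_Suc_imp[OF Suc.prems(1)] and g = Ck_on_UNIV_Suc_imp[OF Suc.prems(2)]
  show ?case
    by (rule Ck_on_UNIV_SucI[OF has_derivative_mult[OF F(1) G(1)]])
       (rule Ck_on_add[OF Suc.IH[OF f G(2)] Suc.IH[OF F(2) g]])
qed (auto intro: continuous_on_mult)

lemma Ck_on_prod:
  assumes "finite A" "\<And>i. i \<in> A \<Longrightarrow> Ck_on k UNIV (f i)"
  shows "Ck_on k UNIV (\<lambda>z. \<Prod>i\<in>A. f i z)"
  using assms by (induction A rule: finite_induct) (auto intro: Ck_on_const Ck_on_mult)

text \<open>All derivatives of \<open>exp (- 1 / s)\<close> on the positive half line are of this form.\<close>

definition flat_exp :: "real poly \<Rightarrow> real \<Rightarrow> real" where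
  "flat_exp P s = (if 0 < s then poly P (1 / s) * exp (- (1 / s)) else 0)"

lemma poly_times_exp_minus_tendsto_0:
  "((\<lambda>x::real. poly P x * exp (- x)) \<longlongrightarrow> 0) at_top"
proof -
  have "((\<lambda>x. \<Sum>i\<le>degree P. coeff P i * (x ^ i / exp x)) \<longlongrightarrow> (\<Sum>i\<le>degree P. coeff P i * 0)) at_top"
    by (intro tendsto_intros tendsto_power_div_exp_0)
  then show ?thesis
    by (simp add: poly_altdef exp_minus divide_inverse sum_distrib_right mult.assoc)
qed

lemma flat_exp_tendsto_0: "((\<lambda>s. flat_exp P s) \<longlongrightarrow> 0) (at_right 0)"
proof -
  have "((\<lambda>s. poly P (inverse s) * exp (- inverse s)) \<longlongrightarrow> 0) (at_right 0)"
    using filterlim_compose[OF poly_times_exp_minus_tendsto_0 filterlim_inverse_at_top_right]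
    by (simp add: comp_def)
  then show ?thesis
    by (rule Lim_transform_eventually)
       (auto simp: flat_exp_def eventually_at_filter divide_inverse)
qed

text \<open>With x = 1 / s, differentiating P(x) exp(-x) in s gives x^2 (P(x) - P'(x)) exp(-x), and
  the factor x^2 is the double \<open>pCons 0\<close>. At 0 every difference quotient tends to
  0.\<close>

lemma flat_exp_has_derivative:
  "(flat_exp P has_real_derivative flat_exp (pCons 0 (pCons 0 (P - pderiv P))) s) (at s)"
proof -
  consider "0 < s" | "s < 0" | "s = 0" by linarith
  then show ?thesis
  proof cases
    case 1
    have inv: "((\<lambda>s. 1 / s) has_real_derivative - (1 / s\<^sup>2)) (at s)"
      using 1 by (auto intro!: derivative_eq_intros simp: power2_eq_square)
    have "((\<lambda>s. poly P (1 / s) * exp (- (1 / s))) has_real_derivative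
        poly (pderiv P) (1 / s) * - (1 / s\<^sup>2) * exp (- (1 / s))
          + exp (- (1 / s)) * - (- (1 / s\<^sup>2)) * poly P (1 / s)) (at s)"
      by (intro DERIV_mult DERIV_chain2[OF poly_DERIV inv] DERIV_chain2[OF DERIV_exp DERIV_minus[OF inv]])
    also have "poly (pderiv P) (1 / s) * - (1 / s\<^sup>2) * exp (- (1 / s))
        + exp (- (1 / s)) * - (- (1 / s\<^sup>2)) * poly P (1 / s)
        = flat_exp (pCons 0 (pCons 0 (P - pderiv P))) s"
      using 1 by (simp add: flat_exp_def power2_eq_square diff_divide_distrib algebra_simps)
    finally have "((\<lambda>s. poly P (1 / s) * exp (- (1 / s))) has_real_derivative
        flat_exp (pCons 0 (pCons 0 (P - pderiv P))) s) (at s)" .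
    then show ?thesis
      by (rule has_field_derivative_transform_within_open[where S = "{0<..}"])
         (use 1 in \<open>auto simp: flat_exp_def\<close>)
  next
    case 2
    have "((\<lambda>s. 0) has_real_derivative flat_exp (pCons 0 (pCons 0 (P - pderiv P))) s) (at s)"
      using 2 by (simp add: flat_exp_def)
    then show ?thesis
      by (rule has_field_derivative_transform_within_open[where S = "{..<0}"])
         (use 2 in \<open>auto simp: flat_exp_def\<close>)
  next
    case 3
    have "((\<lambda>y. flat_exp P y / y) \<longlongrightarrow> 0) (at 0)"
    proof (rule filterlim_split_at)
      show "((\<lambda>y. flat_exp P y / y) \<longlongrightarrow> 0) (at_left 0)"
        by (rule Lim_transform_eventually[OF tendsto_const])
           (auto simp: flat_exp_def eventually_at_filter)
      \<comment> \<open>Dividing by \<open>y\<close> multiplies the polynomial by its variable, so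
        the quotient is again a \<open>flat_exp\<close> and decays as well.\<close>
      show "((\<lambda>y. flat_exp P y / y) \<longlongrightarrow> 0) (at_right 0)"
        by (rule Lim_transform_eventually[OF flat_exp_tendsto_0[of "pCons 0 P"]])
           (auto simp: flat_exp_def eventually_at_filter)
    qed
    then show ?thesis
      using 3 by (simp add: has_field_derivative_iff flat_exp_def)
  qed
qed

text \<open>Induction with \<open>P\<close> general: by the chain rule the derivative in direction
  \<open>v\<close> is another \<open>flat_exp\<close> of the same affine map, times the constant
  \<open>l v\<close>.\<close>

lemma Ck_on_flat_exp:
  fixes l :: "'a::real_normed_vector \<Rightarrow> real"
  assumes l: "bounded_linear l"
  shows "Ck_on k UNIV (\<lambda>z. flat_exp P (l z + d))"
proof (induction k arbitrary: P)
  case 0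
  have "continuous_on UNIV (flat_exp P)"
    using flat_exp_has_derivative DERIV_continuous_on by blast
  moreover have "continuous_on UNIV (\<lambda>z. l z + d)"
    by (intro continuous_intros linear_continuous_on l)
  ultimately show ?case
    by (auto intro: continuous_on_compose2[of UNIV "flat_exp P"])
next
  case (Suc k)
  let ?Q = "pCons 0 (pCons 0 (P - pderiv P))"
  show ?case
  proof (rule Ck_on_UNIV_SucI)
    fix z
    have "((\<lambda>z. l z + d) has_derivative l) (at z)"
      by (auto intro!: derivative_eq_intros bounded_linear_imp_has_derivative[OF l])
    from has_derivative_compose[OF this, of "flat_exp P" "(*) (flat_exp ?Q (l z + d))"]
    show "((\<lambda>z. flat_exp P (l z + d)) has_derivative (\<lambda>v. flat_exp ?Q (l z + d) * l v)) (at z)"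
      using flat_exp_has_derivative[of P "l z + d"] by (simp add: has_field_derivative_def)
  qed (intro Ck_on_mult Ck_on_const Suc.IH)
qed

text \<open>Smooth functions with support \<open>cbox a b\<close> increasing to the indicator of \<open>box a b\<close>:
  for positive \<open>s\<close> one has \<open>exp (- 1 / (k s)) \<longlongrightarrow> 1\<close> as \<open>k\<close> grows.\<close>

definition box_bump :: "'a::euclidean_space \<Rightarrow> 'a \<Rightarrow> nat \<Rightarrow> 'a \<Rightarrow> real" where
  "box_bump a b k z = (\<Prod>i\<in>Basis. flat_exp 1 (real (Suc k) * (z \<bullet> i - a \<bullet> i)) *
     flat_exp 1 (real (Suc k) * (b \<bullet> i - z \<bullet> i)))"

lemma smooth_box_bump: "smooth_on UNIV (box_bump a b n)"
proof -
  define r where "r = real (Suc n)"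
  have "Ck_on k UNIV (\<lambda>z. flat_exp 1 (r * (z \<bullet> i) + - (r * (a \<bullet> i))))"
    "Ck_on k UNIV (\<lambda>z. flat_exp 1 (- (r * (z \<bullet> i)) + r * (b \<bullet> i)))" for i k
    by (rule Ck_on_flat_exp, intro bounded_linear_minus bounded_linear_const_mult bounded_linear_inner_left)+
  moreover have "r * (z \<bullet> i) + - (r * (a \<bullet> i)) = r * (z \<bullet> i - a \<bullet> i)"
    "- (r * (z \<bullet> i)) + r * (b \<bullet> i) = r * (b \<bullet> i - z \<bullet> i)" for z i
    by (simp_all only: right_diff_distrib)
  ultimately have "Ck_on k UNIV (\<lambda>z. flat_exp 1 (r * (z \<bullet> i - a \<bullet> i)) * flat_exp 1 (r * (b \<bullet> i - z \<bullet> i)))" for i k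
    by (intro Ck_on_mult) simp_all
  then show ?thesis
    unfolding smooth_on_def box_bump_def[abs_def] r_def by (intro allI Ck_on_prod finite_Basis)
qed

lemma flat_exp_1_bounds: "0 \<le> flat_exp 1 s" "flat_exp 1 s \<le> 1"
  by (auto simp: flat_exp_def)

lemma box_bump_bounds: "0 \<le> box_bump a b k z" "box_bump a b k z \<le> 1"
proof -
  have "0 \<le> flat_exp 1 x * flat_exp 1 y \<and> flat_exp 1 x * flat_exp 1 y \<le> 1" for x y
    using flat_exp_1_bounds[of x] flat_exp_1_bounds[of y] by (simp add: mult_le_one)
  then show "0 \<le> box_bump a b k z" "box_bump a b k z \<le> 1"
    unfolding box_bump_def by (blast intro: prod_nonneg prod_le_1)+
qed

lemma box_bump_eq_0: "z \<notin> box a b \<Longrightarrow> box_bump a b k z = 0"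
proof -
  assume "z \<notin> box a b"
  then obtain i where i: "i \<in> Basis" "z \<bullet> i \<le> a \<bullet> i \<or> b \<bullet> i \<le> z \<bullet> i"
    by (auto simp: mem_box not_less)
  then have "real (Suc k) * (z \<bullet> i - a \<bullet> i) \<le> 0 \<or> real (Suc k) * (b \<bullet> i - z \<bullet> i) \<le> 0"
    by (auto intro: mult_nonneg_nonpos)
  then have "flat_exp 1 (real (Suc k) * (z \<bullet> i - a \<bullet> i)) * flat_exp 1 (real (Suc k) * (b \<bullet> i - z \<bullet> i)) = 0"
    by (auto simp: flat_exp_def simp del: of_nat_Suc)
  then show ?thesis
    unfolding box_bump_def using i by (intro prod_zero) auto
qed

lemma box_bump_tendsto_indicator: "(\<lambda>k. box_bump a b k z) \<longlonglongrightarrow> indicator (box a b) z"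
proof (cases "z \<in> box a b")
  case True
  have "(\<lambda>k. flat_exp 1 (real (Suc k) * s)) \<longlonglongrightarrow> 1" if "s > 0" for s
  proof -
    have "(\<lambda>k. exp (- (inverse s * inverse (real (Suc k))))) \<longlonglongrightarrow> exp (- (inverse s * 0))"
      by (intro tendsto_intros LIMSEQ_inverse_real_of_nat)
    then show ?thesis using that by (simp add: flat_exp_def divide_inverse mult.commute)
  qed
  then have "(\<lambda>k. box_bump a b k z) \<longlonglongrightarrow> (\<Prod>i\<in>(Basis::'a set). 1 * 1)"
    unfolding box_bump_def using True by (intro tendsto_intros) (auto simp: mem_box)
  then show ?thesis using True by simp
qed (simp add: box_bump_eq_0)

lemma box_bump_test_function:
  assumes "cbox a b \<subseteq> U"
  shows "box_bump a b k \<in> test_functions U"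
proof -
  have "closure {z. box_bump a b k z \<noteq> 0} \<subseteq> cbox a b"
    using box_bump_eq_0[of _ a b k] box_subset_cbox[of a b]
    by (intro closure_minimal) auto
  moreover from this have "compact (closure {z. box_bump a b k z \<noteq> 0})"
    using compact_Int_closed[OF compact_cbox closed_closure] by (metis inf.absorb2)
  ultimately show ?thesis
    using assms smooth_box_bump[of a b k] by (auto simp: test_functions_def)
qed

section \<open>Test functions and derivatives along a field\<close>

lemma lie_deriv_eq_frechet:
  assumes "f differentiable (at z)"
  shows "lie_deriv V f z = frechet_derivative f (at z) (V z)"
proof -
  have "(f has_derivative frechet_derivative f (at z)) (at (z + 0 *\<^sub>R V z))"
    using assms by (simp add: frechet_derivative_works)
  then have "((\<lambda>s. f (z + s *\<^sub>R V z)) has_derivative (\<lambda>s. frechet_derivative f (at z) (s *\<^sub>R V z))) (at 0)"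
    by (rule has_derivative_compose[rotated]) (auto intro!: derivative_eq_intros)
  moreover have "frechet_derivative f (at z) (s *\<^sub>R V z) = frechet_derivative f (at z) (V z) * s" for s
    using linear_cmul[OF linear_frechet_derivative[OF assms]] by simp
  ultimately show ?thesis
    unfolding lie_deriv_def
    by (intro DERIV_imp_deriv) (simp add: has_field_derivative_def)
qed

lemma frechet_derivative_Basis_expansion:
  fixes f :: "'a::euclidean_space \<Rightarrow> real"
  assumes "f differentiable (at z)"
  shows "frechet_derivative f (at z) v = (\<Sum>i\<in>Basis. (v \<bullet> i) * frechet_derivative f (at z) i)"
proof -
  have "frechet_derivative f (at z) v = frechet_derivative f (at z) (\<Sum>i\<in>Basis. (v \<bullet> i) *\<^sub>R i)"
    by (simp add: euclidean_representation)
  also have "\<dots> = (\<Sum>i\<in>Basis. (v \<bullet> i) * frechet_derivative f (at z) i)"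
    using linear_frechet_derivative[OF assms] by (simp add: linear_sum linear_cmul)
  finally show ?thesis .
qed

text \<open>\<open>Ck_on\<close> controls derivatives in fixed directions only, whereas
  \<open>V z\<close> varies with \<open>z\<close>. The expansion separates the two dependences, both
  for continuity and for integration by parts.\<close>

lemma lie_deriv_Basis_expansion:
  fixes f :: "'a::euclidean_space \<Rightarrow> real"
  assumes "Ck_on (Suc 0) UNIV f"
  shows "lie_deriv V f = (\<lambda>z. \<Sum>i\<in>Basis. (V z \<bullet> i) * frechet_derivative f (at z) i)"
proof
  fix z
  have "f differentiable (at z)" using assms by simp
  then show "lie_deriv V f z = (\<Sum>i\<in>Basis. (V z \<bullet> i) * frechet_derivative f (at z) i)"
    by (simp only: lie_deriv_eq_frechet frechet_derivative_Basis_expansion[of f z "V z"])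
qed

lemma continuous_lie_deriv:
  fixes f :: "'a::euclidean_space \<Rightarrow> real"
  assumes "Ck_on (Suc 0) UNIV f" "continuous_on UNIV V"
  shows "continuous_on UNIV (lie_deriv V f)"
  using assms unfolding lie_deriv_Basis_expansion[OF assms(1)]
  by (auto intro!: continuous_intros)

lemma test_function_Ck: "\<phi> \<in> test_functions U \<Longrightarrow> Ck_on k UNIV \<phi>"
  by (auto simp: test_functions_def smooth_on_def)

lemma test_function_differentiable: "\<phi> \<in> test_functions U \<Longrightarrow> \<phi> differentiable (at z)"
  using test_function_Ck[of \<phi> U "Suc 0"] by auto

lemma test_function_continuous: "\<phi> \<in> test_functions U \<Longrightarrow> continuous_on UNIV \<phi>"
  using test_function_Ck[of \<phi> U 0] by auto

lemma test_functions_mono: "U \<subseteq> W \<Longrightarrow> test_functions U \<subseteq> test_functions W"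
  by (auto simp: test_functions_def)

lemma test_functions_linear:
  fixes \<phi> \<eta> :: "'a::euclidean_space \<Rightarrow> real"
  assumes "\<phi> \<in> test_functions U" "\<eta> \<in> test_functions U"
  shows "(\<lambda>z. \<phi> z + c * \<eta> z) \<in> test_functions U"
proof -
  let ?S = "closure {z. \<phi> z \<noteq> 0} \<union> closure {z. \<eta> z \<noteq> 0}"
  have S: "closure {z. \<phi> z + c * \<eta> z \<noteq> 0} \<subseteq> ?S"
  proof (rule closure_minimal)
    have "{z. \<phi> z + c * \<eta> z \<noteq> 0} \<subseteq> {z. \<phi> z \<noteq> 0} \<union> {z. \<eta> z \<noteq> 0}" by auto
    then show "{z. \<phi> z + c * \<eta> z \<noteq> 0} \<subseteq> ?S"
      using closure_subset[of "{z. \<phi> z \<noteq> 0}"] closure_subset[of "{z. \<eta> z \<noteq> 0}"] by blast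
  qed auto
  have "compact ?S" using assms by (auto simp: test_functions_def intro: compact_Un)
  then have "compact (?S \<inter> closure {z. \<phi> z + c * \<eta> z \<noteq> 0})"
    by (rule compact_Int_closed[OF _ closed_closure])
  also have "?S \<inter> closure {z. \<phi> z + c * \<eta> z \<noteq> 0} = closure {z. \<phi> z + c * \<eta> z \<noteq> 0}"
    using S by blast
  finally have "compact (closure {z. \<phi> z + c * \<eta> z \<noteq> 0})" .
  moreover have "smooth_on UNIV (\<lambda>z. \<phi> z + c * \<eta> z)"
    using assms by (auto simp: test_functions_def smooth_on_def intro!: Ck_on_add Ck_on_mult Ck_on_const)
  ultimately show ?thesis
    using S assms by (auto simp: test_functions_def)
qed

lemma zero_test_function: "(\<lambda>z. 0) \<in> test_functions U"
  by (auto simp: test_functions_def smooth_on_def Ck_on_const)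

lemma lie_deriv_linear:
  assumes "\<phi> differentiable (at z)" "\<eta> differentiable (at z)"
  shows "lie_deriv V (\<lambda>z. \<phi> z + c * \<eta> z) z = lie_deriv V \<phi> z + c * lie_deriv V \<eta> z"
proof -
  have d: "((\<lambda>z. \<phi> z + c * \<eta> z) has_derivative
      (\<lambda>v. frechet_derivative \<phi> (at z) v + c * frechet_derivative \<eta> (at z) v)) (at z)"
    using assms by (auto intro!: derivative_intros simp: frechet_derivative_works)
  then have "(\<lambda>z. \<phi> z + c * \<eta> z) differentiable (at z)" by (auto simp: differentiable_def)
  then show ?thesis
    using assms by (simp add: lie_deriv_eq_frechet flip: frechet_derivative_at[OF d])
qed

lemma lie_deriv_mult:
  assumes "\<phi> differentiable (at z)" "\<eta> differentiable (at z)"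
  shows "lie_deriv V (\<lambda>z. \<phi> z * \<eta> z) z = \<phi> z * lie_deriv V \<eta> z + lie_deriv V \<phi> z * \<eta> z"
proof -
  have d: "((\<lambda>z. \<phi> z * \<eta> z) has_derivative
      (\<lambda>v. \<phi> z * frechet_derivative \<eta> (at z) v + frechet_derivative \<phi> (at z) v * \<eta> z)) (at z)"
    using assms by (auto intro!: derivative_intros simp: frechet_derivative_works)
  then have "(\<lambda>z. \<phi> z * \<eta> z) differentiable (at z)" by (auto simp: differentiable_def)
  then show ?thesis
    using assms by (simp add: lie_deriv_eq_frechet flip: frechet_derivative_at[OF d])
qed

lemma lie_deriv_eq_0_off_support:
  assumes "z \<notin> closure {z. f z \<noteq> 0}"
  shows "lie_deriv V f z = 0"
proof -
  have "((\<lambda>z. 0) has_derivative (\<lambda>v. 0)) (at z)" by simp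
  then have d: "(f has_derivative (\<lambda>v. 0)) (at z)"
    by (rule has_derivative_transform_within_open[where s = "- closure {z. f z \<noteq> 0}"])
       (use assms closure_subset[of "{z. f z \<noteq> 0}"] in auto)
  then have "f differentiable (at z)" by (auto simp: differentiable_def)
  then show ?thesis
    by (simp add: lie_deriv_eq_frechet flip: frechet_derivative_at[OF d])
qed

section \<open>Integration by parts\<close>

lemma continuous_compact_support_integrable:
  fixes f :: "'a::euclidean_space \<Rightarrow> real"
  assumes "continuous_on UNIV f" "compact K" "\<And>z. z \<notin> K \<Longrightarrow> f z = 0"
  shows "integrable lborel f"
proof -
  have "integrable lborel (\<lambda>z. indicator K z *\<^sub>R f z)"
    using assms by (intro borel_integrable_compact) (auto intro: continuous_on_subset)
  moreover have "indicator K z *\<^sub>R f z = f z" for z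
    using assms(3)[of z] by (cases "z \<in> K") auto
  ultimately show ?thesis by (simp only:)
qed

lemma continuous_compact_support_bounded:
  fixes f :: "'a::euclidean_space \<Rightarrow> real"
  assumes "continuous_on UNIV f" "compact K" "\<And>z. z \<notin> K \<Longrightarrow> f z = 0"
  obtains C where "0 \<le> C" "\<And>z. \<bar>f z\<bar> \<le> C"
proof -
  have "compact (f ` K)"
    using assms by (intro compact_continuous_image) (auto intro: continuous_on_subset)
  then obtain C where C: "\<And>z. z \<in> K \<Longrightarrow> \<bar>f z\<bar> \<le> C"
    using compact_imp_bounded bounded_iff by (metis imageI real_norm_def)
  have "\<bar>f z\<bar> \<le> max C 0" for z
    using C[of z] assms(3)[of z] by (cases "z \<in> K") auto
  then show ?thesis by (intro that[of "max C 0"]) auto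
qed

text \<open>Difference quotients of \<open>g\<close> integrate to 0 by translation invariance of
  Lebesgue measure, and dominated convergence passes to the derivative \<open>h\<close>.\<close>

lemma integral_directional_derivative_eq_0:
  fixes g h :: "'a::euclidean_space \<Rightarrow> real" and v :: 'a
  assumes cg: "continuous_on UNIV g" and ch: "continuous_on UNIV h" and K: "compact K"
    and g0: "\<And>z. z \<notin> K \<Longrightarrow> g z = 0" and h0: "\<And>z. z \<notin> K \<Longrightarrow> h z = 0"
    and deriv: "\<And>z s. ((\<lambda>s. g (z + s *\<^sub>R v)) has_real_derivative h (z + s *\<^sub>R v)) (at s)"
  shows "(\<integral>z. h z \<partial>lborel) = 0"
proof -
  obtain C where C: "0 \<le> C" "\<And>z. \<bar>h z\<bar> \<le> C"
    using continuous_compact_support_bounded[OF ch K h0] by blast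
  \<comment> \<open>\<open>K'\<close> collects the points from which a step along \<open>v\<close>
    of length parameter at most 1 reaches \<open>K\<close>. By the mean value theorem it contains
    the support of every \<open>D n\<close>, so a multiple of its indicator dominates.\<close>
  define K' where "K' = (\<lambda>(z, s). z - s *\<^sub>R v) ` (K \<times> {0..1})"
  have K': "compact K'"
    unfolding K'_def using K
    by (intro compact_continuous_image compact_Times) (auto intro!: continuous_intros simp: case_prod_unfold)
  define D where "D = (\<lambda>n z. real (Suc n) * (g (z + (1 / real (Suc n)) *\<^sub>R v) - g z))"
  have cgt: "continuous_on UNIV (\<lambda>z. g (z + w))" for w
    by (rule continuous_on_compose2[OF cg]) (auto intro!: continuous_intros)
  have ig: "integrable lborel g" by (rule continuous_compact_support_integrable[OF cg K g0])
  have [measurable]: "g \<in> borel_measurable borel" "h \<in> borel_measurable borel"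
    using cg ch by (simp_all add: borel_measurable_continuous_onI)
  have shift: "(\<integral>z. g (z + w) \<partial>lborel) = (\<integral>z. g z \<partial>lborel)" for w
  proof -
    have "(\<integral>z. g z \<partial>lborel) = (\<integral>z. g z \<partial>(distr lborel borel ((+) w)))"
      by (simp add: lborel_distr_plus)
    also have "\<dots> = (\<integral>z. g (w + z) \<partial>lborel)" by (rule integral_distr) auto
    finally show ?thesis by (simp add: add.commute)
  qed
  have igt: "integrable lborel (\<lambda>z. g (z + w))" for w
  proof (rule continuous_compact_support_integrable[OF cgt])
    show "compact ((\<lambda>z. z - w) ` K)"
      using K by (intro compact_continuous_image continuous_intros)
    show "g (z + w) = 0" if "z \<notin> (\<lambda>z. z - w) ` K" for z
      using g0[of "z + w"] that by (metis add_diff_cancel imageI)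
  qed
  have D_int: "(\<integral>z. D n z \<partial>lborel) = 0" for n
    unfolding D_def using igt ig shift by simp
  have bound: "\<bar>D n z\<bar> \<le> indicator K' z * C" for n z
  proof -
    define t where "t = 1 / real (Suc n)"
    have t: "0 < t" "t \<le> 1" "real (Suc n) = 1 / t" by (auto simp: t_def)
    have "\<exists>s. 0 < s \<and> s < t \<and> g (z + t *\<^sub>R v) - g z = t * h (z + s *\<^sub>R v)"
    proof -
      have "\<exists>s. 0 < s \<and> s < t \<and> g (z + t *\<^sub>R v) - g (z + 0 *\<^sub>R v) = (t - 0) * h (z + s *\<^sub>R v)"
        by (rule MVT2[OF t(1)]) (rule deriv)
      then show ?thesis by simp
    qed
    then obtain s where s: "0 < s" "s < t" "g (z + t *\<^sub>R v) - g z = t * h (z + s *\<^sub>R v)" by blast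
    have D: "D n z = h (z + s *\<^sub>R v)"
      using s(3) t by (simp add: D_def flip: t_def)
    show ?thesis
    proof (cases "z \<in> K'")
      case True
      then show ?thesis using C(2) D by simp
    next
      case False
      have "z + s *\<^sub>R v \<notin> K"
      proof
        assume "z + s *\<^sub>R v \<in> K"
        then have "(z + s *\<^sub>R v, s) \<in> K \<times> {0..1}" using s t by auto
        then have "z \<in> K'" unfolding K'_def by (rule rev_image_eqI) simp
        then show False using False by simp
      qed
      then show ?thesis using D h0 False by simp
    qed
  qed
  have lim: "(\<lambda>n. D n z) \<longlonglongrightarrow> h z" for z
  proof -
    have "((\<lambda>s. (g (z + s *\<^sub>R v) - g z) / s) \<longlongrightarrow> h z) (at 0)"
      using deriv[of z 0] by (simp add: has_field_derivative_iff)
    moreover have "filterlim (\<lambda>n. 1 / real (Suc n)) (at 0) sequentially"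
      unfolding filterlim_at using LIMSEQ_inverse_real_of_nat by (simp add: divide_inverse)
    ultimately have "(\<lambda>n. (g (z + (1 / real (Suc n)) *\<^sub>R v) - g z) / (1 / real (Suc n))) \<longlonglongrightarrow> h z"
      by (rule filterlim_compose)
    then show ?thesis by (simp add: D_def mult.commute)
  qed
  have "(\<lambda>n. \<integral>z. D n z \<partial>lborel) \<longlonglongrightarrow> (\<integral>z. h z \<partial>lborel)"
  proof (rule integral_dominated_convergence)
    show "integrable lborel (\<lambda>z. indicator K' z * C)"
      using borel_integrable_compact[OF K', of "\<lambda>_. C"] by simp
    show "D n \<in> borel_measurable lborel" for n
      unfolding D_def using borel_measurable_continuous_onI[OF cgt] by measurable
  qed (use lim bound in auto)
  then show ?thesis using D_int by (simp add: LIMSEQ_const_iff)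
qed

text \<open>A form of divergence freeness that needs no differentiability of the field.\<close>

definition shear_field :: "('a::euclidean_space \<Rightarrow> 'a) \<Rightarrow> bool" where
  "shear_field V \<longleftrightarrow> continuous_on UNIV V \<and> (\<forall>i\<in>Basis. \<forall>z s. V (z + s *\<^sub>R i) \<bullet> i = V z \<bullet> i)"

text \<open>Each component \<open>V z \<bullet> i\<close> is constant along \<open>i\<close>, so it
  can be moved inside the derivative in direction \<open>i\<close> without differentiating
  \<open>V\<close>; every summand is then a pure directional derivative of a compactly supported
  function.\<close>

lemma integral_lie_deriv_eq_0:
  fixes f :: "'a::euclidean_space \<Rightarrow> real"
  assumes V: "shear_field V" and f: "Ck_on (Suc 0) UNIV f"
    and K: "compact K" and f0: "\<And>z. z \<notin> K \<Longrightarrow> f z = 0"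
  shows "(\<integral>z. lie_deriv V f z \<partial>lborel) = 0"
proof -
  have cV: "continuous_on UNIV V" using V by (simp add: shear_field_def)
  have diff: "f differentiable (at z)" for z using f by simp
  have cf: "continuous_on UNIV f" using Ck_on_UNIV_Suc_imp[OF f] by simp
  have cd: "continuous_on UNIV (\<lambda>z. frechet_derivative f (at z) i)" for i using f by simp
  have supp: "closure {z. f z \<noteq> 0} \<subseteq> K"
    using f0 K by (intro closure_minimal) (auto simp: compact_imp_closed)
  have d0: "frechet_derivative f (at z) i = 0" if "z \<notin> K" for z i
  proof -
    have "lie_deriv (\<lambda>_. i) f z = 0" using that supp by (intro lie_deriv_eq_0_off_support) auto
    then show ?thesis using lie_deriv_eq_frechet[OF diff, of "\<lambda>_. i" z] by simp
  qed
  have I: "integrable lborel (\<lambda>z. (V z \<bullet> i) * frechet_derivative f (at z) i)" for i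
    by (rule continuous_compact_support_integrable[OF _ K])
       (use cV cd d0 in \<open>auto intro!: continuous_intros\<close>)
  have Z: "(\<integral>z. (V z \<bullet> i) * frechet_derivative f (at z) i \<partial>lborel) = 0" if i: "i \<in> Basis" for i
  proof (rule integral_directional_derivative_eq_0[OF _ _ K, where g = "\<lambda>z. (V z \<bullet> i) * f z" and v = i])
    fix z s
    have "((\<lambda>s. f (z + s *\<^sub>R i)) has_derivative
        (\<lambda>t. frechet_derivative f (at (z + s *\<^sub>R i)) (t *\<^sub>R i))) (at s)"
      by (rule has_derivative_compose[of "\<lambda>s. z + s *\<^sub>R i"])
         (use diff in \<open>auto intro!: derivative_eq_intros simp: frechet_derivative_works\<close>)
    moreover have "(\<lambda>t. frechet_derivative f (at (z + s *\<^sub>R i)) (t *\<^sub>R i))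
        = (*) (frechet_derivative f (at (z + s *\<^sub>R i)) i)"
      by (rule ext) (simp add: linear_cmul[OF linear_frechet_derivative[OF diff]])
    ultimately have "((\<lambda>s. f (z + s *\<^sub>R i)) has_real_derivative
        frechet_derivative f (at (z + s *\<^sub>R i)) i) (at s)"
      by (simp only: has_field_derivative_def)
    then have "((\<lambda>s. (V z \<bullet> i) * f (z + s *\<^sub>R i)) has_real_derivative
        (V z \<bullet> i) * frechet_derivative f (at (z + s *\<^sub>R i)) i) (at s)"
      by (rule DERIV_cmult)
    moreover have "V (z + s *\<^sub>R i) \<bullet> i = V z \<bullet> i" for s
      using V i by (simp add: shear_field_def)
    ultimately show "((\<lambda>s. (V (z + s *\<^sub>R i) \<bullet> i) * f (z + s *\<^sub>R i)) has_real_derivative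
        (V (z + s *\<^sub>R i) \<bullet> i) * frechet_derivative f (at (z + s *\<^sub>R i)) i) (at s)"
      by simp
  qed (use cV cf cd f0 d0 in \<open>auto intro!: continuous_intros\<close>)
  show ?thesis
    unfolding lie_deriv_Basis_expansion[OF f] using I Z by simp
qed

lemma
  fixes f :: "'a::euclidean_space \<Rightarrow> real"
  assumes "U \<in> sets lebesgue" "K \<subseteq> U" "continuous_on UNIV f" "compact K" "\<And>z. z \<notin> K \<Longrightarrow> f z = 0"
  shows continuous_compact_support_integrable_on: "integrable (lebesgue_on U) f"
    and continuous_compact_support_integral_on: "(\<integral>z. f z \<partial>lebesgue_on U) = (\<integral>z. f z \<partial>lborel)"
proof -
  have [measurable]: "f \<in> borel_measurable borel"
    using assms by (simp add: borel_measurable_continuous_onI)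
  have eq: "indicat_real U z *\<^sub>R f z = f z" for z
    using assms(2) assms(5)[of z] by (cases "z \<in> K") auto
  have "integrable lborel f"
    by (rule continuous_compact_support_integrable[OF assms(3-5)])
  then show "integrable (lebesgue_on U) f" "(\<integral>z. f z \<partial>lebesgue_on U) = (\<integral>z. f z \<partial>lborel)"
    using assms(1)
    by (simp_all add: integrable_restrict_space integral_restrict_space eq[unfolded real_scaleR_def]
        integrable_completion integral_completion)
qed

lemma continuous_locally_integrable:
  fixes f :: "'a::euclidean_space \<Rightarrow> real"
  assumes "continuous_on UNIV f"
  shows "locally_integrable U f"
  unfolding locally_integrable_def
proof (intro allI impI)
  fix K assume "compact K \<and> K \<subseteq> U"
  then have K: "compact K" by simp
  then have [measurable]: "K \<in> sets borel" by (simp add: compact_imp_closed borel_closed)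
  have "integrable lborel (\<lambda>z. indicator K z *\<^sub>R f z)"
    using assms K by (intro borel_integrable_compact) (auto intro: continuous_on_subset)
  moreover have "f \<in> borel_measurable borel" using assms by (simp add: borel_measurable_continuous_onI)
  ultimately show "integrable (lebesgue_on K) f"
    by (simp add: integrable_restrict_space integrable_completion)
qed

text \<open>Apply \<open>integral_lie_deriv_eq_0\<close> to the product of \<open>\<phi>\<close> and
  a test function, which inherits compact support from the latter. Allowing every C1 function
  \<open>\<phi>\<close> matters for extension by zero, where \<open>\<phi>\<close> is a test
  function of a set larger than \<open>U\<close>.\<close>

lemma C1_has_weak_deriv:
  fixes \<phi> :: "'a::euclidean_space \<Rightarrow> real"
  assumes V: "shear_field V" and U: "open U" and phi: "Ck_on (Suc 0) UNIV \<phi>"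
  shows "has_weak_deriv U V \<phi> (lie_deriv V \<phi>)"
  unfolding has_weak_deriv_def
proof (intro conjI ballI)
  have cV: "continuous_on UNIV V" using V by (simp add: shear_field_def)
  have diff: "\<phi> differentiable (at z)" for z using phi by simp
  have c\<phi>: "continuous_on UNIV \<phi>" using Ck_on_UNIV_Suc_imp[OF phi] by simp
  have cL: "continuous_on UNIV (lie_deriv V \<phi>)" by (rule continuous_lie_deriv[OF phi cV])
  show "locally_integrable U (lie_deriv V \<phi>)"
    by (rule continuous_locally_integrable[OF cL])
  fix \<eta> assume \<eta>: "\<eta> \<in> test_functions U"
  define K where "K = closure {z. \<eta> z \<noteq> 0}"
  have K: "compact K" "K \<subseteq> U" using \<eta> by (auto simp: K_def test_functions_def)
  have \<eta>0: "\<eta> z = 0" "lie_deriv V \<eta> z = 0" if "z \<notin> K" for z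
    using that closure_subset[of "{z. \<eta> z \<noteq> 0}"] lie_deriv_eq_0_off_support[of z \<eta>]
    by (auto simp: K_def)
  note diff' = test_function_differentiable[OF \<eta>] and c\<eta> = test_function_continuous[OF \<eta>]
  have cL': "continuous_on UNIV (lie_deriv V \<eta>)"
    by (rule continuous_lie_deriv[OF test_function_Ck[OF \<eta>] cV])
  have "(\<integral>z. lie_deriv V (\<lambda>z. \<phi> z * \<eta> z) z \<partial>lborel) = 0"
    using \<eta>0 by (intro integral_lie_deriv_eq_0[OF V _ K(1)] Ck_on_mult phi test_function_Ck[OF \<eta>]) auto
  moreover have "lie_deriv V (\<lambda>z. \<phi> z * \<eta> z) z = \<phi> z * lie_deriv V \<eta> z + lie_deriv V \<phi> z * \<eta> z" for z
    by (rule lie_deriv_mult[OF diff diff'])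
  moreover have "integrable lborel (\<lambda>z. \<phi> z * lie_deriv V \<eta> z)" "integrable lborel (\<lambda>z. lie_deriv V \<phi> z * \<eta> z)"
    using K \<eta>0 c\<phi> cL c\<eta> cL'
    by (auto intro!: continuous_compact_support_integrable[OF _ K(1)] continuous_intros)
  ultimately have "(\<integral>z. \<phi> z * lie_deriv V \<eta> z \<partial>lborel) = - (\<integral>z. lie_deriv V \<phi> z * \<eta> z \<partial>lborel)"
    by (simp add: add_eq_0_iff)
  moreover have "U \<in> sets lebesgue" using U by (simp add: borel_open)
  ultimately show "(LINT z|lebesgue_on U. \<phi> z * lie_deriv V \<eta> z) = - (LINT z|lebesgue_on U. lie_deriv V \<phi> z * \<eta> z)"
    using K \<eta>0 c\<phi> cL c\<eta> cL'
    by (subst (1 2) continuous_compact_support_integral_on[OF _ K(2) _ K(1)]) (auto intro!: continuous_intros)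
qed

section \<open>The fundamental lemma of the calculus of variations\<close>

lemma locally_integrable_times_integrable:
  fixes v f :: "'a::euclidean_space \<Rightarrow> real"
  assumes v: "locally_integrable U v" and U: "U \<in> sets lebesgue" and K: "compact K" "K \<subseteq> U"
    and f: "continuous_on UNIV f" "\<And>z. z \<notin> K \<Longrightarrow> f z = 0"
  shows "integrable (lebesgue_on U) (\<lambda>z. v z * f z)"
proof -
  obtain C where C: "\<And>z. \<bar>f z\<bar> \<le> C"
    using continuous_compact_support_bounded[OF f(1) K(1) f(2)] by metis
  have [measurable]: "K \<in> sets borel" using K by (simp add: compact_imp_closed borel_closed)
  have "integrable (lebesgue_on K) v" using v K by (auto simp: locally_integrable_def)
  then have iK: "integrable lebesgue (\<lambda>z. indicator K z *\<^sub>R v z)"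
    by (simp add: integrable_restrict_space)
  have [measurable]: "f \<in> borel_measurable lebesgue"
    using f(1) by (simp add: borel_measurable_continuous_onI measurable_completion)
  have "integrable lebesgue (\<lambda>z. (indicator K z *\<^sub>R v z) * f z)"
  proof (rule Bochner_Integration.integrable_bound)
    show "integrable lebesgue (\<lambda>z. C * (indicator K z *\<^sub>R v z))" using iK by (rule integrable_mult_right)
    show "AE z in lebesgue. norm ((indicator K z *\<^sub>R v z) * f z) \<le> norm (C * (indicator K z *\<^sub>R v z))"
      using C order_trans[OF abs_ge_zero C] by (auto simp: abs_mult mult.commute intro!: mult_right_mono)
  qed (use borel_measurable_integrable[OF iK] in measurable)
  moreover have "(indicator K z *\<^sub>R v z) * f z = indicator U z *\<^sub>R (v z * f z)" for z
    using K f(2)[of z] by (cases "z \<in> K") auto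
  ultimately have "integrable lebesgue (\<lambda>z. indicator U z *\<^sub>R (v z * f z))" by (simp only:)
  then show ?thesis
    using U by (simp add: integrable_restrict_space)
qed

text \<open>The bumps of the box are admissible test functions and converge boundedly to its
  indicator; \<open>v\<close> is integrable on the closed box and provides the dominating
  function.\<close>

lemma integral_box_eq_0:
  fixes v :: "'a::euclidean_space \<Rightarrow> real"
  assumes U: "open U" and v: "locally_integrable U v"
    and test: "\<And>\<phi>. \<phi> \<in> test_functions U \<Longrightarrow> (LINT z|lebesgue_on U. v z * \<phi> z) = 0"
    and box: "cbox a b \<subseteq> U"
  shows "(\<integral>z. indicator (box a b) z * v z \<partial>lebesgue) = 0"
proof -
  have Us: "U \<in> sets lebesgue" using U by (simp add: borel_open)
  have "integrable (lebesgue_on (cbox a b)) v" using v box by (auto simp: locally_integrable_def)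
  then have iK: "integrable lebesgue (\<lambda>z. indicator (cbox a b) z *\<^sub>R v z)"
    by (simp add: integrable_restrict_space)
  have bb: "box_bump a b k \<in> borel_measurable lebesgue" for k
    using test_function_continuous[OF box_bump_test_function[OF box]]
    by (simp add: borel_measurable_continuous_onI measurable_completion)
  define s where "s = (\<lambda>k z. box_bump a b k z * (indicator (cbox a b) z *\<^sub>R v z))"
  have "(\<lambda>k. \<integral>z. s k z \<partial>lebesgue) \<longlonglongrightarrow> (\<integral>z. indicator (box a b) z * (indicator (cbox a b) z *\<^sub>R v z) \<partial>lebesgue)"
  proof (rule integral_dominated_convergence)
    show "integrable lebesgue (\<lambda>z. \<bar>indicator (cbox a b) z *\<^sub>R v z\<bar>)" using iK by (rule integrable_abs)
    show "AE z in lebesgue. (\<lambda>k. s k z) \<longlonglongrightarrow> indicator (box a b) z * (indicator (cbox a b) z *\<^sub>R v z)"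
      unfolding s_def by (intro AE_I2 tendsto_intros box_bump_tendsto_indicator)
    show "AE z in lebesgue. norm (s k z) \<le> \<bar>indicator (cbox a b) z *\<^sub>R v z\<bar>" for k
      using box_bump_bounds[of a b k] by (auto simp: s_def abs_mult mult_left_le_one_le)
    show "s k \<in> borel_measurable lebesgue" for k unfolding s_def by (rule borel_measurable_times[OF bb borel_measurable_integrable[OF iK]])
    show "(\<lambda>z. indicator (box a b) z * (indicator (cbox a b) z *\<^sub>R v z)) \<in> borel_measurable lebesgue"
      by (rule borel_measurable_times[OF borel_measurable_indicator borel_measurable_integrable[OF iK]]) simp
  qed
  moreover have "(\<integral>z. s k z \<partial>lebesgue) = 0" for k
  proof -
    have "s k z = indicator U z *\<^sub>R (v z * box_bump a b k z)" for z
      using box box_bump_eq_0[of z a b k] box_subset_cbox[of a b]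
      by (cases "z \<in> box a b") (auto simp: s_def indicator_def)
    then have "(\<integral>z. s k z \<partial>lebesgue) = (\<integral>z. indicator U z *\<^sub>R (v z * box_bump a b k z) \<partial>lebesgue)"
      by (simp only:)
    also have "\<dots> = (LINT z|lebesgue_on U. v z * box_bump a b k z)"
      using Us by (intro integral_restrict_space[symmetric]) simp
    finally have "(\<integral>z. s k z \<partial>lebesgue) = (LINT z|lebesgue_on U. v z * box_bump a b k z)" .
    then show ?thesis using test[OF box_bump_test_function[OF box]] by simp
  qed
  ultimately have "(\<integral>z. indicator (box a b) z * (indicator (cbox a b) z *\<^sub>R v z) \<partial>lebesgue) = 0"
    by (simp add: LIMSEQ_const_iff)
  moreover have "indicator (box a b) z * (indicator (cbox a b) z *\<^sub>R v z) = indicator (box a b) z * v z" for z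
    using box_subset_cbox[of a b] by (auto simp: indicator_def)
  ultimately show ?thesis by (simp only:)
qed

text \<open>Boxes form an intersection-stable generator of the Borel sets, so vanishing integrals
  extend to all Borel sets, with \<open>total\<close> handling complements. A density with this
  property is 0 almost everywhere.\<close>

lemma AE_eq_0_if_box_integrals_eq_0:
  fixes f :: "'a::euclidean_space \<Rightarrow> real"
  assumes f: "integrable lebesgue f" and total: "(\<integral>z. f z \<partial>lebesgue) = 0"
    and box: "\<And>a b. (\<integral>z. indicator (box a b) z * f z \<partial>lebesgue) = 0"
  shows "AE z in lebesgue. f z = 0"
proof -
  \<comment> \<open>Since \<open>f\<close> is Lebesgue measurable only, the argument over Borel sets
    is run for a Borel representative.\<close>
  obtain f' where f'[measurable]: "f' \<in> borel_measurable lborel" and ff': "AE z in lborel. f z = f' z"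
    using completion_ex_borel_measurable_real[OF borel_measurable_integrable[OF f]] by blast
  note [measurable] = borel_measurable_integrable[OF f]
  have m': "f' \<in> borel_measurable lebesgue" using f' by (rule measurable_completion)
  have ff'L: "AE z in lebesgue. f z = f' z" using ff' by (rule AE_completion)
  have "integrable lebesgue f'"
    using integrable_cong_AE[OF borel_measurable_integrable[OF f] m' ff'L] f by simp
  then have if': "integrable lborel f'" by (simp add: integrable_completion)
  have conv: "(\<integral>z. indicator A z * f' z \<partial>lborel) = (\<integral>z. indicator A z * f z \<partial>lebesgue)"
    if [measurable]: "A \<in> sets borel" for A
  proof -
    have "(\<integral>z. indicator A z * f' z \<partial>lborel) = (\<integral>z. indicator A z * f' z \<partial>lebesgue)"
      by (rule integral_completion[symmetric]) measurable
    also have "\<dots> = (\<integral>z. indicator A z * f z \<partial>lebesgue)"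
    proof (rule integral_cong_AE)
      show "AE z in lebesgue. indicator A z * f' z = indicator A z * f z"
        using ff'L by eventually_elim simp
      have "A \<in> sets lebesgue" using that by simp
      then show "(\<lambda>z. indicator A z * f' z) \<in> borel_measurable lebesgue"
        "(\<lambda>z. indicator A z * f z) \<in> borel_measurable lebesgue"
        by (rule borel_measurable_times[OF borel_measurable_indicator m']
            borel_measurable_times[OF borel_measurable_indicator borel_measurable_integrable[OF f]])+
    qed
    finally show ?thesis .
  qed
  have S: "(LINT z:A|lborel. f' z) = 0" if A: "A \<in> sets borel" for A
  proof -
    have "Int_stable (range (\<lambda>(a, b). box a b :: 'a set))"
      by (auto simp: Int_stable_def box_Int_box)
    moreover have "range (\<lambda>(a, b). box a b) \<subseteq> Pow (UNIV :: 'a set)" by auto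
    moreover have "A \<in> sigma_sets UNIV (range (\<lambda>(a, b). box a b))"
      using A unfolding borel_eq_box by simp
    ultimately show ?thesis
    proof (induction rule: sigma_sets_induct_disjoint)
      case (basic A)
      then obtain a b where "A = box a b" by auto
      then show ?case using conv[of "box a b"] box[of a b] by (simp add: set_lebesgue_integral_def)
    next
      case empty
      then show ?case by (simp add: set_lebesgue_integral_def)
    next
      case (compl A)
      then have [measurable]: "A \<in> sets borel" by (simp add: borel_eq_box)
      have "(\<integral>z. f' z \<partial>lborel) = 0" using conv[of UNIV] total by simp
      moreover have "integrable lborel (\<lambda>z. indicator A z *\<^sub>R f' z)"
        by (rule integrable_mult_indicator[OF _ if']) measurable
      moreover have "indicator (UNIV - A) z *\<^sub>R f' z = f' z - indicator A z *\<^sub>R f' z" for z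
        by (auto simp: indicator_def)
      ultimately show ?case
        using compl.IH if' by (simp add: set_lebesgue_integral_def)
    next
      case (union F)
      then have [measurable]: "F i \<in> sets borel" for i by (auto simp: borel_eq_box subset_eq)
      have "(LINT z:(\<Union>i. F i)|lborel. f' z) = (\<Sum>i. (LINT z:(F i)|lborel. f' z))"
      proof (rule lebesgue_integral_countable_add)
        show "set_integrable lborel (\<Union>i. F i) f'"
          unfolding set_integrable_def by (rule integrable_mult_indicator[OF _ if']) measurable
      qed (use union(1) in \<open>auto simp: disjoint_family_on_def\<close>)
      then show ?case using union.IH by simp
    qed
  qed
  have "AE z in lborel. f' z = 0"
    using if' S by (intro density_unique_real) (auto simp: set_lebesgue_integral_def)
  with ff' have "AE z in lborel. f z = 0" by eventually_elim simp
  then show ?thesis by (rule AE_completion)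
qed

text \<open>On a closed box inside \<open>U\<close> the function is integrable, and cutting it off
  to the open box reduces to \<open>AE_eq_0_if_box_integrals_eq_0\<close>. Countably many closed
  boxes cover \<open>U\<close>.\<close>

lemma fundamental_lemma_calculus_of_variations:
  fixes v :: "'a::euclidean_space \<Rightarrow> real"
  assumes U: "open U" and v: "locally_integrable U v"
    and test: "\<And>\<phi>. \<phi> \<in> test_functions U \<Longrightarrow> (LINT z|lebesgue_on U. v z * \<phi> z) = 0"
  shows "AE z in lebesgue_on U. v z = 0"
proof -
  have local: "AE z in lebesgue. z \<in> cbox c d \<longrightarrow> v z = 0" if cd: "cbox c d \<subseteq> U" for c d
  proof -
    have "integrable (lebesgue_on (cbox c d)) v" using v cd by (auto simp: locally_integrable_def)
    then have "integrable lebesgue (\<lambda>z. indicator (cbox c d) z *\<^sub>R v z)"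
      by (simp add: integrable_restrict_space)
    then have "integrable lebesgue (\<lambda>z. indicator (box c d) z *\<^sub>R (indicator (cbox c d) z *\<^sub>R v z))"
      by (rule integrable_mult_indicator[rotated]) simp
    moreover have "indicator (box c d) z *\<^sub>R (indicator (cbox c d) z *\<^sub>R v z) = indicator (box c d) z * v z" for z
      using box_subset_cbox[of c d] by (auto simp: indicator_def)
    ultimately have int: "integrable lebesgue (\<lambda>z. indicator (box c d) z * v z)" by (simp only:)
    have "AE z in lebesgue. indicator (box c d) z * v z = 0"
    proof (rule AE_eq_0_if_box_integrals_eq_0[OF int])
      show "(\<integral>z. indicator (box c d) z * v z \<partial>lebesgue) = 0"
        by (rule integral_box_eq_0[OF U v test cd])
      fix a b
      \<comment> \<open>\<open>a'\<close> and \<open>b'\<close> are the corners of the intersection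
        of the two boxes. It is again a box inside \<open>U\<close>, so its bumps are admissible
        even if \<open>box a b\<close> leaves \<open>U\<close>.\<close>
      define a' where "a' = (\<Sum>i\<in>Basis. max (a \<bullet> i) (c \<bullet> i) *\<^sub>R i)"
      define b' where "b' = (\<Sum>i\<in>Basis. min (b \<bullet> i) (d \<bullet> i) *\<^sub>R i)"
      have ab: "box a b \<inter> box c d = box a' b'" "cbox a b \<inter> cbox c d = cbox a' b'"
        by (simp_all only: a'_def b'_def box_Int_box Int_interval)
      have "(\<integral>z. indicator (box a' b') z * v z \<partial>lebesgue) = 0"
        using ab(2) cd by (intro integral_box_eq_0[OF U v test]) auto
      then show "(\<integral>z. indicator (box a b) z * (indicator (box c d) z * v z) \<partial>lebesgue) = 0"
        by (simp add: indicator_inter_arith mult.assoc flip: ab(1))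
    qed
    \<comment> \<open>The cover used below consists of closed boxes, so the null boundary is added
      back.\<close>
    moreover have "AE z in lebesgue. z \<notin> cbox c d - box c d"
      using negligible_frontier_interval[of c d] by (intro AE_not_in) (simp add: negligible_iff_null_sets)
    ultimately show ?thesis by eventually_elim (auto simp: indicator_def)
  qed
  obtain \<D> where D: "countable \<D>" "\<D> \<subseteq> Pow U" "\<And>X. X \<in> \<D> \<Longrightarrow> \<exists>a b. X = cbox a b" "\<Union>\<D> = U"
    using open_countable_Union_open_cbox[OF U] by metis
  have "AE z in lebesgue. \<forall>X\<in>\<D>. z \<in> X \<longrightarrow> v z = 0"
  proof (rule AE_ball_countable'[OF _ D(1)])
    fix X assume X: "X \<in> \<D>"
    then obtain a b where "X = cbox a b" using D(3) by blast
    then show "AE z in lebesgue. z \<in> X \<longrightarrow> v z = 0" using local X D(2) by auto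
  qed
  then have "AE z in lebesgue. z \<in> U \<longrightarrow> v z = 0"
    by (rule eventually_mono) (use D(4) in auto)
  then show ?thesis
    using U by (subst AE_restrict_space_iff) (auto simp: borel_open)
qed

section \<open>Weak derivatives\<close>

lemma locally_integrable_linear:
  assumes "locally_integrable U u" "locally_integrable U v"
  shows "locally_integrable U (\<lambda>z. u z + c * v z)"
  using assms by (auto simp: locally_integrable_def)

text \<open>Local integrability yields measurability on compact subsets only; a countable cover by
  closed boxes glues the pieces. This makes the arbitrarily chosen \<open>weak_deriv\<close>
  measurable.\<close>

lemma locally_integrable_measurable:
  assumes v: "locally_integrable U v" and U: "open U"
  shows "v \<in> borel_measurable (lebesgue_on U)"
proof -
  obtain \<D> where D: "countable \<D>" "\<D> \<subseteq> Pow U" "\<And>X. X \<in> \<D> \<Longrightarrow> \<exists>a b. X = cbox a b" "\<Union>\<D> = U"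
    using open_countable_Union_open_cbox[OF U] by metis
  have Us: "U \<in> sets lebesgue" using U by (simp add: borel_open)
  show ?thesis
  proof (rule measurable_piecewise_restrict[OF D(1)])
    show "space (lebesgue_on U) \<subseteq> \<Union>\<D>" using D(4) by simp
    fix X assume X: "X \<in> \<D>"
    then have XU: "X \<subseteq> U" and cX: "compact X" using D(2,3) by fastforce+
    then have "X \<in> sets lebesgue" by (simp add: compact_imp_closed borel_closed)
    then show "X \<inter> space (lebesgue_on U) \<in> sets (lebesgue_on U)"
      using Us XU by (auto simp: sets_restrict_space)
    have "v \<in> borel_measurable (lebesgue_on X)"
      using v XU cX by (auto simp: locally_integrable_def)
    moreover have "restrict_space (lebesgue_on U) X = lebesgue_on X"
      using Us \<open>X \<in> sets lebesgue\<close> XU by (simp add: restrict_restrict_space inf.absorb2)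
    ultimately show "v \<in> borel_measurable (restrict_space (lebesgue_on U) X)" by simp
  qed
qed

lemma test_function_vanishes_off_support:
  assumes "\<phi> \<in> test_functions U"
  obtains K where "compact K" "K \<subseteq> U" "\<And>z. z \<notin> K \<Longrightarrow> \<phi> z = 0" "\<And>V z. z \<notin> K \<Longrightarrow> lie_deriv V \<phi> z = 0"
proof (rule that)
  show "compact (closure {z. \<phi> z \<noteq> 0})" "closure {z. \<phi> z \<noteq> 0} \<subseteq> U"
    using assms by (auto simp: test_functions_def)
qed (use closure_subset[of "{z. \<phi> z \<noteq> 0}"] lie_deriv_eq_0_off_support[of _ \<phi>] in auto)

lemma test_function_continuous_lie_deriv:
  fixes \<phi> :: "'a::euclidean_space \<Rightarrow> real"
  assumes "\<phi> \<in> test_functions U" "shear_field V"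
  shows "continuous_on UNIV (lie_deriv V \<phi>)"
  using assms by (intro continuous_lie_deriv test_function_Ck) (auto simp: shear_field_def)

lemma integrable_times_test_function:
  fixes u :: "'a::euclidean_space \<Rightarrow> real"
  assumes "locally_integrable U u" "U \<in> sets lebesgue" "\<phi> \<in> test_functions U"
  shows "integrable (lebesgue_on U) (\<lambda>z. u z * \<phi> z)"
proof -
  obtain K where "compact K" "K \<subseteq> U" "\<And>z. z \<notin> K \<Longrightarrow> \<phi> z = 0"
    using test_function_vanishes_off_support[OF assms(3)] by metis
  then show ?thesis
    using assms test_function_continuous by (intro locally_integrable_times_integrable) auto
qed

lemma integrable_times_lie_deriv:
  fixes u :: "'a::euclidean_space \<Rightarrow> real"
  assumes "locally_integrable U u" "U \<in> sets lebesgue" "\<phi> \<in> test_functions U" "shear_field V"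
  shows "integrable (lebesgue_on U) (\<lambda>z. u z * lie_deriv V \<phi> z)"
proof -
  obtain K where "compact K" "K \<subseteq> U" "\<And>z. z \<notin> K \<Longrightarrow> lie_deriv V \<phi> z = 0"
    using test_function_vanishes_off_support[OF assms(3)] by metis
  then show ?thesis
    using assms test_function_continuous_lie_deriv by (intro locally_integrable_times_integrable) auto
qed

lemma has_weak_deriv_unique:
  fixes u :: "'a::euclidean_space \<Rightarrow> real"
  assumes U: "open U" and v: "has_weak_deriv U V u v" and v': "has_weak_deriv U V u v'"
  shows "AE z in lebesgue_on U. v z = v' z"
proof -
  have Us: "U \<in> sets lebesgue" using U by (simp add: borel_open)
  have loc: "locally_integrable U v" "locally_integrable U v'"
    using v v' by (auto simp: has_weak_deriv_def)
  have "AE z in lebesgue_on U. v z + (-1) * v' z = 0"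
  proof (rule fundamental_lemma_calculus_of_variations[OF U locally_integrable_linear[OF loc]])
    fix \<phi> assume \<phi>: "\<phi> \<in> test_functions U"
    have "(LINT z|lebesgue_on U. v z * \<phi> z) = (LINT z|lebesgue_on U. v' z * \<phi> z)"
      using v v' \<phi> by (simp add: has_weak_deriv_def)
    moreover have "(LINT z|lebesgue_on U. v z * \<phi> z - v' z * \<phi> z)
        = (LINT z|lebesgue_on U. v z * \<phi> z) - (LINT z|lebesgue_on U. v' z * \<phi> z)"
      by (intro Bochner_Integration.integral_diff integrable_times_test_function[OF _ Us \<phi>] loc)
    ultimately show "(LINT z|lebesgue_on U. (v z + (-1) * v' z) * \<phi> z) = 0"
      by (simp add: algebra_simps)
  qed
  then show ?thesis by eventually_elim simp
qed

lemma has_weak_deriv_weak_deriv: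
  "has_weak_deriv U V u v \<Longrightarrow> has_weak_deriv U V u (weak_deriv U V u)"
  unfolding weak_deriv_def by (rule someI[of "has_weak_deriv U V u"])

lemma weak_deriv_AE_eq:
  fixes u :: "'a::euclidean_space \<Rightarrow> real"
  assumes "open U" "has_weak_deriv U V u v"
  shows "AE z in lebesgue_on U. weak_deriv U V u z = v z"
  using has_weak_deriv_unique[OF assms(1) has_weak_deriv_weak_deriv[OF assms(2)] assms(2)] .

lemma has_weak_deriv_linear:
  fixes u :: "'a::euclidean_space \<Rightarrow> real"
  assumes U: "open U" and V: "shear_field V" and loc: "locally_integrable U u" "locally_integrable U u'"
    and v: "has_weak_deriv U V u v" and v': "has_weak_deriv U V u' v'"
  shows "has_weak_deriv U V (\<lambda>z. u z + c * u' z) (\<lambda>z. v z + c * v' z)"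
  unfolding has_weak_deriv_def
proof (intro conjI ballI)
  have Us: "U \<in> sets lebesgue" using U by (simp add: borel_open)
  have lv: "locally_integrable U v" "locally_integrable U v'"
    using v v' by (auto simp: has_weak_deriv_def)
  then show "locally_integrable U (\<lambda>z. v z + c * v' z)" by (rule locally_integrable_linear)
  fix \<phi> assume \<phi>: "\<phi> \<in> test_functions U"
  have "(LINT z|lebesgue_on U. (u z + c * u' z) * lie_deriv V \<phi> z)
      = (LINT z|lebesgue_on U. u z * lie_deriv V \<phi> z) + c * (LINT z|lebesgue_on U. u' z * lie_deriv V \<phi> z)"
    using integrable_times_lie_deriv[OF loc(1) Us \<phi> V] integrable_times_lie_deriv[OF loc(2) Us \<phi> V]
    by (simp add: distrib_right mult.assoc)
  also have "\<dots> = - ((LINT z|lebesgue_on U. v z * \<phi> z) + c * (LINT z|lebesgue_on U. v' z * \<phi> z))"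
    using v v' \<phi> by (simp add: has_weak_deriv_def)
  also have "(LINT z|lebesgue_on U. v z * \<phi> z) + c * (LINT z|lebesgue_on U. v' z * \<phi> z)
      = (LINT z|lebesgue_on U. (v z + c * v' z) * \<phi> z)"
    using integrable_times_test_function[OF lv(1) Us \<phi>] integrable_times_test_function[OF lv(2) Us \<phi>]
    by (simp add: distrib_right mult.assoc)
  finally show "(LINT z|lebesgue_on U. (u z + c * u' z) * lie_deriv V \<phi> z)
      = - (LINT z|lebesgue_on U. (v z + c * v' z) * \<phi> z)" .
qed

lemma locally_integrable_mono: "locally_integrable W u \<Longrightarrow> U \<subseteq> W \<Longrightarrow> locally_integrable U u"
  by (auto simp: locally_integrable_def)

lemma integral_on_subset:
  fixes f :: "'a::euclidean_space \<Rightarrow> real"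
  assumes "B \<subseteq> U" "B \<in> sets lebesgue" "U \<in> sets lebesgue" "\<And>z. z \<in> U \<Longrightarrow> z \<notin> B \<Longrightarrow> f z = 0"
  shows "(LINT z|lebesgue_on U. f z) = (LINT z|lebesgue_on B. f z)"
proof -
  have "(LINT z|lebesgue_on U. f z) = (LINT z|lebesgue_on U. (if z \<in> B then f z else 0))"
    using assms(4) by (intro Bochner_Integration.integral_cong) auto
  then show ?thesis using integral_restrict[OF assms(1-3), of f] by simp
qed

lemma has_weak_deriv_restrict:
  fixes u :: "'a::euclidean_space \<Rightarrow> real"
  assumes B: "open B" and U: "open U" and BU: "B \<subseteq> U" and v: "has_weak_deriv U V u v"
  shows "has_weak_deriv B V u v"
  unfolding has_weak_deriv_def
proof (intro conjI ballI)
  show "locally_integrable B v"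
    using v BU by (auto simp: has_weak_deriv_def intro: locally_integrable_mono)
  fix \<phi> assume \<phi>: "\<phi> \<in> test_functions B"
  then have \<phi>': "\<phi> \<in> test_functions U" using test_functions_mono[OF BU] by blast
  obtain K where "K \<subseteq> B" "\<And>z. z \<notin> K \<Longrightarrow> \<phi> z = 0" "\<And>z. z \<notin> K \<Longrightarrow> lie_deriv V \<phi> z = 0"
    using test_function_vanishes_off_support[OF \<phi>] by metis
  then have off: "\<phi> z = 0" "lie_deriv V \<phi> z = 0" if "z \<notin> B" for z using that by auto
  have "(LINT z|lebesgue_on U. u z * lie_deriv V \<phi> z) = (LINT z|lebesgue_on B. u z * lie_deriv V \<phi> z)"
    "(LINT z|lebesgue_on U. v z * \<phi> z) = (LINT z|lebesgue_on B. v z * \<phi> z)"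
    using B U BU off by (auto intro!: integral_on_subset simp: borel_open)
  then show "(LINT z|lebesgue_on B. u z * lie_deriv V \<phi> z) = - (LINT z|lebesgue_on B. v z * \<phi> z)"
    using v \<phi>' by (simp add: has_weak_deriv_def)
qed

section \<open>Lebesgue spaces\<close>

lemma Lp_space_linear:
  fixes u v :: "'a::euclidean_space \<Rightarrow> real"
  assumes p: "0 \<le> p" and u: "u \<in> Lp_space p U" and v: "v \<in> Lp_space p U"
  shows "(\<lambda>z. u z + c * v z) \<in> Lp_space p U"
proof -
  have [measurable]: "u \<in> borel_measurable (lebesgue_on U)" "v \<in> borel_measurable (lebesgue_on U)"
    using u v by (auto simp: Lp_space_def)
  have "integrable (lebesgue_on U) (\<lambda>z. \<bar>u z + c * v z\<bar> powr p)"
  proof (rule Bochner_Integration.integrable_bound)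
    show "integrable (lebesgue_on U) (\<lambda>z. 2 powr p * (\<bar>u z\<bar> powr p + \<bar>c\<bar> powr p * \<bar>v z\<bar> powr p))"
      using u v by (auto simp: Lp_space_def)
    show "AE z in lebesgue_on U. norm (\<bar>u z + c * v z\<bar> powr p)
        \<le> norm (2 powr p * (\<bar>u z\<bar> powr p + \<bar>c\<bar> powr p * \<bar>v z\<bar> powr p))"
      using norm_diff_powr_le[OF p, of "u z" "- c * v z" for z]
      by (intro AE_I2) (simp add: abs_mult powr_mult abs_of_nonneg add_nonneg_nonneg)
  qed measurable
  then show ?thesis by (simp add: Lp_space_def)
qed

lemma Lp_space_abs: "u \<in> Lp_space p U \<Longrightarrow> (\<lambda>z. \<bar>u z\<bar>) \<in> Lp_space p U"
  by (auto simp: Lp_space_def)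

lemma Lp_space_zero: "(\<lambda>z. 0) \<in> Lp_space p U"
  by (auto simp: Lp_space_def)

lemma Lp_space_sum_abs:
  assumes "0 \<le> p" "finite A" "\<And>i. i \<in> A \<Longrightarrow> u i \<in> Lp_space p U"
  shows "(\<lambda>z. \<Sum>i\<in>A. \<bar>u i z\<bar>) \<in> Lp_space p U"
  using assms(2,3)
proof (induction A rule: finite_induct)
  case (insert i A)
  then show ?case
    using Lp_space_linear[OF assms(1) Lp_space_abs, of "u i" U "\<lambda>z. \<Sum>i\<in>A. \<bar>u i z\<bar>" 1] by simp
qed (simp add: Lp_space_zero)

lemma Lp_space_cong_AE:
  assumes "u \<in> Lp_space p U" "AE z in lebesgue_on U. v z = u z" "v \<in> borel_measurable (lebesgue_on U)"
  shows "v \<in> Lp_space p U"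
proof -
  have "integrable (lebesgue_on U) (\<lambda>z. \<bar>v z\<bar> powr p)"
  proof (rule integrable_cong_AE_imp)
    show "integrable (lebesgue_on U) (\<lambda>z. \<bar>u z\<bar> powr p)"
      using assms(1) by (auto simp: Lp_space_def)
    show "(\<lambda>z. \<bar>v z\<bar> powr p) \<in> borel_measurable (lebesgue_on U)" using assms(3) by measurable
    show "AE z in lebesgue_on U. \<bar>u z\<bar> powr p = \<bar>v z\<bar> powr p"
      using assms(2) by eventually_elim simp
  qed
  then show ?thesis using assms(3) by (simp add: Lp_space_def)
qed

lemma Lp_space_restrict:
  assumes u: "u \<in> Lp_space p U" and "B \<subseteq> U" "B \<in> sets lebesgue" "U \<in> sets lebesgue"
  shows "u \<in> Lp_space p B"
proof -
  have "u \<in> borel_measurable (lebesgue_on B)"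
    using measurable_restrict_mono[OF _ assms(2)] u by (auto simp: Lp_space_def)
  moreover have "integrable (lebesgue_on B) (\<lambda>z. \<bar>u z\<bar> powr p)"
  proof -
    have "integrable lebesgue (\<lambda>z. indicator U z *\<^sub>R \<bar>u z\<bar> powr p)"
      using u assms(4) by (simp add: Lp_space_def integrable_restrict_space)
    then have "integrable lebesgue (\<lambda>z. indicator B z *\<^sub>R (indicator U z *\<^sub>R \<bar>u z\<bar> powr p))"
      by (rule integrable_mult_indicator[OF assms(3)])
    moreover have "indicator B z *\<^sub>R (indicator U z *\<^sub>R \<bar>u z\<bar> powr p) = indicator B z *\<^sub>R \<bar>u z\<bar> powr p" for z
      using assms(2) by (auto simp: indicator_def)
    ultimately have "integrable lebesgue (\<lambda>z. indicator B z *\<^sub>R \<bar>u z\<bar> powr p)" by (simp only:)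
    then show ?thesis using assms(3) by (simp add: integrable_restrict_space)
  qed
  ultimately show ?thesis by (simp add: Lp_space_def)
qed

lemma Lp_space_extend:
  assumes u: "u \<in> Lp_space p B" and "B \<subseteq> U" "B \<in> sets lebesgue" "U \<in> sets lebesgue"
  shows "(\<lambda>z. if z \<in> B then u z else 0) \<in> Lp_space p U"
proof -
  have "(\<lambda>z. if z \<in> B then u z else 0) \<in> borel_measurable (lebesgue_on U)"
    using u assms(2-4) by (subst borel_measurable_if_lebesgue_on) (auto simp: Lp_space_def)
  moreover have "integrable (lebesgue_on U) (\<lambda>z. \<bar>if z \<in> B then u z else 0\<bar> powr p)"
  proof -
    have "integrable lebesgue (\<lambda>z. indicator B z *\<^sub>R \<bar>u z\<bar> powr p)"
      using u assms(3) by (simp add: Lp_space_def integrable_restrict_space)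
    moreover have "indicator B z *\<^sub>R \<bar>u z\<bar> powr p = indicator U z *\<^sub>R \<bar>if z \<in> B then u z else 0\<bar> powr p" for z
      using assms(2) by (auto simp: indicator_def)
    ultimately have "integrable lebesgue (\<lambda>z. indicator U z *\<^sub>R \<bar>if z \<in> B then u z else 0\<bar> powr p)"
      by (simp only:)
    then show ?thesis using assms(4) by (simp add: integrable_restrict_space)
  qed
  ultimately show ?thesis by (simp add: Lp_space_def)
qed

lemma Lp_space_locally_integrable:
  assumes p: "1 \<le> p" and u: "u \<in> Lp_space p U" and U: "U \<in> sets lebesgue"
  shows "locally_integrable U u"
  unfolding locally_integrable_def
proof (intro allI impI)
  fix K assume "compact K \<and> K \<subseteq> U"
  then have K: "compact K" "K \<subseteq> U" by auto
  then have Ks: "K \<in> sets lebesgue" by (simp add: compact_imp_closed borel_closed)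
  have uK: "u \<in> Lp_space p K" by (rule Lp_space_restrict[OF u K(2) Ks U])
  interpret finite_measure "lebesgue_on K"
    using K by (intro finite_measure_lebesgue_on lmeasurable_compact)
  show "integrable (lebesgue_on K) u"
  proof (rule Bochner_Integration.integrable_bound)
    show "integrable (lebesgue_on K) (\<lambda>z. 1 + \<bar>u z\<bar> powr p)" using uK by (auto simp: Lp_space_def)
    have "\<bar>x\<bar> \<le> 1 + \<bar>x\<bar> powr p" for x :: real
    proof (cases "\<bar>x\<bar> \<le> 1")
      case False
      then show ?thesis using powr_mono[OF p, of "\<bar>x\<bar>"] by simp
    qed (use powr_ge_zero[of "\<bar>x\<bar>" p] in linarith)
    then show "AE z in lebesgue_on K. norm (u z) \<le> norm (1 + \<bar>u z\<bar> powr p)"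
      by (auto simp: abs_of_nonneg add_nonneg_nonneg)
  qed (use uK in \<open>auto simp: Lp_space_def\<close>)
qed

lemma continuous_compact_support_Lp_space:
  fixes f :: "'a::euclidean_space \<Rightarrow> real"
  assumes "0 < p" "continuous_on UNIV f" "compact K" "K \<subseteq> U" "\<And>z. z \<notin> K \<Longrightarrow> f z = 0" "U \<in> sets lebesgue"
  shows "f \<in> Lp_space p U"
proof -
  have "integrable (lebesgue_on U) (\<lambda>z. \<bar>f z\<bar> powr p)"
    using assms by (intro continuous_compact_support_integrable_on[OF _ assms(4) _ assms(3)])
      (auto intro!: continuous_intros continuous_on_powr')
  moreover have "f \<in> borel_measurable (lebesgue_on U)"
    using assms(2) by (intro measurable_restrict_space1 measurable_completion)
      (simp add: borel_measurable_continuous_onI)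
  ultimately show ?thesis by (simp add: Lp_space_def)
qed

lemma test_function_Lp_space:
  fixes \<phi> :: "'a::euclidean_space \<Rightarrow> real"
  assumes "0 < p" "\<phi> \<in> test_functions U" "U \<in> sets lebesgue"
  shows "\<phi> \<in> Lp_space p U" and "shear_field V \<Longrightarrow> lie_deriv V \<phi> \<in> Lp_space p U"
proof -
  obtain K where K: "compact K" "K \<subseteq> U" "\<And>z. z \<notin> K \<Longrightarrow> \<phi> z = 0" "\<And>V z. z \<notin> K \<Longrightarrow> lie_deriv V \<phi> z = 0"
    using test_function_vanishes_off_support[OF assms(2)] by metis
  show "\<phi> \<in> Lp_space p U"
    by (rule continuous_compact_support_Lp_space[OF assms(1) test_function_continuous[OF assms(2)] K(1-3) assms(3)])
  assume "shear_field V"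
  then show "lie_deriv V \<phi> \<in> Lp_space p U"
    by (intro continuous_compact_support_Lp_space[OF assms(1) _ K(1,2,4) assms(3)]
        test_function_continuous_lie_deriv[OF assms(2)])
qed

text \<open>Hoelder for \<open>\<bar>f z\<bar> powr p\<close> and the indicator of
  \<open>K \<inter> U\<close> with weights \<open>1 / p\<close> and \<open>1 - 1 / p\<close>.
  \<open>K\<close> may stick out of \<open>U\<close>: in the extension by zero, \<open>U\<close> is
  the smaller set and \<open>K\<close> supports a test function of the larger one.\<close>

lemma Lp_times_compact_support:
  fixes f g :: "'a::euclidean_space \<Rightarrow> real"
  assumes p: "1 < p" and f: "f \<in> Lp_space p U" and U: "U \<in> sets lebesgue" and K: "compact K"
    and g: "continuous_on UNIV g" "\<And>z. \<bar>g z\<bar> \<le> C" "\<And>z. z \<notin> K \<Longrightarrow> g z = 0"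
  shows "integrable (lebesgue_on U) (\<lambda>z. f z * g z)"
    and "\<bar>LINT z|lebesgue_on U. f z * g z\<bar> \<le> C * ((LINT z|lebesgue_on U. \<bar>f z\<bar> powr p) powr (1 / p) * measure lebesgue (K \<inter> U) powr (1 - 1 / p))"
proof -
  have Ks: "K \<in> sets lebesgue" using K by (simp add: compact_imp_closed borel_closed)
  have C: "0 \<le> C" using g(2) abs_ge_zero order_trans by blast
  let ?M = "lebesgue_on U"
  have i1: "integrable ?M (\<lambda>z. \<bar>f z\<bar> powr p)" using f by (auto simp: Lp_space_def)
  have fin: "emeasure lebesgue (K \<inter> U) < \<infinity>"
    using emeasure_mono[of "K \<inter> U" K lebesgue] lmeasurable_compact[OF K]
    by (auto simp: fmeasurable_def intro: le_less_trans)
  have iG: "integrable ?M (indicator (K \<inter> U) :: 'a \<Rightarrow> real)"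
    using fin U Ks by (intro integrable_real_indicator)
      (auto simp: sets_restrict_space emeasure_restrict_space Int_commute)
  have mG: "(LINT z|?M. indicator (K \<inter> U) z) = measure lebesgue (K \<inter> U)"
    using U Ks by (simp add: measure_restrict_space sets_restrict_space Int_absorb1)
  have r: "(\<bar>f z\<bar> powr p) powr (1 / p) * indicator (K \<inter> U) z powr (1 - 1 / p) = \<bar>f z\<bar> * indicator (K \<inter> U) z" for z
    using p by (auto simp: powr_powr indicator_def)
  have "0 \<le> 1 / p" "1 / p \<le> 1" using p by auto
  note H = Holder_powr[OF i1 _ iG _ this, unfolded r mG]
  have iC: "integrable ?M (\<lambda>z. C * (\<bar>f z\<bar> * indicator (K \<inter> U) z))" using H(1) by simp
  have le: "\<bar>f z * g z\<bar> \<le> C * (\<bar>f z\<bar> * indicator (K \<inter> U) z)" if "z \<in> space ?M" for z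
    using that g(2)[of z] g(3)[of z] mult_left_mono[of "\<bar>g z\<bar>" C "\<bar>f z\<bar>"]
    by (cases "z \<in> K") (auto simp: abs_mult mult.commute)
  show "integrable (lebesgue_on U) (\<lambda>z. f z * g z)"
  proof (rule Bochner_Integration.integrable_bound[OF iC])
    have "g \<in> borel_measurable ?M"
      using g(1) by (intro measurable_restrict_space1 measurable_completion)
        (simp add: borel_measurable_continuous_onI)
    then show "(\<lambda>z. f z * g z) \<in> borel_measurable ?M"
      using f by (intro borel_measurable_times) (auto simp: Lp_space_def)
    show "AE z in ?M. norm (f z * g z) \<le> norm (C * (\<bar>f z\<bar> * indicator (K \<inter> U) z))"
    proof (rule AE_I2)
      fix z assume "z \<in> space ?M"
      from le[OF this] show "norm (f z * g z) \<le> norm (C * (\<bar>f z\<bar> * indicator (K \<inter> U) z))"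
        unfolding real_norm_def by linarith
    qed
  qed
  have "\<bar>LINT z|?M. f z * g z\<bar> \<le> (LINT z|?M. C * (\<bar>f z\<bar> * indicator (K \<inter> U) z))"
    by (rule order_trans[OF integral_abs_bound integral_mono'[OF iC le]]) (use C in auto)
  also have "\<dots> = C * (LINT z|?M. \<bar>f z\<bar> * indicator (K \<inter> U) z)" by simp
  also have "\<dots> \<le> C * ((LINT z|?M. \<bar>f z\<bar> powr p) powr (1 / p) * measure lebesgue (K \<inter> U) powr (1 - 1 / p))"
    using H(2) C by (intro mult_left_mono) auto
  finally show "\<bar>LINT z|?M. f z * g z\<bar>
    \<le> C * ((LINT z|?M. \<bar>f z\<bar> powr p) powr (1 / p) * measure lebesgue (K \<inter> U) powr (1 - 1 / p))" .
qed

section \<open>Horizontal Sobolev spaces\<close>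

text \<open>Treating both families as one finite set lets every statement about weak derivatives be
  made once.\<close>

definition hfields :: "('n::finite heis \<Rightarrow> 'n heis) set" where
  "hfields = range heis_X \<union> range heis_Y"

lemma finite_hfields: "finite hfields"
  by (simp add: hfields_def)

text \<open>The only nonconstant coefficient belongs to the t direction and depends on x or y
  alone.\<close>

lemma shear_field_hfields:
  assumes "V \<in> (hfields :: ('n::finite heis \<Rightarrow> 'n heis) set)"
  shows "shear_field V"
proof -
  have X: "heis_X j = (\<lambda>z::'n heis. (axis j 1, 0, 2 * fst (snd z) $ j))" for j :: 'n
    by (auto simp: heis_X_def)
  have Y: "heis_Y j = (\<lambda>z::'n heis. (0, axis j 1, - 2 * fst z $ j))" for j :: 'n
    by (auto simp: heis_Y_def)
  have "shear_field (heis_X j)" "shear_field (heis_Y j)" for j :: 'n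
    unfolding shear_field_def X Y
    by (auto intro!: continuous_intros simp: Basis_prod_def)
  then show ?thesis using assms by (auto simp: hfields_def)
qed

lemma HW_iff:
  "u \<in> HW p U \<longleftrightarrow> u \<in> Lp_space p U \<and> (\<forall>V\<in>hfields. \<exists>v\<in>Lp_space p U. has_weak_deriv U V u v)"
  by (auto simp: HW_def hfields_def)

text \<open>Membership in \<open>HW\<close> provides some weak derivative in the Lebesgue space,
  while \<open>weak_deriv\<close> may choose another one; uniqueness almost everywhere transfers
  integrability.\<close>

lemma HW_weak_deriv:
  assumes U: "open U" and u: "u \<in> HW p U" and V: "V \<in> hfields"
  shows "has_weak_deriv U V u (weak_deriv U V u)" and "weak_deriv U V u \<in> Lp_space p U"
proof -
  obtain v where v: "v \<in> Lp_space p U" "has_weak_deriv U V u v" using u V by (auto simp: HW_iff)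
  show w: "has_weak_deriv U V u (weak_deriv U V u)" by (rule has_weak_deriv_weak_deriv[OF v(2)])
  show "weak_deriv U V u \<in> Lp_space p U"
    using w by (intro Lp_space_cong_AE[OF v(1) weak_deriv_AE_eq[OF U v(2)]] locally_integrable_measurable[OF _ U])
      (auto simp: has_weak_deriv_def)
qed

lemma HW_locally_integrable: "open U \<Longrightarrow> 1 < p \<Longrightarrow> u \<in> HW p U \<Longrightarrow> locally_integrable U u"
  by (rule Lp_space_locally_integrable[of p]) (auto simp: HW_iff borel_open)

lemma HW_linear:
  assumes U: "open U" and p: "1 < p" and u: "u \<in> HW p U" and u': "u' \<in> HW p U"
  shows "(\<lambda>z. u z + c * u' z) \<in> HW p U"
    and "V \<in> hfields \<Longrightarrow> AE z in lebesgue_on U.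
      weak_deriv U V (\<lambda>z. u z + c * u' z) z = weak_deriv U V u z + c * weak_deriv U V u' z"
proof -
  have W: "has_weak_deriv U V (\<lambda>z. u z + c * u' z) (\<lambda>z. weak_deriv U V u z + c * weak_deriv U V u' z)"
    if "V \<in> hfields" for V
    by (rule has_weak_deriv_linear[OF U shear_field_hfields[OF that] HW_locally_integrable[OF U p u]
          HW_locally_integrable[OF U p u'] HW_weak_deriv(1)[OF U u that] HW_weak_deriv(1)[OF U u' that]])
  have L: "(\<lambda>z. weak_deriv U V u z + c * weak_deriv U V u' z) \<in> Lp_space p U" if "V \<in> hfields" for V
    using p HW_weak_deriv(2)[OF U u that] HW_weak_deriv(2)[OF U u' that] by (intro Lp_space_linear) auto
  have "(\<lambda>z. u z + c * u' z) \<in> Lp_space p U"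
    using p u u' by (intro Lp_space_linear) (auto simp: HW_iff)
  then show "(\<lambda>z. u z + c * u' z) \<in> HW p U"
    using W L unfolding HW_iff by blast
  show "V \<in> hfields \<Longrightarrow> AE z in lebesgue_on U.
      weak_deriv U V (\<lambda>z. u z + c * u' z) z = weak_deriv U V u z + c * weak_deriv U V u' z"
    by (rule weak_deriv_AE_eq[OF U W])
qed

lemma HW_restrict:
  assumes B: "open B" and U: "open U" and BU: "B \<subseteq> U" and u: "u \<in> HW p U"
  shows "u \<in> HW p B"
    and "V \<in> hfields \<Longrightarrow> AE z in lebesgue_on B. weak_deriv B V u z = weak_deriv U V u z"
proof -
  have W: "has_weak_deriv B V u (weak_deriv U V u)" if "V \<in> hfields" for V
    by (rule has_weak_deriv_restrict[OF B U BU HW_weak_deriv(1)[OF U u that]])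
  have L: "v \<in> Lp_space p U \<Longrightarrow> v \<in> Lp_space p B" for v
    using B U BU by (auto intro: Lp_space_restrict simp: borel_open)
  show "u \<in> HW p B"
    using W L HW_weak_deriv(2)[OF U u] u unfolding HW_iff by blast
  show "V \<in> hfields \<Longrightarrow> AE z in lebesgue_on B. weak_deriv B V u z = weak_deriv U V u z"
    by (rule weak_deriv_AE_eq[OF B W])
qed

lemma test_function_HW:
  assumes U: "open U" and p: "1 < p" and \<phi>: "\<phi> \<in> test_functions U"
  shows "\<phi> \<in> HW p U"
    and "V \<in> hfields \<Longrightarrow> AE z in lebesgue_on U. weak_deriv U V \<phi> z = lie_deriv V \<phi> z"
proof -
  have W: "has_weak_deriv U V \<phi> (lie_deriv V \<phi>)" if "V \<in> hfields" for V
    by (rule C1_has_weak_deriv[OF shear_field_hfields[OF that] U test_function_Ck[OF \<phi>]])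
  have "\<phi> \<in> Lp_space p U" "\<And>V. V \<in> hfields \<Longrightarrow> lie_deriv V \<phi> \<in> Lp_space p U"
    using p U test_function_Lp_space[OF _ \<phi>, of p] shear_field_hfields by (auto simp: borel_open)
  then show "\<phi> \<in> HW p U"
    using W unfolding HW_iff by blast
  show "V \<in> hfields \<Longrightarrow> AE z in lebesgue_on U. weak_deriv U V \<phi> z = lie_deriv V \<phi> z"
    by (rule weak_deriv_AE_eq[OF U W])
qed

lemma Lp_norm_cong_AE:
  assumes "f \<in> borel_measurable (lebesgue_on U)" "g \<in> borel_measurable (lebesgue_on U)"
    "AE z in lebesgue_on U. f z = g z"
  shows "Lp_norm p U f = Lp_norm p U g"
proof -
  have "(LINT z|lebesgue_on U. \<bar>f z\<bar> powr p) = (LINT z|lebesgue_on U. \<bar>g z\<bar> powr p)"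
  proof (rule integral_cong_AE)
    show "AE z in lebesgue_on U. \<bar>f z\<bar> powr p = \<bar>g z\<bar> powr p" using assms(3) by eventually_elim simp
  qed (use assms in measurable)
  then show ?thesis by (simp add: Lp_norm_def)
qed

lemma Lp_norm_nonneg: "0 \<le> Lp_norm p U f"
  by (simp add: Lp_norm_def)

lemma Lp_norm_powr: "0 < p \<Longrightarrow> (LINT z|lebesgue_on U. \<bar>f z\<bar> powr p) = Lp_norm p U f powr p"
  by (simp add: Lp_norm_def powr_powr)

text \<open>A crude substitute for Minkowski's inequality; it is used only for quantities that can
  be made arbitrarily small, so the constant is harmless.\<close>

lemma Lp_norm_linear_le:
  fixes f g :: "'a::euclidean_space \<Rightarrow> real"
  assumes p: "0 < p" and f: "f \<in> Lp_space p U" and g: "g \<in> Lp_space p U"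
    and df: "Lp_norm p U f \<le> d" and dg: "Lp_norm p U g \<le> d"
  shows "Lp_norm p U (\<lambda>z. f z + c * g z) \<le> (2 powr p * (1 + \<bar>c\<bar> powr p)) powr (1 / p) * d"
proof -
  have d: "0 \<le> d" using df Lp_norm_nonneg order_trans by blast
  have int: "integrable (lebesgue_on U) (\<lambda>z. 2 powr p * (\<bar>f z\<bar> powr p + \<bar>c\<bar> powr p * \<bar>g z\<bar> powr p))"
    using f g by (auto simp: Lp_space_def)
  have le: "\<bar>f z + c * g z\<bar> powr p \<le> 2 powr p * (\<bar>f z\<bar> powr p + \<bar>c\<bar> powr p * \<bar>g z\<bar> powr p)" for z
    using norm_diff_powr_le[of p "f z" "- c * g z"] p by (simp add: abs_mult powr_mult)
  have "(LINT z|lebesgue_on U. \<bar>f z + c * g z\<bar> powr p)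
      \<le> (LINT z|lebesgue_on U. 2 powr p * (\<bar>f z\<bar> powr p + \<bar>c\<bar> powr p * \<bar>g z\<bar> powr p))"
    by (rule integral_mono'[OF int le]) (simp add: add_nonneg_nonneg)
  also have "\<dots> = 2 powr p * (Lp_norm p U f powr p + \<bar>c\<bar> powr p * Lp_norm p U g powr p)"
    using f g p by (simp add: Lp_norm_powr Lp_space_def)
  also have "\<dots> \<le> 2 powr p * (d powr p + \<bar>c\<bar> powr p * d powr p)"
    using p df dg Lp_norm_nonneg by (intro mult_left_mono add_mono powr_mono2) auto
  also have "\<dots> = 2 powr p * (1 + \<bar>c\<bar> powr p) * d powr p" by (simp add: algebra_simps)
  finally have "Lp_norm p U (\<lambda>z. f z + c * g z) \<le> (2 powr p * (1 + \<bar>c\<bar> powr p) * d powr p) powr (1 / p)"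
    unfolding Lp_norm_def using p by (intro powr_mono2) auto
  also have "\<dots> = (2 powr p * (1 + \<bar>c\<bar> powr p)) powr (1 / p) * d"
    using p d by (simp add: powr_mult powr_powr)
  finally show ?thesis .
qed

lemma HW_norm_diff_test_function:
  assumes U: "open U" and p: "1 < p" and u: "u \<in> HW p U" and \<phi>: "\<phi> \<in> test_functions U"
  shows "HW_norm p U (\<lambda>z. u z - \<phi> z) = Lp_norm p U (\<lambda>z. u z - \<phi> z) +
    (\<Sum>j\<in>UNIV. Lp_norm p U (\<lambda>z. weak_deriv U (heis_X j) u z - lie_deriv (heis_X j) \<phi> z)
      + Lp_norm p U (\<lambda>z. weak_deriv U (heis_Y j) u z - lie_deriv (heis_Y j) \<phi> z))"
proof -
  have "Lp_norm p U (weak_deriv U V (\<lambda>z. u z - \<phi> z)) = Lp_norm p U (\<lambda>z. weak_deriv U V u z - lie_deriv V \<phi> z)"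
    if V: "V \<in> hfields" for V
  proof (rule Lp_norm_cong_AE)
    note T = test_function_HW[OF U p \<phi>]
    have [measurable]: "lie_deriv V \<phi> \<in> borel_measurable (lebesgue_on U)"
      using test_function_Lp_space(2)[OF _ \<phi> _ shear_field_hfields[OF V], of p] p U
      by (auto simp: borel_open Lp_space_def)
    have [measurable]: "weak_deriv U V u \<in> borel_measurable (lebesgue_on U)"
      using HW_weak_deriv(2)[OF U u V] by (simp add: Lp_space_def)
    show "(\<lambda>z. weak_deriv U V u z - lie_deriv V \<phi> z) \<in> borel_measurable (lebesgue_on U)"
      by measurable
    have H: "(\<lambda>z. u z - \<phi> z) \<in> HW p U"
      using HW_linear(1)[OF U p u T(1), of "-1"] by simp
    show "weak_deriv U V (\<lambda>z. u z - \<phi> z) \<in> borel_measurable (lebesgue_on U)"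
      using HW_weak_deriv(2)[OF U H V] by (simp add: Lp_space_def)
    show "AE z in lebesgue_on U. weak_deriv U V (\<lambda>z. u z - \<phi> z) z = weak_deriv U V u z - lie_deriv V \<phi> z"
      using HW_linear(2)[OF U p u T(1) V, of "-1"] T(2)[OF V] by eventually_elim simp
  qed
  then show ?thesis
    by (simp add: HW_norm_def hfields_def)
qed

text \<open>The norm is a finite sum of nonnegative terms, so it is small exactly when all terms
  are. In this form the weak derivative of \<open>u\<close> itself is compared with classical
  derivatives, one field at a time.\<close>

lemma HW0_iff_approximable:
  fixes u :: "'n::finite heis \<Rightarrow> real"
  assumes U: "open U" and p: "1 < p" and u: "u \<in> HW p U"
  shows "u \<in> HW0 p U \<longleftrightarrow> (\<forall>e>0. \<exists>\<phi>\<in>test_functions U. Lp_norm p U (\<lambda>z. u z - \<phi> z) < e \<and>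
    (\<forall>V\<in>hfields. Lp_norm p U (\<lambda>z. weak_deriv U V u z - lie_deriv V \<phi> z) < e))" (is "_ = ?R")
proof
  assume L: "u \<in> HW0 p U"
  show ?R
  proof (intro allI impI)
    fix e :: real assume "e > 0"
    then obtain \<phi> where \<phi>: "\<phi> \<in> test_functions U" "HW_norm p U (\<lambda>z. u z - \<phi> z) < e"
      using L by (auto simp: HW0_def)
    define a where "a = (\<lambda>V. Lp_norm p U (\<lambda>z. weak_deriv U V u z - lie_deriv V \<phi> z))"
    have a0: "0 \<le> a V" for V by (simp add: a_def Lp_norm_nonneg)
    have s: "Lp_norm p U (\<lambda>z. u z - \<phi> z) + (\<Sum>j\<in>UNIV. a (heis_X j) + a (heis_Y j)) < e"
      using \<phi> HW_norm_diff_test_function[OF U p u \<phi>(1)] by (simp add: a_def)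
    have "a (heis_X j) + a (heis_Y j) \<le> (\<Sum>j\<in>UNIV. a (heis_X j) + a (heis_Y j))" for j :: 'n
      using a0 by (intro member_le_sum) auto
    then have "a (heis_X j) + a (heis_Y j) < e" for j :: 'n
      using s Lp_norm_nonneg[of p U "\<lambda>z. u z - \<phi> z"] by (meson add_increasing le_less_trans)
    then have "a (heis_X j) < e" "a (heis_Y j) < e" for j :: 'n
      using a0 by (metis add_increasing add_increasing2 le_less_trans order_refl)+
    then have "\<forall>V\<in>hfields. a V < e" by (auto simp: hfields_def)
    moreover have "0 \<le> (\<Sum>j\<in>(UNIV::'n set). a (heis_X j) + a (heis_Y j))"
      using a0 by (intro sum_nonneg) auto
    ultimately show "\<exists>\<phi>\<in>test_functions U. Lp_norm p U (\<lambda>z. u z - \<phi> z) < e \<and>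
        (\<forall>V\<in>hfields. Lp_norm p U (\<lambda>z. weak_deriv U V u z - lie_deriv V \<phi> z) < e)"
      using s \<phi>(1) by (intro bexI[of _ \<phi>]) (auto simp: a_def)
  qed
next
  assume R: ?R
  have "\<exists>\<phi>\<in>test_functions U. HW_norm p U (\<lambda>z. u z - \<phi> z) < e" if e: "e > 0" for e
  proof -
    \<comment> \<open>The denominator counts the terms of the Sobolev norm: the function and its
      \<open>2 * CARD('n)\<close> derivatives.\<close>
    define d where "d = e / (1 + 2 * real CARD('n))"
    have d: "d > 0" using e by (simp add: d_def add_pos_nonneg)
    obtain \<phi> where \<phi>: "\<phi> \<in> test_functions U" "Lp_norm p U (\<lambda>z. u z - \<phi> z) < d"
      "\<And>V. V \<in> hfields \<Longrightarrow> Lp_norm p U (\<lambda>z. weak_deriv U V u z - lie_deriv V \<phi> z) < d"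
      using R d by blast
    have "HW_norm p U (\<lambda>z. u z - \<phi> z) < d + (\<Sum>j\<in>(UNIV::'n set). d + d)"
      unfolding HW_norm_diff_test_function[OF U p u \<phi>(1)]
      using \<phi>(2) less_imp_le[OF \<phi>(3)]
      by (intro add_less_le_mono sum_mono add_mono) (auto simp: hfields_def)
    also have "\<dots> = d * (1 + 2 * real CARD('n))" by (simp add: algebra_simps)
    also have "\<dots> = e" by (simp add: d_def add_nonneg_eq_0_iff)
    finally show ?thesis using \<phi>(1) by blast
  qed
  then show "u \<in> HW0 p U" using u by (simp add: HW0_def)
qed

lemma HW0_imp_HW: "u \<in> HW0 p U \<Longrightarrow> u \<in> HW p U"
  by (simp add: HW0_def)

lemma HW0_linear:
  fixes u u' :: "'n::finite heis \<Rightarrow> real"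
  assumes U: "open U" and p: "1 < p" and u: "u \<in> HW0 p U" and u': "u' \<in> HW0 p U"
  shows "(\<lambda>z. u z + c * u' z) \<in> HW0 p U"
proof -
  have Us: "U \<in> sets lebesgue" using U by (simp add: borel_open)
  note h = HW0_imp_HW[OF u] and h' = HW0_imp_HW[OF u']
  note lin = HW_linear[OF U p h h', where c = c]
  define k where "k = (2 powr p * (1 + \<bar>c\<bar> powr p)) powr (1 / p)"
  have k: "k > 0" unfolding k_def by (simp add: add_pos_nonneg) (metis add_nonneg_eq_0_iff powr_ge_zero zero_le_one zero_neq_one)
  show ?thesis
    unfolding HW0_iff_approximable[OF U p lin(1)]
  proof (intro allI impI)
    fix e :: real assume e: "e > 0"
    \<comment> \<open>\<open>k\<close> is the loss in \<open>Lp_norm_linear_le\<close>; the extra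
      factor 2 makes the final inequality strict.\<close>
    define d where "d = e / (2 * k)"
    have d: "d > 0" using e k by (simp add: d_def)
    obtain \<phi> where \<phi>: "\<phi> \<in> test_functions U" "Lp_norm p U (\<lambda>z. u z - \<phi> z) < d"
      "\<And>V. V \<in> hfields \<Longrightarrow> Lp_norm p U (\<lambda>z. weak_deriv U V u z - lie_deriv V \<phi> z) < d"
      using u d unfolding HW0_iff_approximable[OF U p h] by blast
    obtain \<eta> where \<eta>: "\<eta> \<in> test_functions U" "Lp_norm p U (\<lambda>z. u' z - \<eta> z) < d"
      "\<And>V. V \<in> hfields \<Longrightarrow> Lp_norm p U (\<lambda>z. weak_deriv U V u' z - lie_deriv V \<eta> z) < d"
      using u' d unfolding HW0_iff_approximable[OF U p h'] by blast
    have small: "Lp_norm p U (\<lambda>z. f z + c * g z) < e"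
      if "f \<in> Lp_space p U" "g \<in> Lp_space p U" "Lp_norm p U f < d" "Lp_norm p U g < d" for f g
    proof -
      have "Lp_norm p U (\<lambda>z. f z + c * g z) \<le> k * d"
        unfolding k_def using p that by (intro Lp_norm_linear_le) auto
      also have "\<dots> < e" using k e by (simp add: d_def)
      finally show ?thesis .
    qed
    have Lpd: "(\<lambda>z. f z - g z) \<in> Lp_space p U" if "f \<in> Lp_space p U" "g \<in> Lp_space p U" for f g
      using Lp_space_linear[OF _ that, of "-1"] p by simp
    have p0: "0 < p" using p by simp
    note T\<phi> = test_function_Lp_space[OF p0 \<phi>(1) Us] and T\<eta> = test_function_Lp_space[OF p0 \<eta>(1) Us]
    show "\<exists>\<zeta>\<in>test_functions U. Lp_norm p U (\<lambda>z. u z + c * u' z - \<zeta> z) < e \<and>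
      (\<forall>V\<in>hfields. Lp_norm p U (\<lambda>z. weak_deriv U V (\<lambda>z. u z + c * u' z) z - lie_deriv V \<zeta> z) < e)"
    proof (intro bexI conjI ballI)
      show "(\<lambda>z. \<phi> z + c * \<eta> z) \<in> test_functions U" by (rule test_functions_linear[OF \<phi>(1) \<eta>(1)])
      have "Lp_norm p U (\<lambda>z. (u z - \<phi> z) + c * (u' z - \<eta> z)) < e"
        using h h' T\<phi>(1) T\<eta>(1) \<phi>(2) \<eta>(2) by (intro small Lpd) (auto simp: HW_iff)
      then show "Lp_norm p U (\<lambda>z. u z + c * u' z - (\<phi> z + c * \<eta> z)) < e"
        by (simp add: algebra_simps)
      fix V :: "'n heis \<Rightarrow> 'n heis" assume V: "V \<in> hfields"
      note sV = shear_field_hfields[OF V]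
      let ?f = "\<lambda>z. (weak_deriv U V u z - lie_deriv V \<phi> z) + c * (weak_deriv U V u' z - lie_deriv V \<eta> z)"
      have L: "(\<lambda>z. weak_deriv U V u z - lie_deriv V \<phi> z) \<in> Lp_space p U"
        "(\<lambda>z. weak_deriv U V u' z - lie_deriv V \<eta> z) \<in> Lp_space p U"
        by (intro Lpd HW_weak_deriv(2)[OF U h V] HW_weak_deriv(2)[OF U h' V] T\<phi>(2)[OF sV] T\<eta>(2)[OF sV])+
      have "Lp_norm p U ?f < e" by (rule small[OF L \<phi>(3)[OF V] \<eta>(3)[OF V]])
      also have "Lp_norm p U ?f
          = Lp_norm p U (\<lambda>z. weak_deriv U V (\<lambda>z. u z + c * u' z) z - lie_deriv V (\<lambda>z. \<phi> z + c * \<eta> z) z)"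
      proof (rule Lp_norm_cong_AE)
        show "?f \<in> borel_measurable (lebesgue_on U)"
          using Lp_space_linear[OF _ L, of c] p by (auto simp: Lp_space_def)
        show "(\<lambda>z. weak_deriv U V (\<lambda>z. u z + c * u' z) z - lie_deriv V (\<lambda>z. \<phi> z + c * \<eta> z) z)
            \<in> borel_measurable (lebesgue_on U)"
          using Lpd[OF HW_weak_deriv(2)[OF U lin(1) V]
              test_function_Lp_space(2)[OF p0 test_functions_linear[OF \<phi>(1) \<eta>(1)] Us sV]]
          by (auto simp: Lp_space_def)
        show "AE z in lebesgue_on U. ?f z
            = weak_deriv U V (\<lambda>z. u z + c * u' z) z - lie_deriv V (\<lambda>z. \<phi> z + c * \<eta> z) z"
          using lin(2)[OF V]
          by eventually_elim
            (simp add: lie_deriv_linear test_function_differentiable[OF \<phi>(1)]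
              test_function_differentiable[OF \<eta>(1)] algebra_simps)
      qed
      finally show "Lp_norm p U (\<lambda>z. weak_deriv U V (\<lambda>z. u z + c * u' z) z
          - lie_deriv V (\<lambda>z. \<phi> z + c * \<eta> z) z) < e" .
    qed
  qed
qed

lemma zero_HW0:
  assumes U: "open U" and p: "1 < p"
  shows "(\<lambda>z. 0) \<in> HW0 p U"
proof -
  have T: "(\<lambda>z. 0) \<in> test_functions U" by (rule zero_test_function)
  have u: "(\<lambda>z. 0) \<in> HW p U" by (rule test_function_HW(1)[OF U p T])
  show ?thesis
    unfolding HW0_iff_approximable[OF U p u]
  proof (intro allI impI bexI[OF _ T] conjI ballI)
    fix e :: real and V :: "'a heis \<Rightarrow> 'a heis" assume e: "e > 0" and V: "V \<in> hfields"
    have d: "lie_deriv V (\<lambda>z. 0) = (\<lambda>z. 0)"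
      by (rule ext) (simp add: lie_deriv_eq_frechet)
    have "Lp_norm p U (\<lambda>z. weak_deriv U V (\<lambda>z. 0) z - lie_deriv V (\<lambda>z. 0) z) = Lp_norm p U (\<lambda>z. 0)"
    proof (rule Lp_norm_cong_AE)
      show "AE z in lebesgue_on U. weak_deriv U V (\<lambda>z. 0) z - lie_deriv V (\<lambda>z. 0) z = 0"
        using test_function_HW(2)[OF U p T V] by eventually_elim simp
      show "(\<lambda>z. weak_deriv U V (\<lambda>z. 0) z - lie_deriv V (\<lambda>z. 0) z) \<in> borel_measurable (lebesgue_on U)"
        using HW_weak_deriv(2)[OF U u V] by (simp add: d Lp_space_def)
    qed simp
    then show "Lp_norm p U (\<lambda>z. weak_deriv U V (\<lambda>z. 0) z - lie_deriv V (\<lambda>z. 0) z) < e"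
      using e by (simp add: Lp_norm_def)
  qed (simp add: Lp_norm_def)
qed

section \<open>Extension by zero\<close>

text \<open>A test function \<open>\<eta>\<close> of \<open>U\<close> need not vanish at the
  boundary of \<open>B\<close>, so integration by parts for \<open>w\<close> on \<open>B\<close> is
  not immediate. It holds for each test function of \<open>B\<close> in place of \<open>w\<close>,
  because \<open>\<eta>\<close> is C1, and both sides are continuous in the Sobolev norm, in which
  \<open>w\<close> is such a limit.\<close>

lemma has_weak_deriv_extend_by_zero:
  fixes w :: "'n::finite heis \<Rightarrow> real"
  assumes p: "1 < p" and B: "open B" and U: "open U" and BU: "B \<subseteq> U" and w: "w \<in> HW0 p B"
    and V: "V \<in> hfields"
  shows "has_weak_deriv U V (\<lambda>z. if z \<in> B then w z else 0) (\<lambda>z. if z \<in> B then weak_deriv B V w z else 0)"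
  unfolding has_weak_deriv_def
proof (intro conjI ballI)
  have Bs: "B \<in> sets lebesgue" and Us: "U \<in> sets lebesgue" using B U by (simp_all add: borel_open)
  note h = HW0_imp_HW[OF w] and sV = shear_field_hfields[OF V]
  define D where "D = weak_deriv B V w"
  have wL: "w \<in> Lp_space p B" using h by (simp add: HW_iff)
  have DL: "D \<in> Lp_space p B" unfolding D_def by (rule HW_weak_deriv(2)[OF B h V])
  show "locally_integrable U (\<lambda>z. if z \<in> B then weak_deriv B V w z else 0)"
    using p by (intro Lp_space_locally_integrable[OF _ Lp_space_extend[OF DL[unfolded D_def] BU Bs Us] Us]) simp
  fix \<eta> assume \<eta>: "\<eta> \<in> test_functions U"
  obtain K where K: "compact K" "\<And>z. z \<notin> K \<Longrightarrow> \<eta> z = 0" "\<And>z. z \<notin> K \<Longrightarrow> lie_deriv V \<eta> z = 0"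
    using test_function_vanishes_off_support[OF \<eta>] by metis
  note c\<eta> = test_function_continuous[OF \<eta>] and cV = test_function_continuous_lie_deriv[OF \<eta> sV]
  obtain C1 where C1: "\<And>z. \<bar>\<eta> z\<bar> \<le> C1"
    using continuous_compact_support_bounded[OF c\<eta> K(1,2)] by metis
  obtain C2 where C2: "\<And>z. \<bar>lie_deriv V \<eta> z\<bar> \<le> C2"
    using continuous_compact_support_bounded[OF cV K(1,3)] by metis
  define m where "m = measure lebesgue (K \<inter> B) powr (1 - 1 / p)"
  have m: "0 \<le> m" by (simp add: m_def)
  have C0: "0 \<le> C1" "0 \<le> C2" using C1 C2 abs_ge_zero order_trans by blast+
  have pair\<eta>: "integrable (lebesgue_on B) (\<lambda>z. f z * \<eta> z)"
      "\<bar>LINT z|lebesgue_on B. f z * \<eta> z\<bar> \<le> C1 * (Lp_norm p B f * m)"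
    and pairV: "integrable (lebesgue_on B) (\<lambda>z. f z * lie_deriv V \<eta> z)"
      "\<bar>LINT z|lebesgue_on B. f z * lie_deriv V \<eta> z\<bar> \<le> C2 * (Lp_norm p B f * m)"
    if "f \<in> Lp_space p B" for f
    unfolding m_def Lp_norm_def
    using Lp_times_compact_support[OF p that Bs K(1) c\<eta> C1] Lp_times_compact_support[OF p that Bs K(1) cV C2] K
    by simp_all
  \<comment> \<open>\<open>X\<close> is the defect in the integration by parts. Subtracting the
    vanishing defect of an approximant \<open>\<phi>\<close> leaves only the approximation
    errors.\<close>
  define X where "X = (LINT z|lebesgue_on B. w z * lie_deriv V \<eta> z) + (LINT z|lebesgue_on B. D z * \<eta> z)"
  have X: "\<bar>X\<bar> \<le> (C1 + C2) * m * d" if d: "d > 0" for d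
  proof -
    obtain \<phi> where \<phi>: "\<phi> \<in> test_functions B" "Lp_norm p B (\<lambda>z. w z - \<phi> z) < d"
      "Lp_norm p B (\<lambda>z. D z - lie_deriv V \<phi> z) < d"
      using w d V unfolding HW0_iff_approximable[OF B p h] D_def by blast
    have p0: "0 < p" using p by simp
    note T = test_function_Lp_space(1)[OF p0 \<phi>(1) Bs] test_function_Lp_space(2)[OF p0 \<phi>(1) Bs sV]
    have L: "(\<lambda>z. w z - \<phi> z) \<in> Lp_space p B" "(\<lambda>z. D z - lie_deriv V \<phi> z) \<in> Lp_space p B"
      using Lp_space_linear[OF _ wL T(1), of "-1"] Lp_space_linear[OF _ DL T(2), of "-1"] p by simp_all
    have "(LINT z|lebesgue_on B. \<eta> z * lie_deriv V \<phi> z) = - (LINT z|lebesgue_on B. lie_deriv V \<eta> z * \<phi> z)"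
      using C1_has_weak_deriv[OF sV B test_function_Ck[OF \<eta>]] \<phi>(1)
      by (simp add: has_weak_deriv_def)
    then have ibp: "(LINT z|lebesgue_on B. \<phi> z * lie_deriv V \<eta> z) + (LINT z|lebesgue_on B. lie_deriv V \<phi> z * \<eta> z) = 0"
      by (simp add: mult.commute)
    have "(LINT z|lebesgue_on B. (w z - \<phi> z) * lie_deriv V \<eta> z)
        = (LINT z|lebesgue_on B. w z * lie_deriv V \<eta> z) - (LINT z|lebesgue_on B. \<phi> z * lie_deriv V \<eta> z)"
      using pairV(1)[OF wL] pairV(1)[OF T(1)] by (simp add: left_diff_distrib)
    moreover have "(LINT z|lebesgue_on B. (D z - lie_deriv V \<phi> z) * \<eta> z)
        = (LINT z|lebesgue_on B. D z * \<eta> z) - (LINT z|lebesgue_on B. lie_deriv V \<phi> z * \<eta> z)"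
      using pair\<eta>(1)[OF DL] pair\<eta>(1)[OF T(2)] by (simp add: left_diff_distrib)
    ultimately have "X = (LINT z|lebesgue_on B. (w z - \<phi> z) * lie_deriv V \<eta> z)
        + (LINT z|lebesgue_on B. (D z - lie_deriv V \<phi> z) * \<eta> z)"
      using ibp by (simp add: X_def)
    moreover have "\<bar>LINT z|lebesgue_on B. (w z - \<phi> z) * lie_deriv V \<eta> z\<bar> \<le> C2 * (d * m)"
      using C0 m \<phi>(2) by (intro order_trans[OF pairV(2)[OF L(1)]] mult_left_mono mult_right_mono) auto
    moreover have "\<bar>LINT z|lebesgue_on B. (D z - lie_deriv V \<phi> z) * \<eta> z\<bar> \<le> C1 * (d * m)"
      using C0 m \<phi>(3) by (intro order_trans[OF pair\<eta>(2)[OF L(2)]] mult_left_mono mult_right_mono) auto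
    ultimately have "\<bar>X\<bar> \<le> C2 * (d * m) + C1 * (d * m)" by linarith
    then show ?thesis by (simp add: algebra_simps)
  qed
  have X0: "X = 0"
  proof (rule ccontr)
    assume "X \<noteq> 0"
    \<comment> \<open>The bound holds with every positive \<open>d\<close>; taking
      \<open>\<bar>X\<bar> / (A + 1)\<close> contradicts a nonzero \<open>X\<close>, also when
      \<open>A\<close> is 0.\<close>
    define A where "A = (C1 + C2) * m"
    have A: "0 \<le> A" using C0 m by (simp add: A_def)
    have "\<bar>X\<bar> \<le> A * (\<bar>X\<bar> / (A + 1))"
      using X[of "\<bar>X\<bar> / (A + 1)"] A \<open>X \<noteq> 0\<close> by (simp add: A_def)
    then have "\<bar>X\<bar> * (A + 1) \<le> A * \<bar>X\<bar>" using A by (simp add: field_simps)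
    then show False using \<open>X \<noteq> 0\<close> by (simp add: algebra_simps)
  qed
  have "(LINT z|lebesgue_on U. (if z \<in> B then w z else 0) * lie_deriv V \<eta> z) = (LINT z|lebesgue_on B. w z * lie_deriv V \<eta> z)"
    using integral_restrict[OF BU Bs Us, of "\<lambda>z. w z * lie_deriv V \<eta> z"]
    by (simp add: if_distrib[of "\<lambda>x. x * _"] cong: if_cong)
  moreover have "(LINT z|lebesgue_on U. (if z \<in> B then weak_deriv B V w z else 0) * \<eta> z) = (LINT z|lebesgue_on B. D z * \<eta> z)"
    using integral_restrict[OF BU Bs Us, of "\<lambda>z. D z * \<eta> z"]
    by (simp add: D_def if_distrib[of "\<lambda>x. x * _"] cong: if_cong)
  ultimately show "(LINT z|lebesgue_on U. (if z \<in> B then w z else 0) * lie_deriv V \<eta> z)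
      = - (LINT z|lebesgue_on U. (if z \<in> B then weak_deriv B V w z else 0) * \<eta> z)"
    using X0 by (simp add: X_def add_eq_0_iff)
qed

text \<open>Approximants of \<open>w\<close> on \<open>B\<close> also approximate the extension on
  \<open>U\<close>: they and their derivatives vanish off \<open>B\<close>, so the norms over
  \<open>U\<close> and over \<open>B\<close> agree.\<close>

lemma HW0_extend_by_zero:
  fixes w :: "'n::finite heis \<Rightarrow> real"
  assumes p: "1 < p" and B: "open B" and U: "open U" and BU: "B \<subseteq> U" and w: "w \<in> HW0 p B"
  shows "(\<lambda>z. if z \<in> B then w z else 0) \<in> HW0 p U"
    and "V \<in> hfields \<Longrightarrow> AE z in lebesgue_on U.
      weak_deriv U V (\<lambda>z. if z \<in> B then w z else 0) z = (if z \<in> B then weak_deriv B V w z else 0)"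
proof -
  have Bs: "B \<in> sets lebesgue" and Us: "U \<in> sets lebesgue" using B U by (simp_all add: borel_open)
  note h = HW0_imp_HW[OF w]
  let ?w = "\<lambda>z. if z \<in> B then w z else 0"
  note W = has_weak_deriv_extend_by_zero[OF p B U BU w]
  show AE: "V \<in> hfields \<Longrightarrow> AE z in lebesgue_on U. weak_deriv U V ?w z = (if z \<in> B then weak_deriv B V w z else 0)" for V
    by (rule weak_deriv_AE_eq[OF U W])
  have L: "(\<lambda>z. if z \<in> B then weak_deriv B V w z else 0) \<in> Lp_space p U" if "V \<in> hfields" for V
    by (rule Lp_space_extend[OF HW_weak_deriv(2)[OF B h that] BU Bs Us])
  have "?w \<in> Lp_space p U" using h by (intro Lp_space_extend[OF _ BU Bs Us]) (simp add: HW_iff)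
  then have H: "?w \<in> HW p U" using W L unfolding HW_iff by blast
  have same: "Lp_norm p U (\<lambda>z. (if z \<in> B then f z else 0) - g z) = Lp_norm p B (\<lambda>z. f z - g z)"
    if "\<And>z. z \<notin> B \<Longrightarrow> g z = 0" for f g :: "'n heis \<Rightarrow> real"
  proof -
    have "\<bar>(if z \<in> B then f z else 0) - g z\<bar> powr p = (if z \<in> B then \<bar>f z - g z\<bar> powr p else 0)" for z
      using that by auto
    then show ?thesis
      using integral_restrict[OF BU Bs Us, of "\<lambda>z. \<bar>f z - g z\<bar> powr p"] by (simp add: Lp_norm_def)
  qed
  show "?w \<in> HW0 p U"
    unfolding HW0_iff_approximable[OF U p H]
  proof (intro allI impI)
    fix e :: real assume "e > 0"
    then obtain \<phi> where \<phi>: "\<phi> \<in> test_functions B" "Lp_norm p B (\<lambda>z. w z - \<phi> z) < e"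
      "\<And>V. V \<in> hfields \<Longrightarrow> Lp_norm p B (\<lambda>z. weak_deriv B V w z - lie_deriv V \<phi> z) < e"
      using w unfolding HW0_iff_approximable[OF B p h] by blast
    have \<phi>U: "\<phi> \<in> test_functions U" using \<phi>(1) test_functions_mono[OF BU] by blast
    obtain K where "K \<subseteq> B" "\<And>z. z \<notin> K \<Longrightarrow> \<phi> z = 0" "\<And>V z. z \<notin> K \<Longrightarrow> lie_deriv V \<phi> z = 0"
      using test_function_vanishes_off_support[OF \<phi>(1)] by metis
    then have off: "\<phi> z = 0" "lie_deriv V \<phi> z = 0" if "z \<notin> B" for z V using that by blast+
    show "\<exists>\<phi>\<in>test_functions U. Lp_norm p U (\<lambda>z. ?w z - \<phi> z) < e \<and>
        (\<forall>V\<in>hfields. Lp_norm p U (\<lambda>z. weak_deriv U V ?w z - lie_deriv V \<phi> z) < e)"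
    proof (intro bexI[OF _ \<phi>U] conjI ballI)
      show "Lp_norm p U (\<lambda>z. ?w z - \<phi> z) < e" using same[of \<phi> w] off \<phi>(2) by simp
      fix V :: "'n heis \<Rightarrow> 'n heis" assume V: "V \<in> hfields"
      have [measurable]: "lie_deriv V \<phi> \<in> borel_measurable (lebesgue_on U)"
        using test_function_Lp_space(2)[OF _ \<phi>U Us shear_field_hfields[OF V], of p] p by (simp add: Lp_space_def)
      have [measurable]: "weak_deriv U V ?w \<in> borel_measurable (lebesgue_on U)"
        using HW_weak_deriv(2)[OF U H V] by (simp add: Lp_space_def)
      have [measurable]: "(\<lambda>z. if z \<in> B then weak_deriv B V w z else 0) \<in> borel_measurable (lebesgue_on U)"
        using L[OF V] by (simp add: Lp_space_def)
      have "Lp_norm p U (\<lambda>z. weak_deriv U V ?w z - lie_deriv V \<phi> z)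
          = Lp_norm p U (\<lambda>z. (if z \<in> B then weak_deriv B V w z else 0) - lie_deriv V \<phi> z)"
      proof (rule Lp_norm_cong_AE)
        show "AE z in lebesgue_on U. weak_deriv U V ?w z - lie_deriv V \<phi> z
            = (if z \<in> B then weak_deriv B V w z else 0) - lie_deriv V \<phi> z"
          using AE[OF V] by eventually_elim (simp only:)
      qed measurable
      also have "\<dots> = Lp_norm p B (\<lambda>z. weak_deriv B V w z - lie_deriv V \<phi> z)"
        using off by (intro same)
      also have "\<dots> < e" by (rule \<phi>(3)[OF V])
      finally show "Lp_norm p U (\<lambda>z. weak_deriv U V ?w z - lie_deriv V \<phi> z) < e" .
    qed
  qed
qed

section \<open>The horizontal gradient\<close>

lemma hgrad_measurable:
  fixes u :: "'n::finite heis \<Rightarrow> real"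
  assumes "open U" "u \<in> HW p U"
  shows "hgrad U u \<in> borel_measurable (lebesgue_on U)"
proof -
  have [measurable]: "weak_deriv U (heis_X j) u \<in> borel_measurable (lebesgue_on U)"
    "weak_deriv U (heis_Y j) u \<in> borel_measurable (lebesgue_on U)" for j
    using HW_weak_deriv(2)[OF assms] by (auto simp: hfields_def Lp_space_def)
  have "(\<lambda>z. \<chi> j. weak_deriv U (heis_X j) u z) \<in> borel_measurable (lebesgue_on U)"
    "(\<lambda>z. \<chi> j. weak_deriv U (heis_Y j) u z) \<in> borel_measurable (lebesgue_on U)"
    by (subst borel_measurable_euclidean_space; auto simp: Basis_vec_def inner_axis)+
  then show ?thesis
    unfolding hgrad_def[abs_def] by (rule borel_measurable_Pair)
qed

lemma hgrad_powr_integrable: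
  fixes u :: "'n::finite heis \<Rightarrow> real"
  assumes U: "open U" and p: "0 \<le> p" and u: "u \<in> HW p U"
  shows "integrable (lebesgue_on U) (\<lambda>z. norm (hgrad U u z) powr p)"
proof -
  define S where "S = (\<lambda>z. (\<Sum>j\<in>UNIV. \<bar>weak_deriv U (heis_X j) u z\<bar>) + 1 * (\<Sum>j\<in>UNIV. \<bar>weak_deriv U (heis_Y j) u z\<bar>))"
  have "S \<in> Lp_space p U"
    unfolding S_def using HW_weak_deriv(2)[OF U u] p
    by (intro Lp_space_linear Lp_space_sum_abs) (auto simp: hfields_def)
  then have int: "integrable (lebesgue_on U) (\<lambda>z. \<bar>S z\<bar> powr p)" by (simp add: Lp_space_def)
  have le: "norm (hgrad U u z) \<le> \<bar>S z\<bar>" for z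
  proof -
    have "norm (hgrad U u z) \<le> norm (\<chi> j. weak_deriv U (heis_X j) u z) + norm (\<chi> j. weak_deriv U (heis_Y j) u z)"
      unfolding hgrad_def by (rule norm_Pair_le)
    also have "\<dots> \<le> S z"
      unfolding S_def using norm_le_l1_cart[of "\<chi> j. weak_deriv U (heis_X j) u z"]
        norm_le_l1_cart[of "\<chi> j. weak_deriv U (heis_Y j) u z"] by simp
    finally show ?thesis by simp
  qed
  show ?thesis
  proof (rule Bochner_Integration.integrable_bound[OF int])
    show "(\<lambda>z. norm (hgrad U u z) powr p) \<in> borel_measurable (lebesgue_on U)"
      using hgrad_measurable[OF U u] by measurable
    show "AE z in lebesgue_on U. norm (norm (hgrad U u z) powr p) \<le> norm (\<bar>S z\<bar> powr p)"
      using p le by (auto intro!: powr_mono2)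
  qed
qed

section \<open>Gauge balls\<close>

lemma open_heis_ball: "open (heis_ball R :: 'n::finite heis set)"
proof -
  have "continuous_on UNIV (heis_norm :: 'n heis \<Rightarrow> real)"
    unfolding heis_norm_def case_prod_unfold by (intro continuous_intros)
  then show ?thesis
    unfolding heis_ball_def by (intro open_Collect_less continuous_on_const)
qed

lemma heis_ball_subset_cbox:
  assumes R: "0 < R"
  shows "(heis_ball R :: 'n::finite heis set) \<subseteq>
    cbox (\<chi> i. - R, \<chi> i. - R, - (R\<^sup>2)) (\<chi> i. R, \<chi> i. R, R\<^sup>2)"
proof
  fix z :: "'n heis" assume z: "z \<in> heis_ball R"
  obtain x y t where zt: "z = (x, y, t)" by (cases z)
  have "root 4 (norm (x, y) ^ 4 + t\<^sup>2) < root 4 (R ^ 4)"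
    using z R by (simp add: heis_ball_def heis_norm_def zt real_root_power_cancel)
  then have lt: "norm (x, y) ^ 4 + t\<^sup>2 < R ^ 4" by simp
  then have "norm (x, y) ^ 4 < R ^ 4" using zero_le_power2[of t] by linarith
  then have xy: "norm (x, y) \<le> R" using R power_less_imp_less_base by (metis less_imp_le)
  have "0 \<le> norm (x, y) ^ 4" by simp
  then have "t\<^sup>2 < R ^ 4" using lt by linarith
  then have "t\<^sup>2 < (R\<^sup>2)\<^sup>2" by (simp flip: power_mult)
  then have t: "\<bar>t\<bar> \<le> R\<^sup>2" using abs_le_square_iff[of t "R\<^sup>2"] by simp
  have "\<bar>x $ i\<bar> \<le> R" "\<bar>y $ i\<bar> \<le> R" for i
    using component_le_norm_cart[of x i] component_le_norm_cart[of y i]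
      norm_fst_le[of "x" "y"] norm_snd_le[of "y" "x"] xy by linarith+
  then show "z \<in> cbox (\<chi> i. - R, \<chi> i. - R, - (R\<^sup>2)) (\<chi> i. R, \<chi> i. R, R\<^sup>2)"
    using t by (auto simp: zt cbox_Pair_eq mem_box_cart abs_le_iff minus_le_iff)
qed

lemma heis_ball_lmeasurable:
  assumes "0 < R"
  shows "(heis_ball R :: 'n::finite heis set) \<in> lmeasurable"
proof (rule fmeasurableI2[OF lmeasurable_cbox heis_ball_subset_cbox[OF assms]])
  show "(heis_ball R :: 'n heis set) \<in> sets lebesgue" by (simp add: borel_open open_heis_ball)
qed

text \<open>The enclosing box has \<open>2 * CARD('n)\<close> sides of length \<open>2 * R\<close>
  and one of length \<open>2 * R\<^sup>2\<close>; the quadratic size in t turns the topological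
  dimension into the homogeneous one.\<close>

lemma measure_heis_ball_le:
  assumes R: "0 < R"
  shows "measure lebesgue (heis_ball R :: 'n::finite heis set) \<le> 2 ^ (2 * CARD('n) + 1) * R ^ (2 * (CARD('n) + 1))"
proof -
  let ?Q = "cbox (\<chi> i. - R, \<chi> i. - R, - (R\<^sup>2)) (\<chi> i. R, \<chi> i. R, R\<^sup>2) :: 'n heis set"
  have "measure lebesgue (heis_ball R :: 'n heis set) \<le> measure lebesgue ?Q"
    using heis_ball_subset_cbox[OF R] heis_ball_lmeasurable[OF R]
    by (intro measure_mono_fmeasurable lmeasurable_cbox) (auto dest: fmeasurableD)
  also have "measure lebesgue ?Q = measure lborel ?Q"
    by (simp add: measure_completion)
  also have "\<dots> = (2 * R) ^ CARD('n) * ((2 * R) ^ CARD('n) * (2 * R\<^sup>2))"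
  proof -
    have "measure lborel (cbox (\<chi> i. - R) (\<chi> i. R) :: (real ^ 'n) set) = (2 * R) ^ CARD('n)"
      using R by (subst content_cbox_cart) (auto simp: interval_eq_empty_cart)
    then show ?thesis using R by (simp add: content_Pair)
  qed
  also have "\<dots> = 2 ^ (2 * CARD('n) + 1) * R ^ (2 * (CARD('n) + 1))"
  proof -
    have "(2 * R) ^ k * ((2 * R) ^ k * (2 * R\<^sup>2)) = 2 ^ (2 * k + 1) * R ^ (2 * (k + 1))" for k
      by (induction k) (simp_all add: power2_eq_square algebra_simps)
    then show ?thesis .
  qed
  finally show ?thesis .
qed

section \<open>Competitors in the two obstacle problems\<close>

text \<open>On \<open>B\<close> the function is the mean of \<open>u0\<close> and \<open>ue\<close>,
  so it respects the obstacle by convexity. Writing it as \<open>u0\<close> plus half of a zero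
  extension makes the boundary condition and the gradients follow from linearity.\<close>

lemma half_step_in_obstacle_class:
  fixes u0 ue :: "'n::finite heis \<Rightarrow> real" and B :: "'n heis set"
  defines "m \<equiv> \<lambda>z. u0 z + 1 / 2 * (if z \<in> B then ue z - u0 z else 0)"
  assumes p: "1 < p" and B: "open B" and U: "open U" and BU: "B \<subseteq> U"
    and u0: "u0 \<in> obstacle_class p U \<psi> g" and ue: "ue \<in> obstacle_class p B \<psi> u0"
  shows "m \<in> obstacle_class p U \<psi> g"
    and "AE z in lebesgue_on U. z \<in> B \<longrightarrow> hgrad U m z = (1 / 2) *\<^sub>R (hgrad U u0 z + hgrad B ue z)"
    and "AE z in lebesgue_on U. z \<notin> B \<longrightarrow> hgrad U m z = hgrad U u0 z"
proof -
  have Bs: "B \<in> sets lebesgue" and Us: "U \<in> sets lebesgue" using B U by (simp_all add: borel_open)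
  have h0: "u0 \<in> HW p U" and he: "ue \<in> HW p B" and w: "(\<lambda>z. ue z - u0 z) \<in> HW0 p B"
    and g: "(\<lambda>z. u0 z - g z) \<in> HW0 p U"
    using u0 ue by (auto simp: obstacle_class_def)
  let ?w = "\<lambda>z. if z \<in> B then ue z - u0 z else 0"
  note ext = HW0_extend_by_zero[OF p B U BU w]
  note lin = HW_linear[OF U p h0 HW0_imp_HW[OF ext(1)], where c = "1 / 2", folded m_def]
  have "(\<lambda>z. (u0 z - g z) + 1 / 2 * ?w z) \<in> HW0 p U"
    by (rule HW0_linear[OF U p g ext(1)])
  moreover have "(\<lambda>z. (u0 z - g z) + 1 / 2 * ?w z) = (\<lambda>z. m z - g z)" by (auto simp: m_def)
  ultimately have m0: "(\<lambda>z. m z - g z) \<in> HW0 p U" by simp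
  have "AE z in lebesgue. z \<in> U \<longrightarrow> u0 z \<le> \<psi> z" "AE z in lebesgue. z \<in> B \<longrightarrow> ue z \<le> \<psi> z"
    using u0 ue Us Bs by (auto simp: obstacle_class_def AE_restrict_space_iff)
  then have "AE z in lebesgue. z \<in> U \<longrightarrow> m z \<le> \<psi> z"
    by eventually_elim (auto simp: m_def field_simps)
  then have "AE z in lebesgue_on U. m z \<le> \<psi> z" using Us by (simp add: AE_restrict_space_iff)
  then show "m \<in> obstacle_class p U \<psi> g"
    using lin(1) m0 by (simp add: obstacle_class_def)
  note r = HW_restrict[OF B U BU h0]
  have W: "AE z in lebesgue_on U. weak_deriv U V m z
      = weak_deriv U V u0 z + 1 / 2 * (if z \<in> B then weak_deriv B V ue z - weak_deriv U V u0 z else 0)"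
    if V: "V \<in> hfields" for V
  proof -
    have "AE z in lebesgue_on B. weak_deriv B V (\<lambda>z. ue z + (-1) * u0 z) z = weak_deriv B V ue z - weak_deriv U V u0 z"
      using HW_linear(2)[OF B p he r(1) V, of "-1"] r(2)[OF V] by eventually_elim simp
    then have "AE z in lebesgue. z \<in> B \<longrightarrow> weak_deriv B V (\<lambda>z. ue z - u0 z) z = weak_deriv B V ue z - weak_deriv U V u0 z"
      using Bs by (simp add: AE_restrict_space_iff)
    then have "AE z in lebesgue_on U. z \<in> B \<longrightarrow> weak_deriv B V (\<lambda>z. ue z - u0 z) z = weak_deriv B V ue z - weak_deriv U V u0 z"
      using Us by (auto simp: AE_restrict_space_iff elim: eventually_mono)
    then show ?thesis
      using lin(2)[OF V] ext(2)[OF V] by eventually_elim auto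
  qed
  have H: "AE z in lebesgue_on U. \<forall>V\<in>hfields. weak_deriv U V m z
      = weak_deriv U V u0 z + 1 / 2 * (if z \<in> B then weak_deriv B V ue z - weak_deriv U V u0 z else 0)"
    using W by (intro AE_finite_allI finite_hfields)
  from H show "AE z in lebesgue_on U. z \<in> B \<longrightarrow> hgrad U m z = (1 / 2) *\<^sub>R (hgrad U u0 z + hgrad B ue z)"
    by eventually_elim (auto simp: hgrad_def hfields_def vec_eq_iff field_simps)
  from H show "AE z in lebesgue_on U. z \<notin> B \<longrightarrow> hgrad U m z = hgrad U u0 z"
    by eventually_elim (auto simp: hgrad_def hfields_def vec_eq_iff)
qed

text \<open>The half step competes with \<open>u0\<close> on \<open>U\<close>, and its gradient
  differs from that of \<open>u0\<close> only on \<open>B\<close> up to a null set; the energies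
  outside \<open>B\<close> therefore cancel.\<close>

lemma energy_le_on_subset:
  fixes u0 ue :: "'n::finite heis \<Rightarrow> real"
  assumes p: "1 < p" and B: "open B" and U: "open U" and BU: "B \<subseteq> U"
    and u0: "is_arg_min (\<lambda>u. LINT z|lebesgue_on U. norm (hgrad U u z) powr p)
      (\<lambda>u. u \<in> obstacle_class p U \<psi> g) u0"
    and ue: "ue \<in> obstacle_class p B \<psi> u0"
  shows "(LINT z|lebesgue_on B. norm (hgrad U u0 z) powr p)
    \<le> (LINT z|lebesgue_on B. norm ((1 / 2) *\<^sub>R (hgrad U u0 z + hgrad B ue z)) powr p)"
proof -
  have Bs: "B \<in> sets lebesgue" and Us: "U \<in> sets lebesgue" using B U by (simp_all add: borel_open)
  have u0c: "u0 \<in> obstacle_class p U \<psi> g" using u0 by (simp add: is_arg_min_def)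
  define m where "m = (\<lambda>z. u0 z + 1 / 2 * (if z \<in> B then ue z - u0 z else 0))"
  note M = half_step_in_obstacle_class[OF p B U BU u0c ue, folded m_def]
  have h0: "u0 \<in> HW p U" and hm: "m \<in> HW p U" and he: "ue \<in> HW p B"
    using u0c M(1) ue by (auto simp: obstacle_class_def)
  define a where "a = hgrad U u0"
  define b where "b = hgrad B ue"
  have p0: "0 \<le> p" using p by simp
  note i0 = hgrad_powr_integrable[OF U p0 h0] and im = hgrad_powr_integrable[OF U p0 hm]
  have res: "integrable (lebesgue_on B) f" if "integrable (lebesgue_on U) f" for f :: "'n heis \<Rightarrow> real"
  proof -
    have "integrable lebesgue (\<lambda>z. indicator U z *\<^sub>R f z)" using that Us by (simp add: integrable_restrict_space)
    then have "integrable lebesgue (\<lambda>z. indicator B z *\<^sub>R (indicator U z *\<^sub>R f z))"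
      by (rule integrable_mult_indicator[OF Bs])
    moreover have "indicator B z *\<^sub>R (indicator U z *\<^sub>R f z) = indicator B z *\<^sub>R f z" for z
      using BU by (auto simp: indicator_def)
    ultimately have "integrable lebesgue (\<lambda>z. indicator B z *\<^sub>R f z)" by (simp only:)
    then show ?thesis using Bs by (simp add: integrable_restrict_space)
  qed
  have "(LINT z|lebesgue_on U. norm (a z) powr p) \<le> (LINT z|lebesgue_on U. norm (hgrad U m z) powr p)"
    using u0 M(1) by (auto simp: is_arg_min_def not_less a_def)
  then have "0 \<le> (LINT z|lebesgue_on U. norm (hgrad U m z) powr p - norm (a z) powr p)"
    using i0 im by (simp add: a_def)
  also have "\<dots> = (LINT z|lebesgue_on U. (if z \<in> B then norm (hgrad U m z) powr p - norm (a z) powr p else 0))"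
  proof (rule integral_cong_AE)
    have meas: "(\<lambda>z. norm (hgrad U m z) powr p - norm (a z) powr p) \<in> borel_measurable (lebesgue_on U)"
      using i0 im by (auto simp: a_def)
    then show "(\<lambda>z. norm (hgrad U m z) powr p - norm (a z) powr p) \<in> borel_measurable (lebesgue_on U)" .
    show "(\<lambda>z. if z \<in> B then norm (hgrad U m z) powr p - norm (a z) powr p else 0) \<in> borel_measurable (lebesgue_on U)"
      using measurable_restrict_mono[OF meas BU] by (simp add: borel_measurable_if_lebesgue_on[OF Bs Us BU])
    show "AE z in lebesgue_on U. norm (hgrad U m z) powr p - norm (a z) powr p
        = (if z \<in> B then norm (hgrad U m z) powr p - norm (a z) powr p else 0)"
      using M(3) by eventually_elim (auto simp: a_def)
  qed
  also have "\<dots> = (LINT z|lebesgue_on B. norm (hgrad U m z) powr p - norm (a z) powr p)"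
    by (rule integral_restrict[OF BU Bs Us])
  also have "\<dots> = (LINT z|lebesgue_on B. norm (hgrad U m z) powr p) - (LINT z|lebesgue_on B. norm (a z) powr p)"
    using res[OF i0] res[OF im] by (simp add: a_def)
  also have "(LINT z|lebesgue_on B. norm (hgrad U m z) powr p)
      = (LINT z|lebesgue_on B. norm ((1 / 2) *\<^sub>R (a z + b z)) powr p)"
  proof (rule integral_cong_AE)
    show "(\<lambda>z. norm (hgrad U m z) powr p) \<in> borel_measurable (lebesgue_on B)" using res[OF im] by auto
    have "a \<in> borel_measurable (lebesgue_on B)" "b \<in> borel_measurable (lebesgue_on B)"
      using measurable_restrict_mono[OF hgrad_measurable[OF U h0] BU] hgrad_measurable[OF B he]
      by (auto simp: a_def b_def)
    then show "(\<lambda>z. norm ((1 / 2) *\<^sub>R (a z + b z)) powr p) \<in> borel_measurable (lebesgue_on B)"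
      by measurable
    have "AE z in lebesgue. z \<in> U \<longrightarrow> z \<in> B \<longrightarrow> hgrad U m z = (1 / 2) *\<^sub>R (a z + b z)"
      using M(2) Us by (simp add: AE_restrict_space_iff a_def b_def)
    then have "AE z in lebesgue_on B. hgrad U m z = (1 / 2) *\<^sub>R (a z + b z)"
      using Bs BU by (auto simp: AE_restrict_space_iff elim: eventually_mono)
    then show "AE z in lebesgue_on B. norm (hgrad U m z) powr p = norm ((1 / 2) *\<^sub>R (a z + b z)) powr p"
      by eventually_elim simp
  qed
  finally show ?thesis by (simp add: a_def b_def)
qed

text \<open>\<open>u0\<close> belongs to the class defined by its own boundary values, because its
  difference to itself is 0. It remains to replace its gradient on \<open>B\<close> by that on
  \<open>U\<close>, which agrees almost everywhere.\<close>

lemma regularized_energy_le: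
  fixes u0 ue :: "'n::finite heis \<Rightarrow> real"
  assumes p: "1 < p" and B: "open B" and U: "open U" and BU: "B \<subseteq> U"
    and u0: "u0 \<in> obstacle_class p U \<psi> g"
    and ue: "is_arg_min (\<lambda>u. LINT z|lebesgue_on B. (\<epsilon> + (norm (hgrad B u z))\<^sup>2) powr (p / 2))
      (\<lambda>u. u \<in> obstacle_class p B \<psi> u0) ue"
  shows "(LINT z|lebesgue_on B. (\<epsilon> + (norm (hgrad B ue z))\<^sup>2) powr (p / 2))
    \<le> (LINT z|lebesgue_on B. (\<epsilon> + (norm (hgrad U u0 z))\<^sup>2) powr (p / 2))"
proof -
  have Bs: "B \<in> sets lebesgue" and Us: "U \<in> sets lebesgue" using B U by (simp_all add: borel_open)
  have h0: "u0 \<in> HW p U" using u0 by (simp add: obstacle_class_def)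
  note r = HW_restrict[OF B U BU h0]
  have "AE z in lebesgue. z \<in> U \<longrightarrow> u0 z \<le> \<psi> z"
    using u0 Us by (simp add: obstacle_class_def AE_restrict_space_iff)
  then have "AE z in lebesgue_on B. u0 z \<le> \<psi> z"
    using Bs BU by (auto simp: AE_restrict_space_iff elim: eventually_mono)
  then have "u0 \<in> obstacle_class p B \<psi> u0"
    using r(1) zero_HW0[OF B p] by (simp add: obstacle_class_def)
  then have "(LINT z|lebesgue_on B. (\<epsilon> + (norm (hgrad B ue z))\<^sup>2) powr (p / 2))
      \<le> (LINT z|lebesgue_on B. (\<epsilon> + (norm (hgrad B u0 z))\<^sup>2) powr (p / 2))"
    using ue by (auto simp: is_arg_min_def not_less)
  also have "\<dots> = (LINT z|lebesgue_on B. (\<epsilon> + (norm (hgrad U u0 z))\<^sup>2) powr (p / 2))"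
  proof (rule integral_cong_AE)
    have "AE z in lebesgue_on B. \<forall>V\<in>hfields. weak_deriv B V u0 z = weak_deriv U V u0 z"
      using r(2) by (intro AE_finite_allI finite_hfields)
    then show "AE z in lebesgue_on B. (\<epsilon> + (norm (hgrad B u0 z))\<^sup>2) powr (p / 2)
        = (\<epsilon> + (norm (hgrad U u0 z))\<^sup>2) powr (p / 2)"
      by eventually_elim (simp add: hgrad_def hfields_def)
  qed (use hgrad_measurable[OF B r(1)] measurable_restrict_mono[OF hgrad_measurable[OF U h0] BU] in measurable)
  finally show ?thesis .
qed

theorem proposition3:
  fixes p :: real
  assumes "1 < p" and "p \<le> 2"
  shows "\<exists>C>0. \<forall>(\<Omega> :: 'n::finite heis set) \<Omega>' \<psi> g R \<epsilon> u0 u\<epsilon>.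
    open \<Omega> \<and> bounded \<Omega> \<and> smooth_boundary \<Omega> \<and> 0 \<in> \<Omega> \<and>
    horizontal_Ck 2 \<psi> \<and>
    open \<Omega>' \<and> connected \<Omega>' \<and> smooth_boundary \<Omega>' \<and> compactly_contained \<Omega> \<Omega>' \<and>
    g \<in> HW p \<Omega>' \<inter> Linf_space \<Omega>' \<and>
    0 < R \<and> R < 1 \<and> compactly_contained (heis_ball R) \<Omega> \<and> 0 < \<epsilon> \<and>
    is_arg_min (\<lambda>u. LINT z|lebesgue_on \<Omega>. norm (hgrad \<Omega> u z) powr p)
      (\<lambda>u. u \<in> obstacle_class p \<Omega> \<psi> g) u0 \<and>
    is_arg_min (\<lambda>u. LINT z|lebesgue_on (heis_ball R).
        (\<epsilon> + (norm (hgrad (heis_ball R) u z))\<^sup>2) powr (p / 2))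
      (\<lambda>u. u \<in> obstacle_class p (heis_ball R) \<psi> u0) u\<epsilon>
    \<longrightarrow>
    (LINT z|lebesgue_on (heis_ball R).
        norm (hgrad \<Omega> u0 z - hgrad (heis_ball R) u\<epsilon> z) powr p)
      \<le> C * (1 + heis_avg R (\<lambda>z. norm (hgrad \<Omega> u0 z) powr p)) powr (1 - p / 2)
          * \<epsilon> powr ((p / 2)\<^sup>2) * R ^ (2 * (CARD('n) + 1))"
\<comment> \<open>The second factor comes from \<open>measure_heis_ball_le\<close>, so the constant
  involves only \<open>p\<close> and the dimension.\<close>
proof (intro exI[of _ "comparison_const p * 2 ^ (2 * CARD('n) + 1)"] conjI allI impI; (elim conjE)?)
  show "0 < comparison_const p * 2 ^ (2 * CARD('n) + 1)"
    by (simp add: comparison_const_pos)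
next
  fix \<Omega> \<Omega>' :: "'n heis set" and \<psi> g u0 u\<epsilon> :: "'n heis \<Rightarrow> real" and R \<epsilon> :: real
  assume U: "open \<Omega>" and R: "0 < R" and cc: "compactly_contained (heis_ball R) \<Omega>" and eps: "0 < \<epsilon>"
    and u0: "is_arg_min (\<lambda>u. LINT z|lebesgue_on \<Omega>. norm (hgrad \<Omega> u z) powr p)
      (\<lambda>u. u \<in> obstacle_class p \<Omega> \<psi> g) u0"
    and ue: "is_arg_min (\<lambda>u. LINT z|lebesgue_on (heis_ball R).
        (\<epsilon> + (norm (hgrad (heis_ball R) u z))\<^sup>2) powr (p / 2))
      (\<lambda>u. u \<in> obstacle_class p (heis_ball R) \<psi> u0) u\<epsilon>"
  define B where "B = (heis_ball R :: 'n heis set)"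
  have B: "open B" by (simp add: B_def open_heis_ball)
  have BU: "B \<subseteq> \<Omega>" using cc closure_subset[of B] by (auto simp: compactly_contained_def B_def)
  have Bm: "B \<in> lmeasurable" using heis_ball_lmeasurable[OF R] by (simp add: B_def)
  have Bs: "B \<in> sets lebesgue" and Us: "\<Omega> \<in> sets lebesgue" using B U by (simp_all add: borel_open)
  have u0c: "u0 \<in> obstacle_class p \<Omega> \<psi> g" and uec: "u\<epsilon> \<in> obstacle_class p B \<psi> u0"
    using u0 ue by (simp_all add: is_arg_min_def B_def)
  have h0: "u0 \<in> HW p \<Omega>" and he: "u\<epsilon> \<in> HW p B" using u0c uec by (auto simp: obstacle_class_def)
  define a where "a = hgrad \<Omega> u0"
  define b where "b = hgrad B u\<epsilon>"
  define \<mu> where "\<mu> = measure lebesgue B"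
  define I where "I = (LINT z|lebesgue_on B. norm (a z) powr p)"
  have I0: "0 \<le> I" by (simp add: I_def)
  have p0: "0 \<le> p" using assms by simp
  interpret finite_measure "lebesgue_on B" by (rule finite_measure_lebesgue_on[OF Bm])
  have am: "a \<in> borel_measurable (lebesgue_on B)"
    unfolding a_def by (rule measurable_restrict_mono[OF hgrad_measurable[OF U h0] BU])
  have ia: "integrable (lebesgue_on B) (\<lambda>z. norm (a z) powr p)"
  proof -
    have r: "u0 \<in> HW p B" by (rule HW_restrict(1)[OF B U BU h0])
    have "AE z in lebesgue_on B. \<forall>V\<in>hfields. weak_deriv B V u0 z = weak_deriv \<Omega> V u0 z"
      using HW_restrict(2)[OF B U BU h0] by (intro AE_finite_allI finite_hfields)
    then have "AE z in lebesgue_on B. norm (hgrad B u0 z) powr p = norm (a z) powr p"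
      by eventually_elim (simp add: hgrad_def hfields_def a_def)
    then show ?thesis
      using am by (intro integrable_cong_AE_imp[OF hgrad_powr_integrable[OF B p0 r]]) (measurable, simp)
  qed
  have main: "(LINT z|lebesgue_on B. norm (a z - b z) powr p)
      \<le> comparison_const p * ((\<mu> + I) powr (1 - p / 2) * \<mu> powr (p / 2) * \<epsilon> powr ((p / 2)\<^sup>2))"
    using minimizer_comparison[OF assms eps am hgrad_measurable[OF B he] ia hgrad_powr_integrable[OF B p0 he]]
      energy_le_on_subset[OF assms(1) B U BU u0 uec]
      regularized_energy_le[OF assms(1) B U BU u0c ue[folded B_def]] Bs
    by (simp add: a_def b_def I_def \<mu>_def measure_restrict_space)
  define A where "A = heis_avg R (\<lambda>z. norm (a z) powr p)"
  have A: "A = I / \<mu>" by (simp add: A_def heis_avg_def I_def \<mu>_def B_def)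
  have mu0: "0 \<le> \<mu>" by (simp add: \<mu>_def)
  have "(\<mu> + I) powr (1 - p / 2) * \<mu> powr (p / 2) \<le> (1 + A) powr (1 - p / 2) * \<mu>"
  \<comment> \<open>If \<open>\<mu>\<close> is 0, both sides are 0, so no lower bound for the
    measure of the ball is required. Otherwise \<open>\<mu> + I\<close> equals
    \<open>\<mu> * (1 + A)\<close>, and the exponents of \<open>\<mu>\<close> add up to 1.\<close>
  proof (cases "\<mu> = 0")
    case False
    then have mu: "\<mu> > 0" using mu0 by simp
    have "\<mu> + I = \<mu> * (1 + A)" using mu by (simp add: A field_simps)
    then have "(\<mu> + I) powr (1 - p / 2) * \<mu> powr (p / 2)
        = (1 + A) powr (1 - p / 2) * (\<mu> powr (1 - p / 2) * \<mu> powr (p / 2))"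
      by (simp add: powr_mult)
    also have "\<mu> powr (1 - p / 2) * \<mu> powr (p / 2) = \<mu>"
      using mu by (simp flip: powr_add)
    finally show ?thesis by simp
  qed simp
  also have "\<dots> \<le> (1 + A) powr (1 - p / 2) * (2 ^ (2 * CARD('n) + 1) * R ^ (2 * (CARD('n) + 1)))"
    using measure_heis_ball_le[OF R, where 'n = 'n] by (intro mult_left_mono) (auto simp: \<mu>_def B_def)
  finally have "comparison_const p * ((\<mu> + I) powr (1 - p / 2) * \<mu> powr (p / 2) * \<epsilon> powr ((p / 2)\<^sup>2))
      \<le> comparison_const p * ((1 + A) powr (1 - p / 2) * (2 ^ (2 * CARD('n) + 1) * R ^ (2 * (CARD('n) + 1)))
          * \<epsilon> powr ((p / 2)\<^sup>2))"
    using comparison_const_pos[of p] by (intro mult_left_mono mult_right_mono) auto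
  with main have "(LINT z|lebesgue_on B. norm (a z - b z) powr p)
      \<le> comparison_const p * 2 ^ (2 * CARD('n) + 1) * (1 + A) powr (1 - p / 2)
          * \<epsilon> powr ((p / 2)\<^sup>2) * R ^ (2 * (CARD('n) + 1))"
    by (simp add: mult_ac)
  then show "(LINT z|lebesgue_on (heis_ball R). norm (hgrad \<Omega> u0 z - hgrad (heis_ball R) u\<epsilon> z) powr p)
      \<le> comparison_const p * 2 ^ (2 * CARD('n) + 1)
          * (1 + heis_avg R (\<lambda>z. norm (hgrad \<Omega> u0 z) powr p)) powr (1 - p / 2)
          * \<epsilon> powr ((p / 2)\<^sup>2) * R ^ (2 * (CARD('n) + 1))"
    by (simp add: a_def b_def A_def B_def)
qed

end
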